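(* Let $U,V$ be two arbitrary non-trivial (non-empty and not equal to $\mathbf{R}^2$) simply connected domains of $\mathbf{R}^2$ and let $f:U\to V$ be a biholomorphic mapping. Then the Dirichlet forms $(\frac12\mathbf{D},H^1_0(U))$ and $(\frac12\mathbf{D},H^1_0(V))$ of the absorbing Brownian motions on $U$ and $V$ have the same structure of regular subspaces with respect to the conformal transformation $f$ and time change: writing $T$ for the spatial transformation by $f$ followed by the time change to Lebesgue measure on $V$, for every regular subspace $(\mathcal{E}'_V,\mathcal{F}'_V)$ of $(\frac12\mathbf{D},H^1_0(V))$ there exists a unique regular subspace $(\mathcal{E}'_U,\mathcal{F}'_U)$ of $(\frac12\mathbf{D},H^1_0(U))$ such that $(\mathcal{E}'_V,\mathcal{F}'_V)=T(\mathcal{E}'_U,\mathcal{F}'_U)$.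
   Context: For regular Dirichlet forms on the same $L^2$ space, $(\mathcal{E}',\mathcal{F}')$ is a regular subspace of $(\mathcal{E},\mathcal{F})$ if $\mathcal{F}'\subset\mathcal{F}$ and $\mathcal{E}=\mathcal{E}'$ on $\mathcal{F}'\times\mathcal{F}'$. (Regular: $\mathcal{F}\cap C_\mathrm{c}$ is dense in $\mathcal{F}$ in the norm $(\mathcal{E}(u,u)+\|u\|_{L^2}^2)^{1/2}$ and uniformly dense in $C_\mathrm{c}$.) For a domain $\Gamma$, $H^1_0(\Gamma)$ is the closure of $C_\mathrm{c}^\infty(\Gamma)$ in $H^1(\Gamma)$ and $\mathbf{D}(u,v)=\int_\Gamma\nabla u\cdot\nabla v\,dx$; $(\frac12\mathbf{D},H^1_0(\Gamma))$ on $L^2(\Gamma)$ is the regular Dirichlet form of absorbing Brownian motion on $\Gamma$. Spatial transformation: for a regular Dirichlet form $(\mathcal{E},\mathcal{F})$ on $L^2(U,dx)$, $f(\mathcal{E},\mathcal{F})=(\hat{\mathcal{E}},\hat{\mathcal{F}})$ is the form on $L^2(V,\hat m)$, $\hat m=dx|_U\circ f^{-1}$, with $\hat{\mathcal{F}}=\{\hat u\in L^2(V,\hat m):\hat u\circ f\in\mathcal{F}\}$, $\hat{\mathcal{E}}(\hat u,\hat v)=\mathcal{E}(\hat u\circ f,\hat v\circ f)$. Time change to Lebesgue measure: $T(\mathcal{E},\mathcal{F})$ is the form on $L^2(V,dx)$ with domain $\hat{\mathcal{F}}_\mathrm{e}\cap L^2(V,dx)$ and form $\hat{\mathcal{E}}$,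 where $\hat{\mathcal{F}}_\mathrm{e}$ is the extended Dirichlet space (the a.e. finite functions that are a.e. limits of $\hat{\mathcal{E}}$-Cauchy sequences in $\hat{\mathcal{F}}$, with $\hat{\mathcal{E}}$ extended to it). By conformal invariance of planar Brownian motion, $T(\frac12\mathbf{D},H^1_0(U))=(\frac12\mathbf{D},H^1_0(V))$. A biholomorphic $f:U\to V$ exists by the Riemann mapping theorem. *)

theory Defs
  imports "HOL-Analysis.Analysis"
begin

section \<open>Square integrable functions\<close>

text \<open>Elements of L2 spaces are represented by measurable functions, and linear subspaces of L2
  by sets of functions that are closed under almost everywhere equality.  The measures of interest
  live on a subset of the type; the values of a function off the space of the measure are
  irrelevant.\<close>

definition L2 :: "'a measure \<Rightarrow> ('a \<Rightarrow> real) set" where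
  "L2 M = {u \<in> borel_measurable M. integrable M (\<lambda>x. (u x)\<^sup>2)}"

definition L2_norm :: "'a measure \<Rightarrow> ('a \<Rightarrow> real) \<Rightarrow> real" where
  "L2_norm M u = sqrt (\<integral>x. (u x)\<^sup>2 \<partial>M)"

abbreviation dx_on :: "'a::euclidean_space set \<Rightarrow> 'a measure" where
  "dx_on \<Gamma> \<equiv> restrict_space lborel \<Gamma>"


section \<open>Regular Dirichlet forms\<close>

type_synonym 'a form = "(('a \<Rightarrow> real) \<times> ('a \<Rightarrow> real) \<Rightarrow> real) \<times> ('a \<Rightarrow> real) set"

definition form_norm ::
    "'a measure \<Rightarrow> (('a \<Rightarrow> real) \<times> ('a \<Rightarrow> real) \<Rightarrow> real) \<Rightarrow> ('a \<Rightarrow> real) \<Rightarrow> real" where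
  "form_norm M E u = sqrt (E (u, u) + (L2_norm M u)\<^sup>2)"

text \<open>The form is only meaningful on the product of its domain with itself; the extensionality
  condition fixes its values elsewhere, so that equality of pairs is equality of forms.\<close>

fun dirichlet_form :: "'a measure \<Rightarrow> 'a form \<Rightarrow> bool" where
  "dirichlet_form M (E, F) \<longleftrightarrow>
     E \<in> extensional (F \<times> F) \<and>
     F \<subseteq> L2 M \<and>
     (\<forall>u\<in>F. \<forall>v\<in>borel_measurable M. (AE x in M. u x = v x) \<longrightarrow> v \<in> F) \<and>
     (\<forall>u\<in>F. \<forall>u'\<in>F. \<forall>v\<in>F. (AE x in M. u x = u' x) \<longrightarrow> E (u, v) = E (u', v)) \<and>
     \<comment> \<open>dense linear subspace\<close>
     (\<lambda>x. 0) \<in> F \<and>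
     (\<forall>u\<in>F. \<forall>v\<in>F. (\<lambda>x. u x + v x) \<in> F) \<and>
     (\<forall>c. \<forall>u\<in>F. (\<lambda>x. c * u x) \<in> F) \<and>
     (\<forall>w\<in>L2 M. \<forall>\<epsilon>>0. \<exists>u\<in>F. L2_norm M (\<lambda>x. w x - u x) < \<epsilon>) \<and>
     \<comment> \<open>nonnegative symmetric bilinear form\<close>
     (\<forall>u\<in>F. \<forall>v\<in>F. E (u, v) = E (v, u)) \<and>
     (\<forall>u\<in>F. \<forall>v\<in>F. \<forall>w\<in>F. E (\<lambda>x. u x + v x, w) = E (u, w) + E (v, w)) \<and>
     (\<forall>c. \<forall>u\<in>F. \<forall>v\<in>F. E (\<lambda>x. c * u x, v) = c * E (u, v)) \<and>
     (\<forall>u\<in>F. 0 \<le> E (u, u)) \<and>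
     \<comment> \<open>closed\<close>
     (\<forall>us. (\<forall>n. us n \<in> F) \<and>
           (\<forall>\<epsilon>>0. \<exists>N. \<forall>m\<ge>N. \<forall>n\<ge>N. form_norm M E (\<lambda>x. us m x - us n x) < \<epsilon>) \<longrightarrow>
           (\<exists>u\<in>F. (\<lambda>n::nat. form_norm M E (\<lambda>x. us n x - u x)) \<longlonglongrightarrow> 0)) \<and>
     \<comment> \<open>Markovian: the unit contraction operates\<close>
     (\<forall>u\<in>F. (\<lambda>x. min (max 0 (u x)) 1) \<in> F \<and>
            E (\<lambda>x. min (max 0 (u x)) 1, \<lambda>x. min (max 0 (u x)) 1) \<le> E (u, u))"

definition Cc :: "'a::topological_space set \<Rightarrow> ('a \<Rightarrow> real) set" where
  "Cc \<Gamma> = {u. continuous_on UNIV u \<and> compact (closure {x. u x \<noteq> 0}) \<and> closure {x. u x \<noteq> 0} \<subseteq> \<Gamma>}"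

fun regular_dirichlet_form :: "'a::topological_space set \<Rightarrow> 'a measure \<Rightarrow> 'a form \<Rightarrow> bool" where
  "regular_dirichlet_form \<Gamma> M (E, F) \<longleftrightarrow>
     dirichlet_form M (E, F) \<and>
     (\<forall>u\<in>F. \<forall>\<epsilon>>0. \<exists>w\<in>F \<inter> Cc \<Gamma>. form_norm M E (\<lambda>x. u x - w x) < \<epsilon>) \<and>
     (\<forall>u\<in>Cc \<Gamma>. \<forall>\<epsilon>>0. \<exists>w\<in>F \<inter> Cc \<Gamma>. \<forall>x. \<bar>u x - w x\<bar> < \<epsilon>)"

fun regular_subspace ::
    "'a::topological_space set \<Rightarrow> 'a measure \<Rightarrow> 'a form \<Rightarrow> 'a form \<Rightarrow> bool" where
  "regular_subspace \<Gamma> M (E', F') (E, F) \<longleftrightarrow>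
     regular_dirichlet_form \<Gamma> M (E', F') \<and> regular_dirichlet_form \<Gamma> M (E, F) \<and>
     F' \<subseteq> F \<and> (\<forall>u\<in>F'. \<forall>v\<in>F'. E (u, v) = E' (u, v))"


section \<open>The Dirichlet form of absorbing Brownian motion\<close>

definition partial_deriv :: "'a::euclidean_space \<Rightarrow> ('a \<Rightarrow> real) \<Rightarrow> 'a \<Rightarrow> real" where
  "partial_deriv b u x = frechet_derivative u (at x) b"

primrec Ck :: "nat \<Rightarrow> ('a::euclidean_space \<Rightarrow> real) set" where
  "Ck 0 = {u. continuous_on UNIV u}"
| "Ck (Suc k) = {u. u differentiable_on UNIV \<and> (\<forall>b\<in>Basis. partial_deriv b u \<in> Ck k)}"

definition Cc_infinity :: "'a::euclidean_space set \<Rightarrow> ('a \<Rightarrow> real) set" where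
  "Cc_infinity \<Gamma> = Cc \<Gamma> \<inter> (\<Inter>k. Ck k)"

definition L2_weak_gradient ::
    "'a::euclidean_space set \<Rightarrow> ('a \<Rightarrow> real) \<Rightarrow> ('a \<Rightarrow> 'a) \<Rightarrow> bool" where
  "L2_weak_gradient \<Gamma> u g \<longleftrightarrow>
     (\<forall>b\<in>Basis. (\<lambda>x. g x \<bullet> b) \<in> L2 (dx_on \<Gamma>)) \<and>
     (\<forall>\<phi>\<in>Cc_infinity \<Gamma>. \<forall>b\<in>Basis.
        (\<integral>x. u x * partial_deriv b \<phi> x \<partial>dx_on \<Gamma>) = - (\<integral>x. (g x \<bullet> b) * \<phi> x \<partial>dx_on \<Gamma>))"

definition H1 :: "'a::euclidean_space set \<Rightarrow> ('a \<Rightarrow> real) set" where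
  "H1 \<Gamma> = {u \<in> L2 (dx_on \<Gamma>). \<exists>g. L2_weak_gradient \<Gamma> u g}"

text \<open>The choice is immaterial: weak gradients are unique up to almost everywhere equality.\<close>

definition weak_gradient :: "'a::euclidean_space set \<Rightarrow> ('a \<Rightarrow> real) \<Rightarrow> 'a \<Rightarrow> 'a" where
  "weak_gradient \<Gamma> u = (SOME g. L2_weak_gradient \<Gamma> u g)"

definition dirichlet_integral ::
    "'a::euclidean_space set \<Rightarrow> ('a \<Rightarrow> real) \<times> ('a \<Rightarrow> real) \<Rightarrow> real" where
  "dirichlet_integral \<Gamma> = (\<lambda>(u, v). \<integral>x. weak_gradient \<Gamma> u x \<bullet> weak_gradient \<Gamma> v x \<partial>dx_on \<Gamma>)"

text \<open>With the Dirichlet integral as form, \<open>form_norm\<close> is the norm of H1.\<close>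

definition H10 :: "'a::euclidean_space set \<Rightarrow> ('a \<Rightarrow> real) set" where
  "H10 \<Gamma> = {u \<in> H1 \<Gamma>. \<forall>\<epsilon>>0. \<exists>\<phi>\<in>Cc_infinity \<Gamma>.
              form_norm (dx_on \<Gamma>) (dirichlet_integral \<Gamma>) (\<lambda>x. u x - \<phi> x) < \<epsilon>}"

definition absorbing_BM_form :: "'a::euclidean_space set \<Rightarrow> 'a form" where
  "absorbing_BM_form \<Gamma> =
     (restrict (\<lambda>(u, v). 1/2 * dirichlet_integral \<Gamma> (u, v)) (H10 \<Gamma> \<times> H10 \<Gamma>), H10 \<Gamma>)"


section \<open>Spatial transformation and time change\<close>

definition image_measure ::
    "('a::euclidean_space \<Rightarrow> 'a) \<Rightarrow> 'a set \<Rightarrow> 'a set \<Rightarrow> 'a measure" where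
  "image_measure f U V = distr (dx_on U) (restrict_space borel V) f"

fun spatial_transform :: "('a \<Rightarrow> 'b) \<Rightarrow> 'b measure \<Rightarrow> 'a form \<Rightarrow> 'b form" where
  "spatial_transform f m (E, F) =
     (let F' = {u \<in> L2 m. u \<circ> f \<in> F}
      in (restrict (\<lambda>(u, v). E (u \<circ> f, v \<circ> f)) (F' \<times> F'), F'))"

fun approximates :: "'a measure \<Rightarrow> 'a form \<Rightarrow> (nat \<Rightarrow> 'a \<Rightarrow> real) \<Rightarrow> ('a \<Rightarrow> real) \<Rightarrow> bool" where
  "approximates m (E, F) us u \<longleftrightarrow>
     (\<forall>n. us n \<in> F) \<and>
     (\<forall>\<epsilon>>0. \<exists>N. \<forall>k\<ge>N. \<forall>n\<ge>N. E (\<lambda>x. us k x - us n x, \<lambda>x. us k x - us n x) < \<epsilon>) \<and>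
     (AE x in m. (\<lambda>n. us n x) \<longlonglongrightarrow> u x)"

text \<open>An almost everywhere finite function has a real-valued version.\<close>

definition extended_domain :: "'a measure \<Rightarrow> 'a form \<Rightarrow> ('a \<Rightarrow> real) set" where
  "extended_domain m A = {u \<in> borel_measurable m. \<exists>us. approximates m A us u}"

text \<open>The limit does not depend on the approximating sequences when \<open>A\<close> is a Dirichlet form.\<close>

definition extended_form ::
    "'a measure \<Rightarrow> 'a form \<Rightarrow> ('a \<Rightarrow> real) \<times> ('a \<Rightarrow> real) \<Rightarrow> real" where
  "extended_form m A = (\<lambda>(u, v). THE e. \<exists>us vs. approximates m A us u \<and> approximates m A vs v \<and>
     (\<lambda>n. fst A (us n, vs n)) \<longlonglongrightarrow> e)"

definition time_change :: "'a measure \<Rightarrow> 'a measure \<Rightarrow> 'a form \<Rightarrow> 'a form" where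
  "time_change m m' A =
     (let F' = extended_domain m A \<inter> L2 m'
      in (restrict (extended_form m A) (F' \<times> F'), F'))"

definition transform_and_time_change ::
    "('a::euclidean_space \<Rightarrow> 'a) \<Rightarrow> 'a set \<Rightarrow> 'a set \<Rightarrow> 'a form \<Rightarrow> 'a form" where
  "transform_and_time_change f U V A =
     time_change (image_measure f U V) (dx_on V) (spatial_transform f (image_measure f U V) A)"


section \<open>Domains and biholomorphic maps of the plane\<close>

text \<open>The plane is identified with the type of complex numbers, whose Euclidean structure
  (inner product, Lebesgue measure) is that of the real plane.\<close>

definition nontrivial_sc_domain :: "complex set \<Rightarrow> bool" where
  "nontrivial_sc_domain U \<longleftrightarrow>
     open U \<and> connected U \<and> simply_connected U \<and> U \<noteq> {} \<and> U \<noteq> UNIV"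

definition biholomorphic :: "(complex \<Rightarrow> complex) \<Rightarrow> complex set \<Rightarrow> complex set \<Rightarrow> bool" where
  "biholomorphic f U V \<longleftrightarrow>
     f holomorphic_on U \<and> bij_betw f U V \<and> the_inv_into U f holomorphic_on V"

end

theory Submission
  imports Defs "HOL-Complex_Analysis.Complex_Analysis"
begin

text \<open>
A regular subspace of the form of absorbing Brownian motion carries half the Dirichlet integral as
its form and is the closure, in the form norm, of its continuous members with compact support.  So
it is determined by these members, and they are the functions that a conformal map transports well:
composition with \<open>f\<close> maps \<open>Cc V\<close> onto \<open>Cc U\<close>, and it preserves the Dirichlet integral of smooth
functions, because the Cauchy--Riemann equations make the inner product of gradients scale by exactly
the Jacobian determinant (\<open>grad_pull\<close>, \<open>dirichlet_integral_pull_smooth\<close>).  The L2 norm is not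
preserved, but the L2 norms on \<open>U\<close> and \<open>V\<close> are comparable for functions supported in a fixed compact
set.  A cutoff function reduces members of \<open>H10 V\<close> with compact support to this case, so composition
preserves their Dirichlet integrals too (\<open>dirichlet_integral_pull\<close>).

Given a regular subspace on \<open>V\<close> with domain \<open>F\<close>, its counterpart on \<open>U\<close> has as domain the closure in
\<open>H10 U\<close> of the functions \<open>w \<circ> f\<close> with \<open>w\<close> in \<open>F \<inter> Cc V\<close> (\<open>pulled_domain\<close>).  It is a regular
Dirichlet form: the unit contraction operates on the core, and passes to the closure because an L2
limit of functions of bounded energy stays in the domain of a closed form (\<open>bounded_energy_limit\<close>);
uniform density is inherited from \<open>V\<close> and implies density in L2 by soft thresholding and the
fundamental lemma of the calculus of variations (\<open>regular_pulled_domain\<close>).  For \<open>F = H10 V\<close> the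
construction returns \<open>H10 U\<close>, so the ambient form on \<open>U\<close> is a regular Dirichlet form as well.

It remains to compare domains across the time change.  Its definition goes through the extended
Dirichlet space, and the link back is the identity \<open>F\<^sub>e \<inter> L2 = F\<close>, valid for every Dirichlet form
(\<open>extended_limit\<close>).  The proof here avoids resolvents: an approximating sequence \<open>u\<^sub>n\<close> is cut at the
absolute value of one of its own members \<open>u\<^sub>k\<close>.  The lattice operations keep the energy bounded, the
cut functions are dominated by \<open>\<bar>u\<^sub>k\<bar>\<close>, and their limit is dominated by the square integrable \<open>u\<close>; so
dominated convergence applies twice, first in \<open>n\<close> and then in \<open>k\<close>.  This identity on \<open>V\<close> shows that
\<open>pulled_domain F\<close> is transformed into \<open>F\<close> (\<open>transform_pulled_domain\<close>).  On \<open>U\<close> it shows that every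
regular subspace that is transformed into \<open>F\<close> has the same continuous members with compact support
as \<open>pulled_domain F\<close>, hence coincides with it (\<open>transform_inj\<close>).
\<close>

lemma tendsto_0_le_combination:
  fixes a b d :: "nat \<Rightarrow> real"
  assumes "\<And>n. 0 \<le> a n" "\<And>n. a n \<le> p * b n + q * d n" "b \<longlonglongrightarrow> 0" "d \<longlonglongrightarrow> 0"
  shows "a \<longlonglongrightarrow> 0"
proof (rule Lim_null_comparison)
  show "\<forall>\<^sub>F n in sequentially. norm (a n) \<le> p * b n + q * d n" using assms(1,2) by simp
  have "(\<lambda>n. p * b n + q * d n) \<longlonglongrightarrow> p * 0 + q * 0" by (intro tendsto_intros assms)
  then show "(\<lambda>n. p * b n + q * d n) \<longlonglongrightarrow> 0" by simp
qed

lemmas tendsto_0_le_scale = tendsto_0_le_combination[where q = 0 and d = "\<lambda>_. 0", simplified]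

section \<open>Nonnegative symmetric bilinear forms on spaces of functions\<close>

text \<open>The three inner products that occur below, on L2, on the domain of a form, and their sum, are all
  only semidefinite as long as functions are not identified almost everywhere.  What they share is
  developed once, for functions with values in any real vector space so that it also covers
  gradients.\<close>

locale psd_form =
  fixes F :: "('a \<Rightarrow> 'b::real_vector) set"
    and B :: "('a \<Rightarrow> 'b) \<times> ('a \<Rightarrow> 'b) \<Rightarrow> real"
  assumes zero_mem: "(\<lambda>x. 0) \<in> F"
    and add_mem: "u \<in> F \<Longrightarrow> v \<in> F \<Longrightarrow> (\<lambda>x. u x + v x) \<in> F"
    and scale_mem: "u \<in> F \<Longrightarrow> (\<lambda>x. c *\<^sub>R u x) \<in> F"
    and sym: "u \<in> F \<Longrightarrow> v \<in> F \<Longrightarrow> B (u, v) = B (v, u)"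
    and add_left: "u \<in> F \<Longrightarrow> v \<in> F \<Longrightarrow> w \<in> F \<Longrightarrow> B (\<lambda>x. u x + v x, w) = B (u, w) + B (v, w)"
    and scale_left: "u \<in> F \<Longrightarrow> v \<in> F \<Longrightarrow> B (\<lambda>x. c *\<^sub>R u x, v) = c * B (u, v)"
    and nonneg: "u \<in> F \<Longrightarrow> 0 \<le> B (u, u)"
begin

abbreviation sq :: "('a \<Rightarrow> 'b) \<Rightarrow> real" where "sq u \<equiv> B (u, u)"

abbreviation conv :: "(nat \<Rightarrow> 'a \<Rightarrow> 'b) \<Rightarrow> ('a \<Rightarrow> 'b) \<Rightarrow> bool" where
  "conv us u \<equiv> (\<lambda>n. sq (\<lambda>x. us n x - u x)) \<longlonglongrightarrow> 0"

lemma minus_mem: "u \<in> F \<Longrightarrow> (\<lambda>x. - u x) \<in> F"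
  using scale_mem[of u "-1"] by simp

lemma diff_mem: "u \<in> F \<Longrightarrow> v \<in> F \<Longrightarrow> (\<lambda>x. u x - v x) \<in> F"
  using add_mem[of u "\<lambda>x. - v x"] minus_mem by simp

lemma minus_left: "u \<in> F \<Longrightarrow> v \<in> F \<Longrightarrow> B (\<lambda>x. - u x, v) = - B (u, v)"
  using scale_left[of u v "-1"] by simp

lemma diff_left: "u \<in> F \<Longrightarrow> v \<in> F \<Longrightarrow> w \<in> F \<Longrightarrow> B (\<lambda>x. u x - v x, w) = B (u, w) - B (v, w)"
  using add_left[of u "\<lambda>x. - v x" w] minus_left[of v w] minus_mem by simp

lemma add_right: "u \<in> F \<Longrightarrow> v \<in> F \<Longrightarrow> w \<in> F \<Longrightarrow> B (w, \<lambda>x. u x + v x) = B (w, u) + B (w, v)"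
  by (simp add: add_left sym[of w "\<lambda>x. u x + v x"] add_mem sym[of w u] sym[of w v])

lemma scale_right: "u \<in> F \<Longrightarrow> v \<in> F \<Longrightarrow> B (v, \<lambda>x. c *\<^sub>R u x) = c * B (v, u)"
  by (simp add: scale_left sym[of v "\<lambda>x. c *\<^sub>R u x"] scale_mem sym[of v u])

lemma diff_right: "u \<in> F \<Longrightarrow> v \<in> F \<Longrightarrow> w \<in> F \<Longrightarrow> B (w, \<lambda>x. u x - v x) = B (w, u) - B (w, v)"
  by (simp add: diff_left sym[of w "\<lambda>x. u x - v x"] diff_mem sym[of w u] sym[of w v])

lemma sq_scale: "u \<in> F \<Longrightarrow> sq (\<lambda>x. c *\<^sub>R u x) = c\<^sup>2 * sq u"
  by (simp add: scale_left scale_right scale_mem power2_eq_square)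

lemma sq_minus: "u \<in> F \<Longrightarrow> sq (\<lambda>x. - u x) = sq u"
  using sq_scale[of u "-1"] by simp

lemma sq_add: "u \<in> F \<Longrightarrow> v \<in> F \<Longrightarrow> sq (\<lambda>x. u x + v x) = sq u + 2 * B (u, v) + sq v"
  using sym[of u v] by (simp add: add_left add_right add_mem)

lemma sq_diff: "u \<in> F \<Longrightarrow> v \<in> F \<Longrightarrow> sq (\<lambda>x. u x - v x) = sq u - 2 * B (u, v) + sq v"
  using sym[of u v] by (simp add: diff_left diff_right diff_mem)

lemma sq_diff_commute: "u \<in> F \<Longrightarrow> v \<in> F \<Longrightarrow> sq (\<lambda>x. u x - v x) = sq (\<lambda>x. v x - u x)"
  by (simp add: sq_diff sym)

lemma zero_left: "u \<in> F \<Longrightarrow> B (\<lambda>x. 0, u) = 0"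
  using scale_left[of u u 0] by simp

lemma parallelogram:
  "u \<in> F \<Longrightarrow> v \<in> F \<Longrightarrow> sq (\<lambda>x. u x + v x) + sq (\<lambda>x. u x - v x) = 2 * sq u + 2 * sq v"
  by (simp add: sq_add sq_diff)

lemma sq_add_le: "u \<in> F \<Longrightarrow> v \<in> F \<Longrightarrow> sq (\<lambda>x. u x + v x) \<le> 2 * sq u + 2 * sq v"
  using parallelogram[of u v] nonneg[OF diff_mem[of u v]] by simp

lemma sq_diff_le: "u \<in> F \<Longrightarrow> v \<in> F \<Longrightarrow> sq (\<lambda>x. u x - v x) \<le> 2 * sq u + 2 * sq v"
  using parallelogram[of u v] nonneg[OF add_mem[of u v]] by simp

lemma sq_triangle:
  assumes "u \<in> F" "v \<in> F" "w \<in> F"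
  shows "sq (\<lambda>x. u x - w x) \<le> 2 * sq (\<lambda>x. u x - v x) + 2 * sq (\<lambda>x. v x - w x)"
  using sq_add_le[OF diff_mem[OF assms(1,2)] diff_mem[OF assms(2,3)]] by simp

lemma sq_le_double: "u \<in> F \<Longrightarrow> v \<in> F \<Longrightarrow> sq u \<le> 2 * sq (\<lambda>x. u x - v x) + 2 * sq v"
  using sq_add_le[OF diff_mem[of u v], of v] by simp

lemma sq_midpoint_le:
  "u \<in> F \<Longrightarrow> v \<in> F \<Longrightarrow> sq (\<lambda>x. (1/2) *\<^sub>R (u x + v x)) \<le> (sq u + sq v) / 2"
  using sq_add_le[of u v] by (simp add: sq_scale add_mem power2_eq_square)

lemma cauchy_schwarz:
  assumes "u \<in> F" "v \<in> F"
  shows "(B (u, v))\<^sup>2 \<le> sq u * sq v"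
proof -
  have pos: "0 \<le> sq u - 2 * t * B (u, v) + t\<^sup>2 * sq v" for t
    using nonneg[OF diff_mem[OF assms(1) scale_mem[OF assms(2), of t]]]
    by (simp add: sq_diff sq_scale scale_right scale_mem assms)
  show ?thesis
  proof (cases "sq v = 0")
    case True
    have "B (u, v) = 0"
    proof (rule ccontr)
      assume "B (u, v) \<noteq> 0"
      with pos[of "(sq u + 1) / (2 * B (u, v))"] True show False by (simp add: field_simps)
    qed
    with True show ?thesis by simp
  next
    case False
    then have "sq v > 0" using nonneg[OF assms(2)] by simp
    with pos[of "B (u, v) / sq v"] show ?thesis
      by (simp add: power2_eq_square field_simps)
  qed
qed

lemma abs_le: "u \<in> F \<Longrightarrow> v \<in> F \<Longrightarrow> \<bar>B (u, v)\<bar> \<le> sqrt (sq u * sq v)"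
  using cauchy_schwarz[of u v] real_le_rsqrt[of "\<bar>B (u,v)\<bar>"] by simp

definition Cauchy_seq :: "(nat \<Rightarrow> 'a \<Rightarrow> 'b) \<Rightarrow> bool" where
  "Cauchy_seq us \<longleftrightarrow> (\<forall>\<epsilon>>0. \<exists>N. \<forall>m\<ge>N. \<forall>n\<ge>N. sq (\<lambda>x. us m x - us n x) < \<epsilon>)"

lemma Cauchy_seq_bounded:
  assumes "\<And>n. us n \<in> F" "Cauchy_seq us"
  obtains K where "K > 0" "\<And>n. sq (us n) \<le> K"
proof -
  obtain N where N: "\<And>m n. m \<ge> N \<Longrightarrow> n \<ge> N \<Longrightarrow> sq (\<lambda>x. us m x - us n x) < 1"
    using assms(2) unfolding Cauchy_seq_def by (meson zero_less_one)
  define K where "K = 2 + 2 * sq (us N) + (\<Sum>n\<le>N. sq (us n))"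
  have "sq (us n) \<le> K" for n
  proof (cases "n \<le> N")
    case True
    then have "sq (us n) \<le> (\<Sum>n\<le>N. sq (us n))"
      by (intro member_le_sum) (auto intro: nonneg assms)
    then show ?thesis unfolding K_def using nonneg[OF assms(1)[of N]] by linarith
  next
    case False
    then have "sq (us n) \<le> 2 * 1 + 2 * sq (us N)"
      using sq_le_double[OF assms(1)[of n] assms(1)[of N]] N[of n N] by simp
    then show ?thesis unfolding K_def
      using sum_nonneg[of "{..N}" "\<lambda>n. sq (us n)"] nonneg[OF assms(1)] by fastforce
  qed
  moreover have "K > 0" unfolding K_def
    using sum_nonneg[of "{..N}" "\<lambda>n. sq (us n)"] nonneg[OF assms(1)] by (smt (verit))
  ultimately show ?thesis using that by blast
qed

text \<open>The quantity \<open>d\<close> is arbitrary, so that the Cauchy property can be carried over between two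
  different forms.\<close>

lemma Cauchy_seq_dominated:
  assumes "Cauchy_seq us" "R > 0" and le: "\<And>m n. d m n \<le> R * sq (\<lambda>x. us m x - us n x)"
  shows "\<forall>\<epsilon>>0. \<exists>N. \<forall>m\<ge>N. \<forall>n\<ge>N. d m n < \<epsilon>"
proof (intro allI impI)
  fix \<epsilon> :: real assume "\<epsilon> > 0"
  then obtain N where N: "\<forall>m\<ge>N. \<forall>n\<ge>N. sq (\<lambda>x. us m x - us n x) < \<epsilon> / R"
    using assms(1,2) unfolding Cauchy_seq_def by (meson divide_pos_pos)
  have "d m n < \<epsilon>" if "m \<ge> N" "n \<ge> N" for m n
    using le[of m n] mult_strict_left_mono[OF N[rule_format, OF that] assms(2)] assms(2) by simp
  then show "\<exists>N. \<forall>m\<ge>N. \<forall>n\<ge>N. d m n < \<epsilon>" by blast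
qed

lemma convergent_Cauchy_seq:
  assumes "\<And>n. us n \<in> F" "u \<in> F" "(\<lambda>n. sq (\<lambda>x. us n x - u x)) \<longlonglongrightarrow> 0"
  shows "Cauchy_seq us"
  unfolding Cauchy_seq_def
proof (intro allI impI)
  fix \<epsilon> :: real assume "\<epsilon> > 0"
  then have "\<forall>\<^sub>F n in sequentially. sq (\<lambda>x. us n x - u x) < \<epsilon> / 4"
    using order_tendstoD(2)[OF assms(3), of "\<epsilon>/4"] by simp
  then obtain N where N: "\<And>n. n \<ge> N \<Longrightarrow> sq (\<lambda>x. us n x - u x) < \<epsilon> / 4"
    unfolding eventually_sequentially by blast
  show "\<exists>N. \<forall>m\<ge>N. \<forall>n\<ge>N. sq (\<lambda>x. us m x - us n x) < \<epsilon>"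
  proof (intro exI allI impI)
    fix m n assume "m \<ge> N" "n \<ge> N"
    then show "sq (\<lambda>x. us m x - us n x) < \<epsilon>"
      using sq_triangle[OF assms(1)[of m] assms(2) assms(1)[of n]] N[of m] N[of n]
        sq_diff_commute[OF assms(1)[of n] assms(2)] by linarith
  qed
qed

lemma Cauchy_seq_diff:
  assumes F: "\<And>n. us n \<in> F" "\<And>n. vs n \<in> F" and C: "Cauchy_seq us" "Cauchy_seq vs"
  shows "Cauchy_seq (\<lambda>n x. us n x - vs n x)"
  unfolding Cauchy_seq_def
proof (intro allI impI)
  fix \<epsilon> :: real assume "\<epsilon> > 0"
  then have e: "\<epsilon> / 4 > 0" by simp
  obtain N1 where N1: "\<forall>m\<ge>N1. \<forall>n\<ge>N1. sq (\<lambda>x. us m x - us n x) < \<epsilon> / 4"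
    using C(1) e unfolding Cauchy_seq_def by blast
  obtain N2 where N2: "\<forall>m\<ge>N2. \<forall>n\<ge>N2. sq (\<lambda>x. vs m x - vs n x) < \<epsilon> / 4"
    using C(2) e unfolding Cauchy_seq_def by blast
  show "\<exists>N. \<forall>m\<ge>N. \<forall>n\<ge>N. sq (\<lambda>x. us m x - vs m x - (us n x - vs n x)) < \<epsilon>"
  proof (intro exI[of _ "max N1 N2"] allI impI)
    fix m n assume mn: "max N1 N2 \<le> m" "max N1 N2 \<le> n"
    have eq: "(\<lambda>x. us m x - vs m x - (us n x - vs n x)) = (\<lambda>x. (us m x - us n x) - (vs m x - vs n x))"
      by (simp add: fun_eq_iff algebra_simps)
    have "sq (\<lambda>x. us m x - us n x) < \<epsilon> / 4" "sq (\<lambda>x. vs m x - vs n x) < \<epsilon> / 4" using N1 N2 mn by auto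
    then show "sq (\<lambda>x. us m x - vs m x - (us n x - vs n x)) < \<epsilon>"
      unfolding eq using sq_diff_le[OF diff_mem[OF F(1)[of m] F(1)[of n]] diff_mem[OF F(2)[of m] F(2)[of n]]] by linarith
  qed
qed

lemma tendsto_diff_forms:
  assumes F: "\<And>n. us n \<in> F" "\<And>n. us' n \<in> F" "\<And>n. vs n \<in> F" "\<And>n. vs' n \<in> F"
    and lim: "(\<lambda>n. sq (\<lambda>x. us n x - us' n x)) \<longlonglongrightarrow> 0" "(\<lambda>n. sq (\<lambda>x. vs n x - vs' n x)) \<longlonglongrightarrow> 0"
    and bound: "\<And>n. sq (us n) \<le> K" "\<And>n. sq (vs' n) \<le> K'"
  shows "(\<lambda>n. B (us n, vs n) - B (us' n, vs' n)) \<longlonglongrightarrow> 0"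
proof -
  let ?d = "\<lambda>n x. us n x - us' n x" and ?e = "\<lambda>n x. vs n x - vs' n x"
  have eq: "B (us n, vs n) - B (us' n, vs' n) = B (us n, ?e n) + B (?d n, vs' n)" for n
    using F by (simp add: diff_left diff_right)
  have "(\<lambda>n. B (us n, ?e n)) \<longlonglongrightarrow> 0"
  proof (rule Lim_null_comparison)
    show "\<forall>\<^sub>F n in sequentially. norm (B (us n, ?e n)) \<le> sqrt (K * sq (?e n))"
    proof (intro always_eventually allI)
      fix n
      have "\<bar>B (us n, ?e n)\<bar> \<le> sqrt (sq (us n) * sq (?e n))" by (intro abs_le diff_mem F)
      also have "\<dots> \<le> sqrt (K * sq (?e n))"
        by (intro real_sqrt_le_mono mult_right_mono bound nonneg diff_mem F)
      finally show "norm (B (us n, ?e n)) \<le> sqrt (K * sq (?e n))" by simp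
    qed
    have "(\<lambda>n. sqrt (K * sq (?e n))) \<longlonglongrightarrow> sqrt (K * 0)" by (intro tendsto_intros lim)
    then show "(\<lambda>n. sqrt (K * sq (?e n))) \<longlonglongrightarrow> 0" by simp
  qed
  moreover have "(\<lambda>n. B (?d n, vs' n)) \<longlonglongrightarrow> 0"
  proof (rule Lim_null_comparison)
    show "\<forall>\<^sub>F n in sequentially. norm (B (?d n, vs' n)) \<le> sqrt (sq (?d n) * K')"
    proof (intro always_eventually allI)
      fix n
      have "\<bar>B (?d n, vs' n)\<bar> \<le> sqrt (sq (?d n) * sq (vs' n))" by (intro abs_le diff_mem F)
      also have "\<dots> \<le> sqrt (sq (?d n) * K')"
        by (intro real_sqrt_le_mono mult_left_mono bound nonneg diff_mem F)
      finally show "norm (B (?d n, vs' n)) \<le> sqrt (sq (?d n) * K')" by simp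
    qed
    have "(\<lambda>n. sqrt (sq (?d n) * K')) \<longlonglongrightarrow> sqrt (0 * K')" by (intro tendsto_intros lim)
    then show "(\<lambda>n. sqrt (sq (?d n) * K')) \<longlonglongrightarrow> 0" by simp
  qed
  ultimately show ?thesis unfolding eq using tendsto_add by fastforce
qed

lemma tendsto_form:
  assumes F: "\<And>n. us n \<in> F" "\<And>n. vs n \<in> F" "u \<in> F" "v \<in> F"
    and lim: "(\<lambda>n. sq (\<lambda>x. us n x - u x)) \<longlonglongrightarrow> 0" "(\<lambda>n. sq (\<lambda>x. vs n x - v x)) \<longlonglongrightarrow> 0"
  shows "(\<lambda>n. B (us n, vs n)) \<longlonglongrightarrow> B (u, v)"
proof -
  obtain K where "\<And>n. sq (us n) \<le> K"
    using Cauchy_seq_bounded[OF F(1) convergent_Cauchy_seq[OF F(1,3) lim(1)]] by blast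
  then have "(\<lambda>n. B (us n, vs n) - B (u, v)) \<longlonglongrightarrow> 0"
    using tendsto_diff_forms[OF F(1) F(3) F(2) F(4) lim] by blast
  then show ?thesis by (simp add: LIM_zero_iff)
qed

lemma tendsto_form_right:
  assumes "\<And>n. us n \<in> F" "u \<in> F" "v \<in> F" "(\<lambda>n. sq (\<lambda>x. us n x - u x)) \<longlonglongrightarrow> 0"
  shows "(\<lambda>n. B (us n, v)) \<longlonglongrightarrow> B (u, v)"
  using tendsto_form[of us "\<lambda>_. v" u v] assms zero_mem zero_left by simp

text \<open>By the parallelogram identity: since the sets are midpoint convex and decreasing, the midpoint of
  two almost minimal elements cannot have much smaller energy than the elements themselves, so that
  the energy of their difference is small.\<close>

lemma minimizing_Cauchy_seq:
  assumes sub: "\<And>n. C n \<subseteq> F" and dec: "\<And>m n. m \<le> n \<Longrightarrow> C n \<subseteq> C m"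
    and mid: "\<And>n u v. u \<in> C n \<Longrightarrow> v \<in> C n \<Longrightarrow> (\<lambda>x. (1/2) *\<^sub>R (u x + v x)) \<in> C n"
    and ne: "\<And>n. \<exists>u\<in>C n. sq u \<le> K"
  obtains vs where "\<And>n. vs n \<in> C n" "Cauchy_seq vs" 
proof -
  define d where "d n = Inf (sq ` C n)" for n
  have bdd: "bdd_below (sq ` C n)" for n
    by (rule bdd_belowI[of _ 0]) (use sub nonneg in auto)
  have ne': "C n \<noteq> {}" for n using ne[of n] by auto
  have d_le: "d n \<le> sq u" if "u \<in> C n" for n u
    unfolding d_def using that by (intro cInf_lower bdd) auto
  have d_mono: "d m \<le> d n" if "m \<le> n" for m n
    unfolding d_def using dec[OF that] ne' by (intro cInf_superset_mono bdd) auto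
  have d_K: "d n \<le> K" for n using ne[of n] d_le[of _ n] by force
  define e :: "nat \<Rightarrow> real" where "e n = 1 / real (Suc n)" for n
  have "\<exists>u\<in>C n. sq u < d n + e n" for n :: nat
  proof -
    have "Inf (sq ` C n) < d n + e n" unfolding d_def e_def by simp
    then show ?thesis using cInf_lessD[of "sq ` C n"] ne'[of n] by auto
  qed
  then obtain vs where vs: "\<And>n::nat. vs n \<in> C n" "\<And>n. sq (vs n) < d n + e n" by metis
  have close: "sq (\<lambda>x. vs m x - vs n x) \<le> 2 * d n - 2 * d m + 4 * e m" if "m \<le> n" for m n :: nat
  proof -
    have mem: "vs m \<in> C m" "vs n \<in> C m" using vs dec[OF that] by auto
    then have memF: "vs m \<in> F" "vs n \<in> F" using sub by auto
    have "d m \<le> sq (\<lambda>x. (1/2) *\<^sub>R (vs m x + vs n x))" using d_le mid mem by blast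
    then have "4 * d m \<le> sq (\<lambda>x. vs m x + vs n x)"
      by (subst (asm) sq_scale) (auto intro: add_mem memF simp: power2_eq_square)
    moreover have "e n \<le> e m" using that by (simp add: frac_le e_def)
    ultimately show ?thesis
      using parallelogram[OF memF] vs(2)[of m] vs(2)[of n] by linarith
  qed
  have "incseq d" using d_mono by (auto intro: monoI)
  then obtain L where "d \<longlonglongrightarrow> L" using incseq_convergent[of d K] d_K by blast
  then have "Cauchy d" by (rule LIMSEQ_imp_Cauchy)
  have "Cauchy_seq vs" unfolding Cauchy_seq_def
  proof (intro allI impI)
    fix \<epsilon> :: real assume "\<epsilon> > 0"
    obtain N1 where N1: "\<And>m n. m \<ge> N1 \<Longrightarrow> n \<ge> N1 \<Longrightarrow> \<bar>d m - d n\<bar> < \<epsilon> / 8"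
      using \<open>Cauchy d\<close> \<open>\<epsilon> > 0\<close> unfolding Cauchy_def dist_real_def by (metis zero_less_divide_iff zero_less_numeral)
    obtain N2 :: nat where N2: "N2 > 8 / \<epsilon>" using reals_Archimedean2 by blast
    have small: "sq (\<lambda>x. vs m x - vs n x) < \<epsilon>" if "m \<ge> max N1 N2" "m \<le> n" for m n
    proof -
      have "8 / \<epsilon> < real m + 1" using N2 that by linarith
      then have "4 * e m < \<epsilon> / 2" using \<open>\<epsilon> > 0\<close> by (simp add: field_simps e_def)
      moreover have "\<bar>d n - d m\<bar> < \<epsilon> / 8" using N1 that by auto
      ultimately show ?thesis using close[OF that(2)] by linarith
    qed
    have memF: "vs n \<in> F" for n using vs sub by blast
    show "\<exists>N. \<forall>m\<ge>N. \<forall>n\<ge>N. sq (\<lambda>x. vs m x - vs n x) < \<epsilon>"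
    proof (intro exI[of _ "max N1 N2"] allI impI)
      fix m n assume "m \<ge> max N1 N2" "n \<ge> max N1 N2"
      then show "sq (\<lambda>x. vs m x - vs n x) < \<epsilon>"
        using small[of m n] small[of n m] sq_diff_commute[OF memF[of m] memF[of n]] by (cases "m \<le> n") auto
    qed
  qed
  with vs that show ?thesis by blast
qed

lemma psd_form_subspace:
  assumes "G \<subseteq> F" "(\<lambda>x. 0) \<in> G" "\<And>u v. u \<in> G \<Longrightarrow> v \<in> G \<Longrightarrow> (\<lambda>x. u x + v x) \<in> G"
    "\<And>c u. u \<in> G \<Longrightarrow> (\<lambda>x. c *\<^sub>R u x) \<in> G"
  shows "psd_form G B"
proof
  note sub = subsetD[OF assms(1)]
  fix u v w and c :: real assume m: "u \<in> G" "v \<in> G" "w \<in> G"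
  note F = m[THEN sub]
  show "B (u, v) = B (v, u)" by (rule sym[OF F(1,2)])
  show "B (\<lambda>x. u x + v x, w) = B (u, w) + B (v, w)" by (rule add_left[OF F])
  show "B (\<lambda>x. c *\<^sub>R u x, v) = c * B (u, v)" by (rule scale_left[OF F(1,2)])
  show "0 \<le> B (u, u)" by (rule nonneg[OF F(1)])
qed (intro assms; assumption)+

definition sq_closure :: "('a \<Rightarrow> 'b) set \<Rightarrow> ('a \<Rightarrow> 'b) set" where
  "sq_closure C = {u \<in> F. \<forall>\<epsilon>>0. \<exists>v\<in>C. sq (\<lambda>x. u x - v x) < \<epsilon>}"

lemma sq_closure_sub: "sq_closure C \<subseteq> F"
  by (auto simp: sq_closure_def)

lemma sq_closureI:
  assumes "C \<subseteq> F" "u \<in> F" "\<And>n::nat. vs n \<in> C" "conv vs u"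
  shows "u \<in> sq_closure C"
  unfolding sq_closure_def
proof (intro CollectI conjI allI impI assms(2))
  fix \<epsilon> :: real assume "\<epsilon> > 0"
  then obtain n where "sq (\<lambda>x. vs n x - u x) < \<epsilon>"
    using order_tendstoD(2)[OF assms(4)] eventually_happens'[OF sequentially_bot] by blast
  moreover have "vs n \<in> F" using assms(1,3) by blast
  ultimately show "\<exists>v\<in>C. sq (\<lambda>x. u x - v x) < \<epsilon>"
    using sq_diff_commute[OF assms(2), of "vs n"] assms(3) by (intro bexI[of _ "vs n"]) auto
qed

lemma sq_closure_base: "C \<subseteq> F \<Longrightarrow> u \<in> C \<Longrightarrow> u \<in> sq_closure C"
  by (rule sq_closureI[where vs = "\<lambda>_. u"]) (auto simp: zero_left zero_mem)

lemma sq_closureE: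
  assumes "C \<subseteq> F" "u \<in> sq_closure C"
  obtains vs where "\<And>n::nat. vs n \<in> C" "conv vs u"
proof -
  have u: "u \<in> F" using assms(2) by (simp add: sq_closure_def)
  have "\<forall>n. \<exists>v. v \<in> C \<and> sq (\<lambda>x. u x - v x) < 1 / real (Suc n)"
    using assms(2) unfolding sq_closure_def by (simp add: Bex_def)
  from choice[OF this] obtain vs where vs: "\<And>n. vs n \<in> C" "\<And>n. sq (\<lambda>x. u x - vs n x) < 1 / real (Suc n)"
    by blast
  have vsF: "vs n \<in> F" for n using vs(1) assms(1) by blast
  have "conv vs u"
  proof (rule tendsto_0_le_scale[where p = 1])
    show "0 \<le> sq (\<lambda>x. vs n x - u x)" for n by (rule nonneg[OF diff_mem[OF vsF u]])
    show "sq (\<lambda>x. vs n x - u x) \<le> 1 * (1 / real (Suc n))" for n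
      using vs(2)[of n] unfolding sq_diff_commute[OF u vsF] by linarith
    show "(\<lambda>n. 1 / real (Suc n)) \<longlonglongrightarrow> 0" by (intro LIMSEQ_Suc lim_1_over_n)
  qed
  with vs(1) that show ?thesis by blast
qed

lemma sq_closure_idem:
  assumes C: "C \<subseteq> F" and u: "u \<in> F" and vs: "\<And>n::nat. vs n \<in> sq_closure C" "conv vs u"
  shows "u \<in> sq_closure C"
  unfolding sq_closure_def
proof (intro CollectI conjI allI impI u)
  fix \<epsilon> :: real assume "\<epsilon> > 0"
  then have e: "\<epsilon> / 4 > 0" by simp
  obtain n where n: "sq (\<lambda>x. vs n x - u x) < \<epsilon> / 4"
    using order_tendstoD(2)[OF vs(2) e] eventually_happens'[OF sequentially_bot] by blast
  obtain w where w: "w \<in> C" "sq (\<lambda>x. vs n x - w x) < \<epsilon> / 4"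
    using vs(1)[of n] e unfolding sq_closure_def by blast
  have F: "vs n \<in> F" "w \<in> F" using vs(1) sq_closure_sub w(1) C by blast+
  have "sq (\<lambda>x. u x - w x) < \<epsilon>"
    using sq_triangle[OF u F] sq_diff_commute[OF u F(1)] n w(2) by linarith
  with w(1) show "\<exists>v\<in>C. sq (\<lambda>x. u x - v x) < \<epsilon>" by blast
qed

lemma conv_add:
  assumes "\<And>n. us n \<in> F" "\<And>n. vs n \<in> F" "u \<in> F" "v \<in> F" "conv us u" "conv vs v"
  shows "conv (\<lambda>n x. us n x + vs n x) (\<lambda>x. u x + v x)"
proof (rule tendsto_0_le_combination[OF _ _ assms(5,6), where p = 2 and q = 2])
  fix n
  have d: "(\<lambda>x. us n x - u x) \<in> F" "(\<lambda>x. vs n x - v x) \<in> F" by (intro diff_mem assms)+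
  have eq: "(\<lambda>x. us n x + vs n x - (u x + v x)) = (\<lambda>x. (us n x - u x) + (vs n x - v x))"
    by (simp add: fun_eq_iff)
  show "0 \<le> sq (\<lambda>x. us n x + vs n x - (u x + v x))"
    unfolding eq by (rule nonneg[OF add_mem[OF d]])
  show "sq (\<lambda>x. us n x + vs n x - (u x + v x)) \<le> 2 * sq (\<lambda>x. us n x - u x) + 2 * sq (\<lambda>x. vs n x - v x)"
    unfolding eq by (rule sq_add_le[OF d])
qed

lemma psd_form_sq_closure:
  assumes C: "C \<subseteq> F" "(\<lambda>x. 0) \<in> C" "\<And>u v. u \<in> C \<Longrightarrow> v \<in> C \<Longrightarrow> (\<lambda>x. u x + v x) \<in> C"
    "\<And>c u. u \<in> C \<Longrightarrow> (\<lambda>x. c *\<^sub>R u x) \<in> C"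
  shows "psd_form (sq_closure C) B"
proof (rule psd_form_subspace[OF sq_closure_sub])
  note sub = sq_closure_sub[of C, THEN subsetD]
  show "(\<lambda>x. 0) \<in> sq_closure C" by (rule sq_closure_base[OF C(1,2)])
  fix u assume u: "u \<in> sq_closure C"
  obtain us where us: "\<And>n::nat. us n \<in> C" "conv us u" using sq_closureE[OF C(1) u] by blast
  have usF: "us n \<in> F" for n using us C by auto
  show "(\<lambda>x. c *\<^sub>R u x) \<in> sq_closure C" for c
  proof (rule sq_closureI[OF C(1) scale_mem[OF sub[OF u]]])
    show "(\<lambda>x. c *\<^sub>R us n x) \<in> C" for n by (rule C(4)[OF us(1)])
    have "(\<lambda>n. c\<^sup>2 * sq (\<lambda>x. us n x - u x)) \<longlonglongrightarrow> c\<^sup>2 * 0" by (intro tendsto_intros us)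
    moreover have "(\<lambda>x. c *\<^sub>R us n x - c *\<^sub>R u x) = (\<lambda>x. c *\<^sub>R (us n x - u x))" for n
      by (simp add: scaleR_right_diff_distrib)
    ultimately show "conv (\<lambda>n x. c *\<^sub>R us n x) (\<lambda>x. c *\<^sub>R u x)"
      by (simp add: sq_scale[OF diff_mem[OF usF sub[OF u]]])
  qed
  fix v assume v: "v \<in> sq_closure C"
  obtain vs where vs: "\<And>n::nat. vs n \<in> C" "conv vs v" using sq_closureE[OF C(1) v] by blast
  have vsF: "vs n \<in> F" for n using vs C by auto
  show "(\<lambda>x. u x + v x) \<in> sq_closure C"
    by (rule sq_closureI[OF C(1) add_mem[OF sub[OF u] sub[OF v]]
          C(3)[OF us(1) vs(1)] conv_add[OF usF vsF sub[OF u] sub[OF v] us(2) vs(2)]])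
qed

end

section \<open>Square integrable functions\<close>

text \<open>Gradients are treated on the same footing as functions, hence the vector valued version of the
  space L2.\<close>

definition sq_int :: "'a measure \<Rightarrow> ('a \<Rightarrow> 'b::euclidean_space) set" where
  "sq_int M = {g \<in> borel_measurable M. integrable M (\<lambda>x. (norm (g x))\<^sup>2)}"

definition sq_inner :: "'a measure \<Rightarrow> ('a \<Rightarrow> 'b::euclidean_space) \<times> ('a \<Rightarrow> 'b) \<Rightarrow> real" where
  "sq_inner M = (\<lambda>(g, h). \<integral>x. g x \<bullet> h x \<partial>M)"

abbreviation mean_sq :: "'a measure \<Rightarrow> ('a \<Rightarrow> 'b::euclidean_space) \<Rightarrow> real" where
  "mean_sq M u \<equiv> sq_inner M (u, u)"

abbreviation mean_conv :: "'a measure \<Rightarrow> (nat \<Rightarrow> 'a \<Rightarrow> 'b::euclidean_space) \<Rightarrow> ('a \<Rightarrow> 'b) \<Rightarrow> bool" where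
  "mean_conv M us u \<equiv> (\<lambda>n. sq_inner M (\<lambda>x. us n x - u x, \<lambda>x. us n x - u x)) \<longlonglongrightarrow> 0"

lemma L2_eq_sq_int: "L2 M = sq_int M"
  by (simp add: L2_def sq_int_def)

lemma L2_norm_eq: "L2_norm M u = sqrt (mean_sq M u)"
  by (simp add: L2_norm_def sq_inner_def power2_eq_square)

lemma sq_int_measurable [measurable_dest]: "g \<in> sq_int M \<Longrightarrow> g \<in> borel_measurable M"
  by (simp add: sq_int_def)

lemma sq_int_norm_sq: "g \<in> sq_int M \<Longrightarrow> integrable M (\<lambda>x. (norm (g x))\<^sup>2)"
  by (simp add: sq_int_def)

lemma sq_inner_self: "mean_sq M g = (\<integral>x. (norm (g x))\<^sup>2 \<partial>M)"
  by (simp add: sq_inner_def power2_norm_eq_inner)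

lemma integrable_inner_sq_int:
  fixes g h :: "'a \<Rightarrow> 'b::euclidean_space"
  assumes "g \<in> sq_int M" "h \<in> sq_int M"
  shows "integrable M (\<lambda>x. g x \<bullet> h x)"
proof (rule Bochner_Integration.integrable_bound)
  show "integrable M (\<lambda>x. (norm (g x))\<^sup>2 + (norm (h x))\<^sup>2)"
    by (intro Bochner_Integration.integrable_add sq_int_norm_sq assms)
  show "(\<lambda>x. g x \<bullet> h x) \<in> borel_measurable M"
    using assms[THEN sq_int_measurable] by measurable
  have "\<bar>g x \<bullet> h x\<bar> \<le> (norm (g x))\<^sup>2 + (norm (h x))\<^sup>2" for x
  proof -
    have "0 \<le> norm (g x) * norm (h x)" by simp
    moreover have "2 * (norm (g x) * norm (h x)) \<le> (norm (g x))\<^sup>2 + (norm (h x))\<^sup>2"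
      using sum_squares_bound[of "norm (g x)" "norm (h x)"] by (simp add: mult.assoc)
    ultimately show ?thesis using Cauchy_Schwarz_ineq2[of "g x" "h x"] by linarith
  qed
  then show "AE x in M. norm (g x \<bullet> h x) \<le> norm ((norm (g x))\<^sup>2 + (norm (h x))\<^sup>2)" by simp
qed

lemma sq_int_bound:
  assumes "g \<in> sq_int M" "h \<in> borel_measurable M" "AE x in M. norm (h x) \<le> norm (g x)"
  shows "h \<in> sq_int M"
proof -
  have "integrable M (\<lambda>x. (norm (h x))\<^sup>2)"
  proof (rule Bochner_Integration.integrable_bound[OF sq_int_norm_sq[OF assms(1)]])
    show "(\<lambda>x. (norm (h x))\<^sup>2) \<in> borel_measurable M" using assms(2) by measurable
    show "AE x in M. norm ((norm (h x))\<^sup>2) \<le> norm ((norm (g x))\<^sup>2)"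
      using assms(3) by eventually_elim (simp add: power_mono)
  qed
  with assms(2) show ?thesis by (simp add: sq_int_def)
qed

lemma sq_int_dominated:
  fixes g :: "'a \<Rightarrow> 'b::euclidean_space" and h :: "'a \<Rightarrow> 'c::euclidean_space"
  assumes h: "h \<in> sq_int M" and g: "g \<in> borel_measurable M" and le: "\<And>x. norm (g x) \<le> C * norm (h x)"
  shows "g \<in> sq_int M" "mean_sq M g \<le> C\<^sup>2 * mean_sq M h"
proof -
  have le2: "(norm (g x))\<^sup>2 \<le> C\<^sup>2 * (norm (h x))\<^sup>2" for x
    using power_mono[OF le[of x], of 2] by (simp add: power_mult_distrib)
  have int: "integrable M (\<lambda>x. C\<^sup>2 * (norm (h x))\<^sup>2)" using sq_int_norm_sq[OF h] by simp
  have "integrable M (\<lambda>x. (norm (g x))\<^sup>2)"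
    by (rule Bochner_Integration.integrable_bound[OF int]) (use g le2 in \<open>auto intro!: AE_I2\<close>)
  with g show gi: "g \<in> sq_int M" by (simp add: sq_int_def)
  have "(\<integral>x. (norm (g x))\<^sup>2 \<partial>M) \<le> (\<integral>x. C\<^sup>2 * (norm (h x))\<^sup>2 \<partial>M)"
    by (rule integral_mono[OF sq_int_norm_sq[OF gi] int le2])
  then show "mean_sq M g \<le> C\<^sup>2 * mean_sq M h" by (simp add: sq_inner_self)
qed

interpretation sq_int: psd_form "sq_int M" "sq_inner M" for M :: "'a measure"
proof
  fix u v :: "'a \<Rightarrow> 'b" and c :: real
  assume uv: "u \<in> sq_int M" "v \<in> sq_int M"
  note [measurable] = uv[THEN sq_int_measurable]
  have "integrable M (\<lambda>x. (norm (u x))\<^sup>2 + 2 * (u x \<bullet> v x) + (norm (v x))\<^sup>2)"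
    by (intro Bochner_Integration.integrable_add integrable_mult_right sq_int_norm_sq
        integrable_inner_sq_int uv)
  moreover have "(norm (u x + v x))\<^sup>2 = (norm (u x))\<^sup>2 + 2 * (u x \<bullet> v x) + (norm (v x))\<^sup>2" for x
    by (simp add: power2_norm_eq_inner inner_add_left inner_add_right inner_commute)
  ultimately show "(\<lambda>x. u x + v x) \<in> sq_int M"
    by (simp add: sq_int_def)
  show "sq_inner M (u, v) = sq_inner M (v, u)"
    by (simp add: sq_inner_def inner_commute)
  show "0 \<le> mean_sq M u"
    by (simp add: sq_inner_def)
next
  fix u :: "'a \<Rightarrow> 'b" and c :: real
  assume u: "u \<in> sq_int M"
  then show "(\<lambda>x. c *\<^sub>R u x) \<in> sq_int M"
    by (auto simp: sq_int_def power_mult_distrib intro: borel_measurable_scaleR)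
  fix v :: "'a \<Rightarrow> 'b" assume v: "v \<in> sq_int M"
  show "sq_inner M (\<lambda>x. c *\<^sub>R u x, v) = c * sq_inner M (u, v)"
    by (simp add: sq_inner_def)
next
  fix u v w :: "'a \<Rightarrow> 'b"
  assume "u \<in> sq_int M" "v \<in> sq_int M" "w \<in> sq_int M"
  then show "sq_inner M (\<lambda>x. u x + v x, w) = sq_inner M (u, w) + sq_inner M (v, w)"
    by (simp add: sq_inner_def inner_add_left Bochner_Integration.integral_add integrable_inner_sq_int)
qed (simp add: sq_int_def)

lemma sq_inner_AE_cong:
  assumes "AE x in M. u x = u' x" "AE x in M. v x = v' x"
    "u \<in> borel_measurable M" "u' \<in> borel_measurable M" "v \<in> borel_measurable M" "v' \<in> borel_measurable M"
  shows "sq_inner M (u, v) = sq_inner M (u', v')"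
  unfolding sq_inner_def prod.case
  by (rule integral_cong_AE) (use assms in \<open>auto intro: borel_measurable_inner\<close>)

lemma sq_inner_zero_iff:
  assumes "g \<in> sq_int M"
  shows "mean_sq M g = 0 \<longleftrightarrow> (AE x in M. g x = 0)"
  unfolding sq_inner_self
  by (subst integral_nonneg_eq_0_iff_AE[OF sq_int_norm_sq[OF assms]]) auto

lemma sq_int_AE_subseq:
  assumes "\<And>n. g n \<in> sq_int M" "(\<lambda>n. mean_sq M (g n)) \<longlonglongrightarrow> 0"
  obtains r :: "nat \<Rightarrow> nat" where "strict_mono r" "AE x in M. (\<lambda>n. g (r n) x) \<longlonglongrightarrow> 0"
proof -
  have "\<exists>r::nat\<Rightarrow>nat. strict_mono r \<and> (AE x in M. (\<lambda>n. (norm (g (r n) x))\<^sup>2) \<longlonglongrightarrow> 0)"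
    by (rule tendsto_L1_AE_subseq) (use assms in \<open>auto simp: sq_int_norm_sq sq_inner_self\<close>)
  then obtain r :: "nat \<Rightarrow> nat" where r: "strict_mono r" "AE x in M. (\<lambda>n. (norm (g (r n) x))\<^sup>2) \<longlonglongrightarrow> 0"
    by blast
  have "(\<lambda>n. g (r n) x) \<longlonglongrightarrow> 0" if "(\<lambda>n. (norm (g (r n) x))\<^sup>2) \<longlonglongrightarrow> 0" for x
    using tendsto_real_sqrt[OF that] by (simp add: tendsto_norm_zero_iff)
  with r that show ?thesis by (metis (no_types, lifting) eventually_mono)
qed

text \<open>Riesz--Fischer: along a subsequence whose increments have squares of integral at most
  \<open>4\<^sup>-\<^sup>k\<close>, the increments are almost everywhere summable; Fatou's lemma turns the pointwise limit
  into a limit in the mean.\<close>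

lemma sq_int_complete:
  fixes g :: "nat \<Rightarrow> 'a \<Rightarrow> 'b::euclidean_space"
  assumes g: "\<And>n. g n \<in> sq_int M" and Cauchy: "sq_int.Cauchy_seq M g"
  obtains h where "h \<in> sq_int M" "mean_conv M g h"
proof -
  note [measurable] = g[THEN sq_int_measurable]
  note Cauchy' = Cauchy[unfolded sq_int.Cauchy_seq_def]
  define Q where "Q u = mean_sq M u" for u :: "'a \<Rightarrow> 'b"
  have "\<exists>N. \<forall>m\<ge>N. \<forall>n\<ge>N. Q (\<lambda>x. g m x - g n x) < (1/4) ^ k" for k :: nat
    using Cauchy' unfolding Q_def by (metis zero_less_divide_1_iff zero_less_numeral zero_less_power)
  then obtain N where N: "\<And>k m n. m \<ge> N k \<Longrightarrow> n \<ge> N k \<Longrightarrow> Q (\<lambda>x. g m x - g n x) < (1/4) ^ k"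
    by metis
  define r where "r k = (\<Sum>i\<le>k. N i) + k" for k
  have rN: "r k \<ge> N k" for k
    unfolding r_def by (metis atMost_iff finite_atMost le_add1 le_trans member_le_sum order_refl zero_le)
  have r_Suc: "r (Suc k) \<ge> r k" for k unfolding r_def by simp
  define d where "d k x = g (r (Suc k)) x - g (r k) x" for k x
  have d_int: "d k \<in> sq_int M" for k unfolding d_def by (intro sq_int.diff_mem g)
  note [measurable] = d_int[THEN sq_int_measurable]
  have dQ: "Q (d k) \<le> (1/4) ^ k" for k
    using N[where m = "r (Suc k)" and n = "r k" and k = k] rN[of k] r_Suc[of k] unfolding d_def by simp
  have d_nn: "(\<integral>\<^sup>+x. ennreal (2 ^ k * (norm (d k x))\<^sup>2) \<partial>M) \<le> ennreal ((1/2) ^ k)" for k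
  proof -
    have "(\<integral>\<^sup>+x. ennreal (2 ^ k * (norm (d k x))\<^sup>2) \<partial>M) = ennreal (2 ^ k * Q (d k))"
      by (subst nn_integral_eq_integral) (auto simp: Q_def sq_inner_self sq_int_norm_sq d_int)
    also have "\<dots> \<le> ennreal (2 ^ k * (1/4) ^ k)"
      by (intro ennreal_leI mult_left_mono dQ) simp
    also have "(2::real) ^ k * (1/4) ^ k = (1/2) ^ k" by (simp flip: power_mult_distrib)
    finally show ?thesis .
  qed
  have "(\<integral>\<^sup>+x. (\<Sum>k. ennreal (2 ^ k * (norm (d k x))\<^sup>2)) \<partial>M)
      = (\<Sum>k. \<integral>\<^sup>+x. ennreal (2 ^ k * (norm (d k x))\<^sup>2) \<partial>M)"
    by (intro nn_integral_suminf) measurable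
  also have "\<dots> \<le> (\<Sum>k. ennreal ((1/2) ^ k))" by (intro suminf_le d_nn) auto
  also have "\<dots> = ennreal (\<Sum>k. (1/2) ^ k)" by (intro suminf_ennreal2) auto
  also have "\<dots> < \<infinity>" by simp
  finally have fin: "(\<integral>\<^sup>+x. (\<Sum>k. ennreal (2 ^ k * (norm (d k x))\<^sup>2)) \<partial>M) \<noteq> \<infinity>" by simp
  have "AE x in M. (\<Sum>k. ennreal (2 ^ k * (norm (d k x))\<^sup>2)) \<noteq> \<infinity>"
    by (rule nn_integral_noteq_infinite[OF _ fin]) measurable
  then have conv: "AE x in M. convergent (\<lambda>k. g (r k) x)"
  proof eventually_elim
    case (elim x)
    then have s1: "summable (\<lambda>k. 2 ^ k * (norm (d k x))\<^sup>2)"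
      by (intro summable_suminf_not_top) (auto simp: top_ennreal_def infinity_ennreal_def)
    have "summable (\<lambda>k. norm (d k x))"
    proof (rule summable_comparison_test')
      show "summable (\<lambda>k. 2 ^ k * (norm (d k x))\<^sup>2 + (1/2) ^ k)"
        by (intro summable_add s1) simp
      fix k :: nat
      define a where "a = norm (d k x)"
      \<comment> \<open>The geometric mean inequality splits the increment into two summable parts.\<close>
      define P :: real where "P = 2 ^ k"
      have "P > 0" unfolding P_def by simp
      have "P * (a - 1 / P)\<^sup>2 = P * a\<^sup>2 - 2 * a + 1 / P"
        using \<open>P > 0\<close> by (simp add: power2_eq_square field_simps)
      moreover have "0 \<le> P * (a - 1 / P)\<^sup>2" "a \<ge> 0" using \<open>P > 0\<close> unfolding a_def by auto
      ultimately have "a \<le> P * a\<^sup>2 + 1 / P" by linarith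
      then have "a \<le> 2 ^ k * a\<^sup>2 + (1/2) ^ k" by (simp add: P_def power_divide)
      then show "norm (norm (d k x)) \<le> 2 ^ k * (norm (d k x))\<^sup>2 + (1/2) ^ k" by (simp add: a_def)
    qed
    then have "summable (\<lambda>k. d k x)" by (rule summable_norm_cancel)
    then have "convergent (\<lambda>n. \<Sum>k<n. d k x)" by (simp add: summable_iff_convergent)
    moreover have "(\<Sum>k<n. d k x) = g (r n) x - g (r 0) x" for n
      unfolding d_def by (rule sum_lessThan_telescope)
    ultimately have "convergent (\<lambda>n. (g (r n) x - g (r 0) x) + g (r 0) x)"
      by (intro convergent_add convergent_const) simp
    then show ?case by simp
  qed
  define h where "h x = lim (\<lambda>k. g (r k) x)" for x
  have h_meas [measurable]: "h \<in> borel_measurable M" unfolding h_def by measurable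
  have h_lim: "AE x in M. (\<lambda>k. g (r k) x) \<longlonglongrightarrow> h x"
    using conv by eventually_elim (simp add: h_def convergent_LIMSEQ_iff)
  have small: "(\<integral>\<^sup>+x. ennreal ((norm (g m x - h x))\<^sup>2) \<partial>M) \<le> ennreal ((1/4) ^ K)" if "m \<ge> N K" for m K
  proof -
    have "(\<integral>\<^sup>+x. ennreal ((norm (g m x - h x))\<^sup>2) \<partial>M)
        = (\<integral>\<^sup>+x. liminf (\<lambda>k. ennreal ((norm (g m x - g (r k) x))\<^sup>2)) \<partial>M)"
    proof (rule nn_integral_cong_AE)
      show "AE x in M. ennreal ((norm (g m x - h x))\<^sup>2) = liminf (\<lambda>k. ennreal ((norm (g m x - g (r k) x))\<^sup>2))"
        using h_lim
      proof eventually_elim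
        case (elim x)
        have "(\<lambda>k. ennreal ((norm (g m x - g (r k) x))\<^sup>2)) \<longlonglongrightarrow> ennreal ((norm (g m x - h x))\<^sup>2)"
          by (intro tendsto_ennrealI tendsto_intros elim)
        then show ?case by (intro lim_imp_Liminf[symmetric]) auto
      qed
    qed
    also have "\<dots> \<le> liminf (\<lambda>k. \<integral>\<^sup>+x. ennreal ((norm (g m x - g (r k) x))\<^sup>2) \<partial>M)"
      by (intro nn_integral_liminf) measurable
    also have "\<dots> \<le> ennreal ((1/4) ^ K)"
    proof (rule Liminf_le)
      show "\<forall>\<^sub>F k in sequentially. (\<integral>\<^sup>+x. ennreal ((norm (g m x - g (r k) x))\<^sup>2) \<partial>M) \<le> ennreal ((1/4) ^ K)"
        unfolding eventually_sequentially
      proof (intro exI[of _ K] allI impI)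
        fix k assume "k \<ge> K"
        have "incseq r" using r_Suc by (rule incseq_SucI)
        then have "r k \<ge> N K" using rN[of K] \<open>k \<ge> K\<close> by (meson incseqD le_trans)
        then have "Q (\<lambda>x. g m x - g (r k) x) < (1/4) ^ K" using N that by blast
        moreover have "(\<integral>\<^sup>+x. ennreal ((norm (g m x - g (r k) x))\<^sup>2) \<partial>M) = ennreal (Q (\<lambda>x. g m x - g (r k) x))"
          unfolding Q_def sq_inner_self
          by (rule nn_integral_eq_integral[OF sq_int_norm_sq[OF sq_int.diff_mem[OF g g]]]) simp
        ultimately show "(\<integral>\<^sup>+x. ennreal ((norm (g m x - g (r k) x))\<^sup>2) \<partial>M) \<le> ennreal ((1/4) ^ K)"
          by (simp add: ennreal_leI)
      qed
    qed simp
    finally show ?thesis .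
  qed
  have diff_int: "(\<lambda>x. g m x - h x) \<in> sq_int M" if "m \<ge> N K" for m K
  proof -
    have "integrable M (\<lambda>x. (norm (g m x - h x))\<^sup>2)"
      using small[OF that] by (intro integrableI_bounded) (auto intro: le_less_trans)
    then show ?thesis by (simp add: sq_int_def)
  qed
  have "(\<lambda>x. g (N 0) x - (g (N 0) x - h x)) \<in> sq_int M"
    by (rule sq_int.diff_mem[OF g diff_int[of 0]]) simp
  then have h_int: "h \<in> sq_int M" by simp
  have "(\<lambda>n. Q (\<lambda>x. g n x - h x)) \<longlonglongrightarrow> 0"
  proof (rule LIMSEQ_I)
    fix e :: real assume "e > 0"
    obtain K where K: "(1/4) ^ K < e" using real_arch_pow_inv[OF \<open>e > 0\<close>, of "1/4"] by auto
    have "norm (Q (\<lambda>x. g n x - h x) - 0) < e" if "n \<ge> N K" for n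
    proof -
      have "ennreal (Q (\<lambda>x. g n x - h x)) = (\<integral>\<^sup>+x. ennreal ((norm (g n x - h x))\<^sup>2) \<partial>M)"
        unfolding Q_def sq_inner_self
        by (rule nn_integral_eq_integral[OF sq_int_norm_sq[OF sq_int.diff_mem[OF g h_int]], symmetric]) simp
      also have "\<dots> \<le> ennreal ((1/4) ^ K)" by (rule small[OF that])
      finally have "Q (\<lambda>x. g n x - h x) \<le> (1/4) ^ K" by (subst (asm) ennreal_le_iff) auto
      moreover have "Q (\<lambda>x. g n x - h x) \<ge> 0" unfolding Q_def by (intro sq_int.nonneg sq_int.diff_mem g h_int)
      ultimately show ?thesis using K by simp
    qed
    then show "\<exists>no. \<forall>n\<ge>no. norm (Q (\<lambda>x. g n x - h x) - 0) < e" by blast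
  qed
  with h_int that show ?thesis unfolding Q_def by blast
qed

text \<open>The differences to \<open>w\<close> along a minimizing sequence converge, and their limit \<open>h\<close> is the error of
  the orthogonal projection of \<open>w\<close>: it is orthogonal to the subspace, hence zero.\<close>

lemma sq_int_denseI:
  fixes w :: "'a \<Rightarrow> 'b::euclidean_space"
  assumes sub: "F \<subseteq> sq_int M" and zero: "(\<lambda>x. 0) \<in> F"
    and add: "\<And>u v. u \<in> F \<Longrightarrow> v \<in> F \<Longrightarrow> (\<lambda>x. u x + v x) \<in> F"
    and scale: "\<And>c u. u \<in> F \<Longrightarrow> (\<lambda>x. c *\<^sub>R u x) \<in> F"
    and orth: "\<And>h. h \<in> sq_int M \<Longrightarrow> \<forall>u\<in>F. sq_inner M (h, u) = 0 \<Longrightarrow> AE x in M. h x = 0"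
    and w: "w \<in> sq_int M" and "\<epsilon> > 0"
  shows "\<exists>u\<in>F. mean_sq M (\<lambda>x. w x - u x) < \<epsilon>"
proof -
  define d where "d = Inf ((\<lambda>u. mean_sq M (\<lambda>x. w x - u x)) ` F)"
  let ?C = "\<lambda>n::nat. {v. \<exists>u\<in>F. v = (\<lambda>x. w x - u x) \<and> mean_sq M v \<le> d + 1 / real (Suc n)}"
  have bdd: "bdd_below ((\<lambda>u. mean_sq M (\<lambda>x. w x - u x)) ` F)"
    by (rule bdd_belowI[of _ 0]) (use sub w in \<open>auto intro!: sq_int.nonneg sq_int.diff_mem\<close>)
  have d_le: "d \<le> mean_sq M (\<lambda>x. w x - u x)" if "u \<in> F" for u
    unfolding d_def using that by (intro cInf_lower bdd) auto
  have ne: "\<exists>v\<in>?C n. mean_sq M v \<le> d + 1" for n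
  proof -
    have "d < d + 1 / real (Suc n)" by simp
    then obtain u where u: "u \<in> F" "mean_sq M (\<lambda>x. w x - u x) < d + 1 / real (Suc n)"
      unfolding d_def using cInf_lessD[of "(\<lambda>u. mean_sq M (\<lambda>x. w x - u x)) ` F"] zero
      by (smt (verit) imageE image_is_empty empty_iff)
    have "1 / real (Suc n) \<le> 1" by simp
    with u(2) have "mean_sq M (\<lambda>x. w x - u x) \<le> d + 1" by linarith
    with u show ?thesis by (intro bexI[of _ "\<lambda>x. w x - u x"]) (auto simp del: of_nat_Suc)
  qed
  obtain vs where vs: "\<And>n. vs n \<in> ?C n" "sq_int.Cauchy_seq M vs"
  proof (rule sq_int.minimizing_Cauchy_seq[where M = M and C = ?C and K = "d + 1"])
    show "?C n \<subseteq> sq_int M" for n using sub w by (auto intro!: sq_int.diff_mem)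
    show "?C n \<subseteq> ?C m" if "m \<le> n" for m n
    proof -
      have "1 / real (Suc n) \<le> 1 / real (Suc m)" using that by (simp add: frac_le)
      then show ?thesis by (smt (verit) Collect_mono)
    qed
    show "(\<lambda>x. (1/2) *\<^sub>R (u x + v x)) \<in> ?C n" if "u \<in> ?C n" "v \<in> ?C n" for n u v
    proof -
      from that obtain a b where ab: "a \<in> F" "b \<in> F" and uv: "u = (\<lambda>x. w x - a x)" "v = (\<lambda>x. w x - b x)"
        and le: "mean_sq M u \<le> d + 1 / real (Suc n)" "mean_sq M v \<le> d + 1 / real (Suc n)" by auto
      have "u \<in> sq_int M" "v \<in> sq_int M" unfolding uv using ab sub w by (auto intro!: sq_int.diff_mem)
      from sq_int.sq_midpoint_le[OF this] le
      have "mean_sq M (\<lambda>x. (1/2) *\<^sub>R (u x + v x)) \<le> d + 1 / real (Suc n)" by argo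
      moreover have "(\<lambda>x. (1/2) *\<^sub>R (u x + v x)) = (\<lambda>x. w x - (1/2) *\<^sub>R (a x + b x))"
        unfolding uv by (auto simp: fun_eq_iff algebra_simps simp flip: scaleR_left.add)
      ultimately show ?thesis using scale[OF add[OF ab], of "1/2"] by auto
    qed
    show "\<exists>v\<in>?C n. mean_sq M v \<le> d + 1" for n by (rule ne)
  qed (use that in blast)
  have vs_int: "vs n \<in> sq_int M" for n using vs(1)[of n] sub w by (auto intro!: sq_int.diff_mem)
  obtain h where h: "h \<in> sq_int M" "mean_conv M vs h"
    using sq_int_complete[OF vs_int vs(2)] by blast
  have lim: "(\<lambda>n. mean_sq M (vs n)) \<longlonglongrightarrow> mean_sq M h"
    using sq_int.tendsto_form[OF vs_int vs_int h(1) h(1) h(2) h(2)] .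
  have hd: "mean_sq M h \<le> d"
  proof (rule LIMSEQ_le[OF lim])
    have "(\<lambda>n. d + 1 / real (Suc n)) \<longlonglongrightarrow> d + 0" by (intro tendsto_intros LIMSEQ_Suc lim_1_over_n)
    then show "(\<lambda>n. d + 1 / real (Suc n)) \<longlonglongrightarrow> d" by simp
    show "\<exists>N. \<forall>n\<ge>N. mean_sq M (vs n) \<le> d + 1 / real (Suc n)" using vs(1) by fastforce
  qed
  \<comment> \<open>On the line from \<open>h\<close> in the direction of \<open>u\<close> the norm is minimal at \<open>h\<close>.\<close>
  have "sq_inner M (h, u) = 0" if u: "u \<in> F" for u
  proof -
    have u': "u \<in> sq_int M" using u sub by auto
    have ge: "d \<le> mean_sq M h - 2 * t * sq_inner M (h, u) + t\<^sup>2 * mean_sq M u" for t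
    proof -
      have tu: "(\<lambda>x. t *\<^sub>R u x) \<in> sq_int M" by (rule sq_int.scale_mem[OF u'])
      have "(\<lambda>n. mean_sq M (\<lambda>x. vs n x - t *\<^sub>R u x))
          \<longlonglongrightarrow> mean_sq M (\<lambda>x. h x - t *\<^sub>R u x)"
        by (intro sq_int.tendsto_form sq_int.diff_mem vs_int tu h(1)) (use h(2) in simp_all)
      moreover have "d \<le> mean_sq M (\<lambda>x. vs n x - t *\<^sub>R u x)" for n
      proof -
        obtain a where a: "a \<in> F" "vs n = (\<lambda>x. w x - a x)" using vs(1)[of n] by auto
        show ?thesis using d_le[OF add[OF a(1) scale[OF u, of t]]] by (simp add: a(2) algebra_simps)
      qed
      ultimately have "d \<le> mean_sq M (\<lambda>x. h x - t *\<^sub>R u x)"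
        using LIMSEQ_le_const by blast
      then show ?thesis
        by (simp add: sq_int.sq_diff[OF h(1) tu] sq_int.sq_scale[OF u'] sq_int.scale_right[OF u' h(1)])
    qed
    have key: "2 * t * sq_inner M (h, u) \<le> t\<^sup>2 * mean_sq M u" for t using ge[of t] hd by linarith
    show ?thesis
    proof (rule ccontr)
      assume ne: "sq_inner M (h, u) \<noteq> 0"
      define b q where "b = sq_inner M (h, u)" and "q = mean_sq M u + 1"
      have q: "q > 0" unfolding q_def using sq_int.nonneg[OF u'] by linarith
      have "2 * (b / q) * b \<le> (b / q)\<^sup>2 * (q - 1)" using key[of "b / q"] unfolding b_def q_def by simp
      also have "\<dots> \<le> (b / q)\<^sup>2 * q" by (intro mult_left_mono) auto
      also have "\<dots> = b\<^sup>2 / q" using q by (simp add: power2_eq_square)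
      finally have "2 * b\<^sup>2 / q \<le> b\<^sup>2 / q" by (simp add: power2_eq_square)
      then have "b\<^sup>2 \<le> 0" using q by (simp add: field_simps)
      then show False using ne by (simp add: b_def)
    qed
  qed
  then have "AE x in M. h x = 0" using orth h(1) by blast
  then have "mean_sq M h = 0" using sq_inner_zero_iff[OF h(1)] by simp
  then have "\<forall>\<^sub>F n in sequentially. mean_sq M (vs n) < \<epsilon>"
    using order_tendstoD(2)[OF lim, of \<epsilon>] \<open>\<epsilon> > 0\<close> by simp
  then obtain n where n: "mean_sq M (vs n) < \<epsilon>" using eventually_happens'[OF sequentially_bot] by blast
  obtain a where "a \<in> F" "vs n = (\<lambda>x. w x - a x)" using vs(1)[of n] by auto
  with n show ?thesis by auto
qed

lemma sq_int_dominated_tendsto_0: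
  fixes g :: "nat \<Rightarrow> 'a \<Rightarrow> 'b::euclidean_space" and w :: "'a \<Rightarrow> 'c::euclidean_space"
  assumes [measurable]: "\<And>n. g n \<in> borel_measurable M" and w: "w \<in> sq_int M"
    and bound: "\<And>n. AE x in M. norm (g n x) \<le> norm (w x)"
    and lim: "AE x in M. (\<lambda>n. g n x) \<longlonglongrightarrow> 0"
  shows "(\<lambda>n. mean_sq M (g n)) \<longlonglongrightarrow> 0"
proof -
  have "(\<lambda>n. \<integral>x. (norm (g n x))\<^sup>2 \<partial>M) \<longlonglongrightarrow> (\<integral>x. 0 \<partial>M)"
  proof (rule integral_dominated_convergence[where w = "\<lambda>x. (norm (w x))\<^sup>2"])
    show "integrable M (\<lambda>x. (norm (w x))\<^sup>2)" by (rule sq_int_norm_sq[OF w])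
    show "AE x in M. (\<lambda>n. (norm (g n x))\<^sup>2) \<longlonglongrightarrow> 0"
      using lim by eventually_elim (auto intro!: tendsto_eq_intros)
    show "AE x in M. norm ((norm (g n x))\<^sup>2) \<le> (norm (w x))\<^sup>2" for n
      using bound[of n] by eventually_elim (simp add: power_mono)
  qed measurable
  then show ?thesis by (simp add: sq_inner_self)
qed

section \<open>Closed forms and Dirichlet forms\<close>

text \<open>A form on a space of square integrable functions; \<open>E1\<close> is the inner product that belongs to
  its form norm.\<close>

locale L2_form = psd_form F E
  for M :: "'a measure" and F :: "('a \<Rightarrow> real) set" and E +
  assumes sub_sq_int: "F \<subseteq> sq_int M"
begin

lemma mem_sq_int: "u \<in> F \<Longrightarrow> u \<in> sq_int M"
  using sub_sq_int by blast

lemma mem_measurable [measurable_dest]: "u \<in> F \<Longrightarrow> u \<in> borel_measurable M"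
  using mem_sq_int sq_int_measurable by blast

definition E1 :: "('a \<Rightarrow> real) \<times> ('a \<Rightarrow> real) \<Rightarrow> real" where
  "E1 = (\<lambda>(u, v). E (u, v) + sq_inner M (u, v))"

lemma E1_apply: "E1 (u, v) = E (u, v) + sq_inner M (u, v)"
  by (simp add: E1_def)

lemma psd_form_E1: "psd_form F E1"
proof
  fix u v w and c :: real assume m: "u \<in> F" "v \<in> F" "w \<in> F"
  note L = m[THEN mem_sq_int]
  show "E1 (\<lambda>x. u x + v x, w) = E1 (u, w) + E1 (v, w)"
    by (simp add: E1_apply add_left[OF m] sq_int.add_left[OF L])
  show "E1 (\<lambda>x. c *\<^sub>R u x, v) = c * E1 (u, v)"
    unfolding E1_apply scale_left[OF m(1,2)] sq_int.scale_left[OF L(1,2)] by (simp add: distrib_left)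
  show "E1 (u, v) = E1 (v, u)"
    unfolding E1_apply using sym[OF m(1,2)] sq_int.sym[OF L(1,2)] by linarith
  show "0 \<le> E1 (u, u)"
    unfolding E1_apply using nonneg[OF m(1)] sq_int.nonneg[OF L(1)] by linarith
qed (intro zero_mem add_mem scale_mem; assumption)+

sublocale E1: psd_form F E1 by (rule psd_form_E1)

lemma sq_le_E1: "sq u \<le> E1 (u, u)" "u \<in> F \<Longrightarrow> mean_sq M u \<le> E1 (u, u)"
  using nonneg[of u] by (simp_all add: E1_apply sq_inner_self)

lemma E1_tendsto_0_iff:
  assumes us: "\<And>n. us n \<in> F"
  shows "(\<lambda>n. E1 (us n, us n)) \<longlonglongrightarrow> 0 \<longleftrightarrow> (\<lambda>n. sq (us n)) \<longlonglongrightarrow> 0 \<and> (\<lambda>n. mean_sq M (us n)) \<longlonglongrightarrow> 0"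
proof (intro iffI conjI)
  assume L: "(\<lambda>n. E1 (us n, us n)) \<longlonglongrightarrow> 0"
  show "(\<lambda>n. sq (us n)) \<longlonglongrightarrow> 0"
    by (rule tendsto_0_le_scale[OF nonneg[OF us] _ L, where p = 1]) (use sq_le_E1 in simp)
  show "(\<lambda>n. mean_sq M (us n)) \<longlonglongrightarrow> 0"
    by (rule tendsto_0_le_scale[OF sq_int.nonneg[OF mem_sq_int[OF us]] _ L, where p = 1]) (use sq_le_E1(2)[OF us] in simp)
next
  assume "(\<lambda>n. sq (us n)) \<longlonglongrightarrow> 0 \<and> (\<lambda>n. mean_sq M (us n)) \<longlonglongrightarrow> 0"
  then have "(\<lambda>n. sq (us n) + mean_sq M (us n)) \<longlonglongrightarrow> 0 + 0"
    by (intro tendsto_add) auto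
  then show "(\<lambda>n. E1 (us n, us n)) \<longlonglongrightarrow> 0" by (simp add: E1_apply)
qed

lemma E1_conv_iff:
  "(\<And>n. us n \<in> F) \<Longrightarrow> u \<in> F \<Longrightarrow> E1.conv us u \<longleftrightarrow> conv us u \<and> mean_conv M us u"
  using E1_tendsto_0_iff[of "\<lambda>n x. us n x - u x"] diff_mem by blast

lemma E1_Cauchy_seq_iff:
  assumes us: "\<And>n. us n \<in> F"
  shows "E1.Cauchy_seq us \<longleftrightarrow> Cauchy_seq us \<and> sq_int.Cauchy_seq M us"
proof (intro iffI conjI)
  assume L: "E1.Cauchy_seq us"
  show "Cauchy_seq us" "sq_int.Cauchy_seq M us"
    using L sq_le_E1 diff_mem[OF us us] unfolding Cauchy_seq_def sq_int.Cauchy_seq_def E1.Cauchy_seq_def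
    by (meson order.strict_trans1)+
next
  assume R: "Cauchy_seq us \<and> sq_int.Cauchy_seq M us"
  show "E1.Cauchy_seq us" unfolding E1.Cauchy_seq_def
  proof (intro allI impI)
    fix \<epsilon> :: real assume "\<epsilon> > 0"
    then have e: "\<epsilon> / 2 > 0" by simp
    obtain N1 where N1: "\<forall>m\<ge>N1. \<forall>n\<ge>N1. sq (\<lambda>x. us m x - us n x) < \<epsilon> / 2"
      using R e unfolding Cauchy_seq_def by blast
    obtain N2 where N2: "\<forall>m\<ge>N2. \<forall>n\<ge>N2. mean_sq M (\<lambda>x. us m x - us n x) < \<epsilon> / 2"
      using R e unfolding sq_int.Cauchy_seq_def by blast
    show "\<exists>N. \<forall>m\<ge>N. \<forall>n\<ge>N. E1.sq (\<lambda>x. us m x - us n x) < \<epsilon>"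
    proof (intro exI[of _ "max N1 N2"] allI impI)
      fix m n assume "m \<ge> max N1 N2" "n \<ge> max N1 N2"
      then have "sq (\<lambda>x. us m x - us n x) < \<epsilon> / 2" "mean_sq M (\<lambda>x. us m x - us n x) < \<epsilon> / 2"
        using N1 N2 by auto
      then show "E1.sq (\<lambda>x. us m x - us n x) < \<epsilon>" unfolding E1_apply by linarith
    qed
  qed
qed

lemma form_norm_eq: "form_norm M E u = sqrt (E1 (u, u))"
  by (simp add: form_norm_def L2_norm_eq sq_inner_self E1_apply)

lemma form_norm_less_iff: "\<epsilon> > 0 \<Longrightarrow> form_norm M E u < \<epsilon> \<longleftrightarrow> E1 (u, u) < \<epsilon>\<^sup>2"
  unfolding form_norm_eq by (metis less_eq_real_def real_sqrt_abs abs_of_nonneg real_sqrt_less_iff)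

lemma E1_less_iff: "\<epsilon> > 0 \<Longrightarrow> E1 (u, u) < \<epsilon> \<longleftrightarrow> form_norm M E u < sqrt \<epsilon>"
  unfolding form_norm_eq by simp

lemma form_norm_Cauchy_iff:
  "(\<forall>\<epsilon>>0. \<exists>N. \<forall>m\<ge>N. \<forall>n\<ge>N. form_norm M E (\<lambda>x. us m x - us n x) < \<epsilon>) \<longleftrightarrow> E1.Cauchy_seq us"
  (is "?L \<longleftrightarrow> _")
proof
  assume L: ?L
  show "E1.Cauchy_seq us" unfolding E1.Cauchy_seq_def
  proof (intro allI impI)
    fix \<epsilon> :: real assume e: "\<epsilon> > 0"
    then have "sqrt \<epsilon> > 0" by simp
    with L show "\<exists>N. \<forall>m\<ge>N. \<forall>n\<ge>N. E1.sq (\<lambda>x. us m x - us n x) < \<epsilon>"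
      unfolding E1_less_iff[OF e] by blast
  qed
next
  assume R: "E1.Cauchy_seq us"
  show ?L
  proof (intro allI impI)
    fix \<epsilon> :: real assume e: "\<epsilon> > 0"
    then have "\<epsilon>\<^sup>2 > 0" by simp
    with R show "\<exists>N. \<forall>m\<ge>N. \<forall>n\<ge>N. form_norm M E (\<lambda>x. us m x - us n x) < \<epsilon>"
      unfolding form_norm_less_iff[OF e] E1.Cauchy_seq_def by blast
  qed
qed

lemma form_norm_tendsto_0_iff:
  assumes us: "\<And>n. us n \<in> F"
  shows "(\<lambda>n. form_norm M E (us n)) \<longlonglongrightarrow> 0 \<longleftrightarrow> (\<lambda>n. E1 (us n, us n)) \<longlonglongrightarrow> 0"
proof
  assume "(\<lambda>n. form_norm M E (us n)) \<longlonglongrightarrow> 0"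
  then have "(\<lambda>n. (form_norm M E (us n))\<^sup>2) \<longlonglongrightarrow> 0" by (auto intro!: tendsto_eq_intros)
  then show "(\<lambda>n. E1 (us n, us n)) \<longlonglongrightarrow> 0" unfolding form_norm_eq using E1.nonneg[OF us] by simp
next
  assume "(\<lambda>n. E1 (us n, us n)) \<longlonglongrightarrow> 0"
  from tendsto_real_sqrt[OF this] show "(\<lambda>n. form_norm M E (us n)) \<longlonglongrightarrow> 0" unfolding form_norm_eq by simp
qed

definition form_closure :: "('a \<Rightarrow> real) set \<Rightarrow> ('a \<Rightarrow> real) set" where
  "form_closure C = {u \<in> F. \<forall>\<epsilon>>0. \<exists>v\<in>C. form_norm M E (\<lambda>x. u x - v x) < \<epsilon>}"

lemma form_closure_eq: "form_closure C = E1.sq_closure C"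
proof -
  have "(\<forall>\<epsilon>>0. \<exists>v\<in>C. E1.sq (\<lambda>x. u x - v x) < \<epsilon>) \<longleftrightarrow> (\<forall>\<epsilon>>0. \<exists>v\<in>C. form_norm M E (\<lambda>x. u x - v x) < \<epsilon>)"
    (is "?L \<longleftrightarrow> ?R") for u
  proof
    assume L: ?L
    show ?R
    proof (intro allI impI)
      fix \<epsilon> :: real assume e: "\<epsilon> > 0"
      then have "\<epsilon>\<^sup>2 > 0" by simp
      with L show "\<exists>v\<in>C. form_norm M E (\<lambda>x. u x - v x) < \<epsilon>" unfolding form_norm_less_iff[OF e] by blast
    qed
  next
    assume R: ?R
    show ?L
    proof (intro allI impI)
      fix \<epsilon> :: real assume e: "\<epsilon> > 0"
      then have "sqrt \<epsilon> > 0" by simp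
      with R show "\<exists>v\<in>C. E1.sq (\<lambda>x. u x - v x) < \<epsilon>" unfolding E1_less_iff[OF e] by blast
    qed
  qed
  then show ?thesis by (simp add: E1.sq_closure_def form_closure_def)
qed

lemma form_closure_sub: "form_closure C \<subseteq> F"
  by (auto simp: form_closure_def)

lemma form_closureI:
  assumes "C \<subseteq> F" "u \<in> F" "\<And>n::nat. vs n \<in> C" "conv vs u" "mean_conv M vs u"
  shows "u \<in> form_closure C"
proof -
  have "vs n \<in> F" for n using assms by blast
  then have "E1.conv vs u" using E1_conv_iff[of vs u] assms by blast
  then show ?thesis unfolding form_closure_eq by (rule E1.sq_closureI[OF assms(1-3)])
qed

lemma form_closure_base: "C \<subseteq> F \<Longrightarrow> u \<in> C \<Longrightarrow> u \<in> form_closure C"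
  unfolding form_closure_eq by (rule E1.sq_closure_base)

lemma form_closureE:
  assumes "C \<subseteq> F" "u \<in> form_closure C"
  obtains vs where "\<And>n::nat. vs n \<in> C" "conv vs u" "mean_conv M vs u"
proof -
  obtain vs where vs: "\<And>n::nat. vs n \<in> C" "E1.conv vs u"
    using E1.sq_closureE[OF assms(1) assms(2)[unfolded form_closure_eq]] by blast
  have "vs n \<in> F" for n using vs(1) assms(1) by blast
  with vs that E1_conv_iff[of vs u] assms(2) form_closure_sub show ?thesis by blast
qed

end

text \<open>Closedness is kept apart from density and the Markov property: H1, H10 and closures of cores are
  first shown to be closed forms, and the other two properties of a Dirichlet form are derived from
  this.\<close>

locale closed_form = L2_form +
  assumes AE_mem: "u \<in> F \<Longrightarrow> v \<in> borel_measurable M \<Longrightarrow> AE x in M. u x = v x \<Longrightarrow> v \<in> F"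
    and AE_cong_left: "u \<in> F \<Longrightarrow> u' \<in> F \<Longrightarrow> v \<in> F \<Longrightarrow> AE x in M. u x = u' x \<Longrightarrow> E (u, v) = E (u', v)"
    and complete: "(\<And>n::nat. us n \<in> F) \<Longrightarrow> E1.Cauchy_seq us \<Longrightarrow> \<exists>u\<in>F. E1.conv us u"
begin

lemma AE_cong_sq: "u \<in> F \<Longrightarrow> u' \<in> F \<Longrightarrow> AE x in M. u x = u' x \<Longrightarrow> sq u = sq u'"
  using AE_cong_left[of u u' u] AE_cong_left[of u u' u'] sym[of u u'] by metis

lemma limit_unique:
  assumes "\<And>n. us n \<in> sq_int M" "u \<in> sq_int M" "v \<in> sq_int M"
    "mean_conv M us u"
    "mean_conv M us v"
  shows "AE x in M. u x = v x"
proof -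
  have "mean_sq M (\<lambda>x. u x - v x) \<le> 0"
  proof (rule LIMSEQ_le_const)
    have "(\<lambda>n. 2 * mean_sq M (\<lambda>x. us n x - u x) +
        2 * mean_sq M (\<lambda>x. us n x - v x)) \<longlonglongrightarrow> 2 * 0 + 2 * 0"
      by (intro tendsto_intros assms)
    then show "(\<lambda>n. 2 * mean_sq M (\<lambda>x. us n x - u x) +
        2 * mean_sq M (\<lambda>x. us n x - v x)) \<longlonglongrightarrow> 0" by simp
    show "\<exists>N. \<forall>n\<ge>N. mean_sq M (\<lambda>x. u x - v x) \<le>
        2 * mean_sq M (\<lambda>x. us n x - u x) + 2 * mean_sq M (\<lambda>x. us n x - v x)"
      using sq_int.sq_triangle[OF assms(2) assms(1) assms(3)]
        sq_int.sq_diff_commute[OF assms(2) assms(1)] by simp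
  qed
  then have "mean_sq M (\<lambda>x. u x - v x) = 0"
    using sq_int.nonneg[OF sq_int.diff_mem[OF assms(2,3)]] by linarith
  then show ?thesis using sq_inner_zero_iff[OF sq_int.diff_mem[OF assms(2,3)]] by simp
qed

text \<open>Closedness in the form in which it is used: the limit in L2 is known beforehand, and only the
  energies are known to be Cauchy.\<close>

lemma Cauchy_limit:
  assumes us: "\<And>n::nat. us n \<in> F" "Cauchy_seq us" and u: "u \<in> sq_int M" and lim: "mean_conv M us u"
  shows "u \<in> F" "conv us u"
proof -
  have "sq_int.Cauchy_seq M us"
    by (rule sq_int.convergent_Cauchy_seq[OF mem_sq_int[OF us(1)] u lim])
  then have "E1.Cauchy_seq us" using us(2) by (simp add: E1_Cauchy_seq_iff us(1))
  then obtain u' where u': "u' \<in> F" "E1.conv us u'" using complete[of us] us(1) by blast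
  note c = u'(2)[unfolded E1_conv_iff[OF us(1) u'(1)]]
  have ae: "AE x in M. u' x = u x"
    by (rule limit_unique[OF mem_sq_int[OF us(1)] mem_sq_int[OF u'(1)] u c[THEN conjunct2] lim])
  show uF: "u \<in> F" by (rule AE_mem[OF u'(1) sq_int_measurable[OF u] ae])
  have "sq (\<lambda>x. us n x - u' x) = sq (\<lambda>x. us n x - u x)" for n
    by (rule AE_cong_sq) (use ae in \<open>auto intro: diff_mem us(1) uF u'(1)\<close>)
  then show "conv us u" using c by simp
qed

text \<open>Among the elements of \<open>C\<close> that are close to \<open>u\<close> in L2 and satisfy the energy bound, those of almost
  minimal energy form a Cauchy sequence for the form norm.  This replaces weak compactness followed
  by the passage to convex combinations.\<close>

lemma bounded_energy_limit:
  assumes C: "C \<subseteq> F" "\<And>u v. u \<in> C \<Longrightarrow> v \<in> C \<Longrightarrow> (\<lambda>x. (1/2) * (u x + v x)) \<in> C"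
    and u: "u \<in> sq_int M"
    and approx: "\<And>\<epsilon>. \<epsilon> > 0 \<Longrightarrow> \<exists>v\<in>C. mean_sq M (\<lambda>x. v x - u x) < \<epsilon> \<and> sq v \<le> K"
  shows "u \<in> F" "sq u \<le> K"
    "u \<in> form_closure C"
proof -
  define D where "D v = mean_sq M (\<lambda>x. v x - u x)" for v
  let ?C = "\<lambda>n::nat. {v \<in> C. D v \<le> 1 / real (Suc n) \<and> sq v \<le> K}"
  obtain vs where vs: "\<And>n. vs n \<in> ?C n" "Cauchy_seq vs"
  proof (rule minimizing_Cauchy_seq[where C = ?C and K = K])
    show "?C n \<subseteq> F" for n using C by auto
    show "?C n \<subseteq> ?C m" if "m \<le> n" for m n
    proof -
      have "1 / real (Suc n) \<le> 1 / real (Suc m)" using that by (simp add: frac_le)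
      then show ?thesis by (smt (verit) Collect_mono)
    qed
    show "\<exists>u\<in>?C n. sq u \<le> K" for n
      using approx[of "1 / real (Suc n)"] unfolding D_def by (fastforce simp del: of_nat_Suc)
    show "(\<lambda>x. (1/2) *\<^sub>R (v x + w x)) \<in> ?C n" if vw: "v \<in> ?C n" "w \<in> ?C n" for n v w
    proof -
      have vF: "v \<in> F" "w \<in> F" using vw C by auto
      have L: "(\<lambda>x. v x - u x) \<in> sq_int M" "(\<lambda>x. w x - u x) \<in> sq_int M"
        using vF mem_sq_int u by (auto intro!: sq_int.diff_mem)
      have eq: "(\<lambda>x. (1/2) *\<^sub>R ((v x - u x) + (w x - u x))) = (\<lambda>x. (1/2) * (v x + w x) - u x)"
        by (simp add: fun_eq_iff field_simps)
      have "D (\<lambda>x. (1/2) * (v x + w x)) \<le> (D v + D w) / 2"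
        using sq_int.sq_midpoint_le[OF L] unfolding D_def eq .
      moreover have "sq (\<lambda>x. (1/2) * (v x + w x)) \<le> (sq v + sq w) / 2"
        using sq_midpoint_le[OF vF] by simp
      moreover have "(\<lambda>x. (1/2) * (v x + w x)) \<in> C" using C(2) vw by blast
      ultimately show ?thesis using vw by (auto simp del: of_nat_Suc) 
    qed
  qed (use that in blast)
  have vsF: "vs n \<in> F" for n using vs(1)[of n] C by auto
  have Dlim: "(\<lambda>n. D (vs n)) \<longlonglongrightarrow> 0"
  proof (rule Lim_null_comparison)
    show "\<forall>\<^sub>F n in sequentially. norm (D (vs n)) \<le> 1 / real (Suc n)"
      using vs(1) by (auto simp: D_def sq_inner_self)
    show "(\<lambda>n. 1 / real (Suc n)) \<longlonglongrightarrow> 0" by (intro LIMSEQ_Suc lim_1_over_n)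
  qed
  have uF: "u \<in> F" and lim: "conv vs u"
    using Cauchy_limit[OF vsF vs(2) u] Dlim unfolding D_def by blast+
  then show "u \<in> F" by blast
  show "sq u \<le> K"
    by (rule LIMSEQ_le_const2[OF tendsto_form[OF vsF vsF uF uF lim lim]]) (use vs(1) in auto)
  have mc: "mean_conv M vs u" using Dlim unfolding D_def .
  show "u \<in> form_closure C"
    by (rule form_closureI[OF C(1) uF _ lim mc]) (use vs(1) in blast)
qed

lemma bounded_energy_limit_seq:
  assumes "\<And>n::nat. us n \<in> F" "\<And>n. sq (us n) \<le> K" "u \<in> sq_int M"
    "mean_conv M us u"
  shows "u \<in> F" "sq u \<le> K"
proof -
  have *: "\<exists>v\<in>F. mean_sq M (\<lambda>x. v x - u x) < \<epsilon> \<and> sq v \<le> K" if "\<epsilon> > 0" for \<epsilon>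
  proof -
    have "\<forall>\<^sub>F n in sequentially. mean_sq M (\<lambda>x. us n x - u x) < \<epsilon>"
      using order_tendstoD(2)[OF assms(4) that] .
    then show ?thesis using assms(1,2) eventually_happens'[OF sequentially_bot] by blast
  qed
  have mid: "(\<lambda>x. (1/2) * (u x + v x)) \<in> F" if "u \<in> F" "v \<in> F" for u v
    using scale_mem[OF add_mem[OF that], of "1/2"] by simp
  show "u \<in> F" "sq u \<le> K"
    using bounded_energy_limit(1,2)[OF order_refl mid assms(3) *] by blast+
qed

end

locale markovian_form = closed_form +
  assumes markov_mem: "u \<in> F \<Longrightarrow> (\<lambda>x. min (max 0 (u x)) 1) \<in> F"
    and markov_le: "u \<in> F \<Longrightarrow> sq (\<lambda>x. min (max 0 (u x)) 1) \<le> sq u"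
begin

text \<open>The contraction by \<open>[0, c]\<close> is the unit contraction rescaled; let \<open>c\<close> tend to infinity.\<close>

lemma pos_part:
  assumes u: "u \<in> F"
  shows "(\<lambda>x. max 0 (u x)) \<in> F" "sq (\<lambda>x. max 0 (u x)) \<le> sq u"
proof -
  note [measurable] = mem_measurable[OF u]
  define vs where "vs n x = min (max 0 (u x)) (real (Suc n))" for n x
  have "vs n \<in> F \<and> sq (vs n) \<le> sq u" for n
  proof -
    define c where "c = real (Suc n)"
    have c: "c > 0" unfolding c_def by simp
    have s: "(\<lambda>x. (1/c) *\<^sub>R u x) \<in> F" by (rule scale_mem[OF u])
    define t where "t x = min (max 0 ((1/c) *\<^sub>R u x)) 1" for x
    have t: "t \<in> F" "sq t \<le> sq (\<lambda>x. (1/c) *\<^sub>R u x)"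
      using markov_mem[OF s] markov_le[OF s] unfolding t_def by auto
    have eq: "vs n = (\<lambda>x. c *\<^sub>R t x)"
      using c unfolding vs_def t_def c_def[symmetric] fun_eq_iff by (auto simp: min_def max_def field_simps)
    have "sq (vs n) = c\<^sup>2 * sq t" unfolding eq by (rule sq_scale[OF t(1)])
    also have "\<dots> \<le> c\<^sup>2 * ((1/c)\<^sup>2 * sq u)"
      using t(2) unfolding sq_scale[OF u] by (intro mult_left_mono) auto
    also have "\<dots> = sq u" using c by (simp add: power_divide)
    finally show ?thesis unfolding eq using scale_mem[OF t(1)] by blast
  qed
  then have vs: "vs n \<in> F" "sq (vs n) \<le> sq u" for n by auto
  have L: "(\<lambda>x. max 0 (u x)) \<in> sq_int M"
    by (rule sq_int_bound[OF mem_sq_int[OF u]]) auto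
  have "(\<lambda>n. mean_sq M (\<lambda>x. vs n x - max 0 (u x))) \<longlonglongrightarrow> 0"
  proof (rule sq_int_dominated_tendsto_0[OF _ mem_sq_int[OF u]])
    show "(\<lambda>x. vs n x - max 0 (u x)) \<in> borel_measurable M" for n unfolding vs_def by measurable
    show "AE x in M. norm (vs n x - max 0 (u x)) \<le> norm (u x)" for n
      unfolding vs_def by (auto simp: min_def max_def)
    have "(\<lambda>n. vs n x - max 0 (u x)) \<longlonglongrightarrow> 0" for x
    proof (rule tendsto_eventually)
      obtain N :: nat where "real N \<ge> max 0 (u x)" using real_arch_simple by blast
      then show "\<forall>\<^sub>F n in sequentially. vs n x - max 0 (u x) = 0"
        unfolding eventually_sequentially vs_def by (intro exI[of _ N]) (auto simp: min_def)
    qed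
    then show "AE x in M. (\<lambda>n. vs n x - max 0 (u x)) \<longlonglongrightarrow> 0" by simp
  qed
  then show "(\<lambda>x. max 0 (u x)) \<in> F" "sq (\<lambda>x. max 0 (u x)) \<le> sq u"
    using bounded_energy_limit_seq[of vs, OF vs L] by simp_all
qed

text \<open>For positive \<open>t\<close> the positive part of \<open>u\<^sup>+ - t u\<^sup>-\<close> is \<open>u\<^sup>+\<close>, so taking positive parts decreases
  \<open>E(u\<^sup>+ - t u\<^sup>-)\<close> to \<open>E(u\<^sup>+)\<close>.  Dividing by \<open>t\<close> and letting \<open>t\<close> tend to zero gives the sign of the
  mixed term.\<close>

lemma pos_neg_part_le:
  assumes u: "u \<in> F"
  shows "E (\<lambda>x. max 0 (u x), \<lambda>x. max 0 (- u x)) \<le> 0"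
proof -
  define p n where "p x = max 0 (u x)" and "n x = max 0 (- u x)" for x
  have p: "p \<in> F" and n: "n \<in> F" unfolding p_def n_def using pos_part u minus_mem by blast+
  have key: "2 * E (p, n) \<le> t * sq n" if "t > 0" for t
  proof -
    have tn: "(\<lambda>x. t *\<^sub>R n x) \<in> F" by (rule scale_mem[OF n])
    have "(\<lambda>x. max 0 (p x - t *\<^sub>R n x)) = p"
      using that unfolding p_def n_def fun_eq_iff by (auto simp: max_def mult_le_0_iff zero_le_mult_iff)
    then have "sq p \<le> sq (\<lambda>x. p x - t *\<^sub>R n x)" using pos_part(2)[OF diff_mem[OF p tn]] by simp
    also have "\<dots> = sq p - 2 * (t * E (p, n)) + t\<^sup>2 * sq n"
      unfolding sq_diff[OF p tn] sq_scale[OF n] scale_right[OF n p] ..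
    finally have "t * (2 * E (p, n)) \<le> t * (t * sq n)" by (simp add: power2_eq_square)
    then show ?thesis using that by simp
  qed
  have "2 * E (p, n) \<le> 0"
  proof (rule field_le_epsilon)
    fix e :: real assume "e > 0"
    have nn: "sq n \<ge> 0" by (rule nonneg[OF n])
    have "2 * E (p, n) \<le> e / (sq n + 1) * sq n" using \<open>e > 0\<close> nn by (intro key) auto
    also have "\<dots> \<le> e" using \<open>e > 0\<close> nn by (simp add: field_simps)
    finally show "2 * E (p, n) \<le> 0 + e" by simp
  qed
  then show ?thesis unfolding p_def n_def by simp
qed

lemma abs:
  assumes u: "u \<in> F"
  shows "(\<lambda>x. \<bar>u x\<bar>) \<in> F" "sq (\<lambda>x. \<bar>u x\<bar>) \<le> sq u"
proof -
  define p n where "p x = max 0 (u x)" and "n x = max 0 (- u x)" for x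
  have p: "p \<in> F" and n: "n \<in> F" unfolding p_def n_def using pos_part u minus_mem by blast+
  have abs: "(\<lambda>x. \<bar>u x\<bar>) = (\<lambda>x. p x + n x)" and u_eq: "u = (\<lambda>x. p x - n x)"
    unfolding p_def n_def by (auto simp: fun_eq_iff)
  show "(\<lambda>x. \<bar>u x\<bar>) \<in> F" unfolding abs by (rule add_mem[OF p n])
  have "E (p, n) \<le> 0" unfolding p_def n_def by (rule pos_neg_part_le[OF u])
  then show "sq (\<lambda>x. \<bar>u x\<bar>) \<le> sq u" 
    unfolding abs sq_add[OF p n] using sq_diff[OF p n] u_eq by simp
qed

text \<open>Minimum and maximum are half the sum plus or minus half the absolute value of the difference; two
  applications of the parallelogram identity reduce the energy bound to that for the absolute value.\<close>

lemma lattice: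
  assumes u: "u \<in> F" and v: "v \<in> F"
  shows "(\<lambda>x. min (u x) (v x)) \<in> F" "(\<lambda>x. max (u x) (v x)) \<in> F"
    "sq (\<lambda>x. min (u x) (v x)) + sq (\<lambda>x. max (u x) (v x)) \<le> sq u + sq v"
proof -
  define d where "d x = \<bar>u x - v x\<bar>" for x
  define a where "a x = u x + v x" for x
  have d: "d \<in> F" "sq d \<le> sq (\<lambda>x. u x - v x)" unfolding d_def using abs[OF diff_mem[OF u v]] by auto
  have a: "a \<in> F" unfolding a_def by (rule add_mem[OF u v])
  have mn: "(\<lambda>x. min (u x) (v x)) = (\<lambda>x. (1/2) *\<^sub>R (a x - d x))"
    and mx: "(\<lambda>x. max (u x) (v x)) = (\<lambda>x. (1/2) *\<^sub>R (a x + d x))"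
    unfolding a_def d_def by (auto simp: fun_eq_iff)
  show "(\<lambda>x. min (u x) (v x)) \<in> F" unfolding mn by (intro scale_mem diff_mem a d)
  show "(\<lambda>x. max (u x) (v x)) \<in> F" unfolding mx by (intro scale_mem add_mem a d)
  have "sq (\<lambda>x. min (u x) (v x)) + sq (\<lambda>x. max (u x) (v x)) = (sq a + sq d) / 2"
    unfolding mn mx sq_scale[OF diff_mem[OF a d(1)]] sq_scale[OF add_mem[OF a d(1)]]
    using parallelogram[OF a d(1)] by (simp add: power2_eq_square)
  also have "\<dots> \<le> sq u + sq v"
    using parallelogram[OF u v] d(2) unfolding a_def by simp
  finally show "sq (\<lambda>x. min (u x) (v x)) + sq (\<lambda>x. max (u x) (v x)) \<le> sq u + sq v" .
qed

definition cut :: "('a \<Rightarrow> real) \<Rightarrow> ('a \<Rightarrow> real) \<Rightarrow> 'a \<Rightarrow> real" where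
  "cut b u x = max (min (u x) \<bar>b x\<bar>) (- \<bar>b x\<bar>)"

lemma cut:
  assumes u: "u \<in> F" and b: "b \<in> F"
  shows "cut b u \<in> F" "sq (cut b u) \<le> sq u + 2 * sq b"
proof -
  note ab = abs[OF b]
  note m = lattice[OF u ab(1)]
  note na = minus_mem[OF ab(1)]
  note x = lattice[OF m(1) na]
  have eq: "cut b u = (\<lambda>x. max (min (u x) \<bar>b x\<bar>) (- \<bar>b x\<bar>))" by (simp add: fun_eq_iff cut_def)
  show "cut b u \<in> F" unfolding eq by (rule x(2))
  show "sq (cut b u) \<le> sq u + 2 * sq b"
    unfolding eq using x(3) m(3) ab(2) sq_minus[OF ab(1)] nonneg[OF x(1)] nonneg[OF m(2)] by linarith
qed

lemma abs_cut_le: "\<bar>cut b u x\<bar> \<le> \<bar>b x\<bar>" "\<bar>cut b u x\<bar> \<le> \<bar>u x\<bar>"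
  unfolding cut_def by (auto simp: min_def max_def)

text \<open>The Fatou property: cutting the sequence at the absolute value of one of its own members
  produces functions that are dominated in L2 and have bounded energy.  Their limit is \<open>u\<close> cut at
  that member, which is dominated by \<open>u\<close> itself and in turn converges to \<open>u\<close>.\<close>

lemma fatou:
  assumes us: "\<And>n::nat. us n \<in> F" and K: "\<And>n. sq (us n) \<le> K" 
    and lim: "AE x in M. (\<lambda>n. us n x) \<longlonglongrightarrow> u x" and u: "u \<in> sq_int M"
  shows "u \<in> F" "sq u \<le> 3 * K"
proof -
  note [measurable] = mem_measurable[OF us] sq_int_measurable[OF u]
  have [measurable]: "cut b v \<in> borel_measurable M"
    if "b \<in> borel_measurable M" "v \<in> borel_measurable M" for b v
    unfolding cut_def[abs_def] using that by measurable
  \<comment> \<open>The limit in \<open>n\<close>, for a fixed member \<open>us k\<close>.\<close>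
  have step: "cut (us k) u \<in> F \<and> sq (cut (us k) u) \<le> 3 * K" for k
  proof -
    have L: "cut (us k) u \<in> sq_int M"
      by (rule sq_int_bound[OF u]) (auto simp: abs_cut_le)
    have "(\<lambda>n. mean_sq M (\<lambda>x. cut (us k) (us n) x - cut (us k) u x)) \<longlonglongrightarrow> 0"
    proof (rule sq_int_dominated_tendsto_0)
      show "(\<lambda>x. 2 *\<^sub>R us k x) \<in> sq_int M" by (intro sq_int.scale_mem mem_sq_int us)
      show "AE x in M. norm (cut (us k) (us n) x - cut (us k) u x) \<le> norm (2 *\<^sub>R us k x)" for n
      proof (rule AE_I2)
        fix x
        show "norm (cut (us k) (us n) x - cut (us k) u x) \<le> norm (2 *\<^sub>R us k x)"
          using abs_cut_le(1)[of "us k" "us n" x] abs_cut_le(1)[of "us k" u x] by simp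
      qed
      show "AE x in M. (\<lambda>n. cut (us k) (us n) x - cut (us k) u x) \<longlonglongrightarrow> 0"
        using lim
      proof eventually_elim
        case (elim x)
        then have "(\<lambda>n. cut (us k) (us n) x - cut (us k) u x) \<longlonglongrightarrow> cut (us k) u x - cut (us k) u x"
          unfolding cut_def by (intro tendsto_intros)
        then show ?case by simp
      qed
    qed measurable
    moreover have "sq (cut (us k) (us n)) \<le> 3 * K" for n
      using cut(2)[OF us[of n] us[of k]] K[of n] K[of k] by linarith
    ultimately show ?thesis
      using bounded_energy_limit_seq[of "\<lambda>n. cut (us k) (us n)" "3 * K" "cut (us k) u"] cut(1) us L by blast
  qed
  \<comment> \<open>The limit in \<open>k\<close>.\<close>
  have "(\<lambda>k. mean_sq M (\<lambda>x. cut (us k) u x - u x)) \<longlonglongrightarrow> 0"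
  proof (rule sq_int_dominated_tendsto_0[OF _ sq_int.scale_mem[OF u, of 2]])
    show "AE x in M. norm (cut (us k) u x - u x) \<le> norm (2 *\<^sub>R u x)" for k
    proof (rule AE_I2)
      fix x show "norm (cut (us k) u x - u x) \<le> norm (2 *\<^sub>R u x)"
        using abs_cut_le(2)[of "us k" u x] by simp
    qed
    show "AE x in M. (\<lambda>k. cut (us k) u x - u x) \<longlonglongrightarrow> 0" using lim
    proof eventually_elim
      case (elim x)
      have "(\<lambda>k. cut (us k) u x) \<longlonglongrightarrow> max (min (u x) \<bar>u x\<bar>) (- \<bar>u x\<bar>)"
        unfolding cut_def by (intro tendsto_intros elim)
      also have "max (min (u x) \<bar>u x\<bar>) (- \<bar>u x\<bar>) = u x" by simp
      finally show ?case by (simp add: LIM_zero_iff)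
    qed
  qed measurable
  then show "u \<in> F" "sq u \<le> 3 * K"
    using bounded_energy_limit_seq[of "\<lambda>k. cut (us k) u" "3 * K" u] step u by blast+
qed

text \<open>The Fatou property for the differences of the members of a tail, whose energies are small.\<close>

lemma extended_limit:
  assumes us: "\<And>n::nat. us n \<in> F" "Cauchy_seq us"
    and lim: "AE x in M. (\<lambda>n. us n x) \<longlonglongrightarrow> u x" and u: "u \<in> sq_int M"
  shows "u \<in> F" "conv us u"
proof -
  obtain K where "\<And>n. sq (us n) \<le> K" using Cauchy_seq_bounded[OF us] by blast
  then show uF: "u \<in> F" using fatou(1)[OF us(1) _ lim u] by blast
  show "conv us u"
  proof (rule LIMSEQ_I)
    fix e :: real assume "e > 0"
    then obtain N where N: "\<forall>m\<ge>N. \<forall>n\<ge>N. sq (\<lambda>x. us m x - us n x) < e / 4"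
      using us(2) unfolding Cauchy_seq_def by (meson zero_less_divide_iff zero_less_numeral)
    have "norm (sq (\<lambda>x. us n x - u x) - 0) < e" if n: "n \<ge> N" for n
    proof -
      have "sq (\<lambda>x. us n x - u x) \<le> 3 * (e / 4)"
      proof (rule fatou(2)[where us = "\<lambda>m x. us n x - us (m + N) x"])
        show "(\<lambda>x. us n x - us (m + N) x) \<in> F" for m by (intro diff_mem us)
        show "sq (\<lambda>x. us n x - us (m + N) x) \<le> e / 4" for m using N n by (simp add: less_imp_le)
        show "(\<lambda>x. us n x - u x) \<in> sq_int M" by (intro sq_int.diff_mem mem_sq_int us u)
        show "AE x in M. (\<lambda>m. us n x - us (m + N) x) \<longlonglongrightarrow> us n x - u x"
          using lim by eventually_elim (intro tendsto_intros LIMSEQ_ignore_initial_segment)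
      qed
      then show ?thesis using \<open>e > 0\<close> nonneg[OF diff_mem[OF us(1)[of n] uF]] by simp
    qed
    then show "\<exists>no. \<forall>n\<ge>no. norm (sq (\<lambda>x. us n x - u x) - 0) < e" by blast
  qed
qed

end

context closed_form begin

lemma AE_cong_E1:
  assumes "u \<in> F" "u' \<in> F" "AE x in M. u x = u' x"
  shows "E1 (u, u) = E1 (u', u')"
  unfolding E1_apply AE_cong_sq[OF assms]
  using sq_inner_AE_cong[OF assms(3,3)] mem_measurable assms(1,2) by simp

lemma closed_form_form_closure:
  assumes C: "C \<subseteq> F" "(\<lambda>x. 0) \<in> C" "\<And>u v. u \<in> C \<Longrightarrow> v \<in> C \<Longrightarrow> (\<lambda>x. u x + v x) \<in> C"
    "\<And>c u. u \<in> C \<Longrightarrow> (\<lambda>x. c * u x) \<in> C"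
  shows "closed_form M (form_closure C) E"
proof -
  note sub = form_closure_sub[of C, THEN subsetD]
  have "psd_form (form_closure C) E1"
    unfolding form_closure_eq using C by (intro E1.psd_form_sq_closure) auto
  then interpret cl: psd_form "form_closure C" E1 .
  have psd: "psd_form (form_closure C) E"
    by (rule psd_form_subspace[OF form_closure_sub cl.zero_mem cl.add_mem cl.scale_mem])
  show ?thesis
  proof (intro closed_form.intro L2_form.intro psd L2_form_axioms.intro closed_form_axioms.intro)
    show "form_closure C \<subseteq> sq_int M" using sub mem_sq_int by blast
    fix u v assume u: "u \<in> form_closure C" and v: "v \<in> borel_measurable M" "AE x in M. u x = v x"
    have vF: "v \<in> F" by (rule AE_mem[OF sub[OF u] v])
    have "E1.sq (\<lambda>x. u x - w x) = E1.sq (\<lambda>x. v x - w x)" if "w \<in> C" for w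
    proof (rule AE_cong_E1)
      show "(\<lambda>x. u x - w x) \<in> F" "(\<lambda>x. v x - w x) \<in> F" using that C(1) by (auto intro: diff_mem vF sub[OF u])
      show "AE x in M. u x - w x = v x - w x" using v(2) by eventually_elim simp
    qed
    then show "v \<in> form_closure C" using u vF unfolding form_closure_eq E1.sq_closure_def by auto
  next
    fix u u' v assume "u \<in> form_closure C" "u' \<in> form_closure C" "v \<in> form_closure C" "AE x in M. u x = u' x"
    then show "E (u, v) = E (u', v)" using sub by (intro AE_cong_left)
  next
    fix us assume us: "\<And>n::nat. us n \<in> form_closure C" and "psd_form.Cauchy_seq (L2_form.E1 M E) us"
    then obtain u where u: "u \<in> F" "E1.conv us u" using complete[of us] sub by blast
    have "u \<in> form_closure C"
      using us unfolding form_closure_eq by (rule E1.sq_closure_idem[OF C(1) u(1) _ u(2)])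
    with u(2) show "\<exists>u\<in>form_closure C. E1.conv us u" by blast
  qed
qed

lemma closed_form_scale:
  assumes "c > 0" and E': "\<And>u v. u \<in> F \<Longrightarrow> v \<in> F \<Longrightarrow> E' (u, v) = c * E (u, v)"
  shows "closed_form M F E'"
proof -
  have psd: "psd_form F E'"
  proof
    fix u v w assume uvw: "u \<in> F" "v \<in> F" "w \<in> F"
    show "E' (\<lambda>x. u x + v x, w) = E' (u, w) + E' (v, w)"
      by (simp add: E' add_mem uvw add_left distrib_left)
  next
    fix u v and a :: real assume uv: "u \<in> F" "v \<in> F"
    show "(\<lambda>x. u x + v x) \<in> F" by (rule add_mem[OF uv])
    show "(\<lambda>x. a *\<^sub>R u x) \<in> F" by (rule scale_mem[OF uv(1)])
    show "E' (u, v) = E' (v, u)" unfolding E'[OF uv] E'[OF uv(2,1)] sym[OF uv] ..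
    show "E' (\<lambda>x. a *\<^sub>R u x, v) = a * E' (u, v)"
      unfolding E'[OF uv] E'[OF scale_mem[OF uv(1)] uv(2)] scale_left[OF uv] by (rule mult.left_commute)
    show "0 \<le> E' (u, u)" unfolding E'[OF uv(1,1)] using nonneg[OF uv(1)] \<open>c > 0\<close> by simp
  qed (rule zero_mem)
  interpret E': L2_form M F E' by (intro L2_form.intro psd L2_form_axioms.intro sub_sq_int)
  show ?thesis
  proof (intro closed_form.intro E'.L2_form_axioms closed_form_axioms.intro)
    show "u \<in> F \<Longrightarrow> v \<in> borel_measurable M \<Longrightarrow> AE x in M. u x = v x \<Longrightarrow> v \<in> F" for u v by (rule AE_mem)
    show "u \<in> F \<Longrightarrow> u' \<in> F \<Longrightarrow> v \<in> F \<Longrightarrow> AE x in M. u x = u' x \<Longrightarrow> E' (u, v) = E' (u', v)" for u u' v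
      using AE_cong_left[of u u' v] E'[of u v] E'[of u' v] by simp
    fix us assume us: "\<And>n::nat. us n \<in> F" and "E'.E1.Cauchy_seq us"
    then have C: "E'.Cauchy_seq us" "sq_int.Cauchy_seq M us" using E'.E1_Cauchy_seq_iff[of us] by blast+
    have "Cauchy_seq us" unfolding Cauchy_seq_def
      by (rule E'.Cauchy_seq_dominated[OF C(1), of "1 / c"]) (use \<open>c > 0\<close> in \<open>simp_all add: E' diff_mem us\<close>)
    with C(2) have "E1.Cauchy_seq us" by (simp add: E1_Cauchy_seq_iff us)
    then obtain u where u: "u \<in> F" "E1.conv us u" using complete[of us] us by blast
    note c = u(2)[unfolded E1_conv_iff[OF us u(1)]]
    have "(\<lambda>n. c * sq (\<lambda>x. us n x - u x)) \<longlonglongrightarrow> c * 0" using c by (intro tendsto_intros) blast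
    then have "E'.conv us u" by (simp add: E' diff_mem us u(1))
    then have "E'.E1.conv us u" using c E'.E1_conv_iff[of us u] us u(1) by blast
    with u(1) show "\<exists>u\<in>F. E'.E1.conv us u" by blast
  qed
qed

end

lemma dirichlet_form_imp_closed_form:
  assumes D: "dirichlet_form M (E, F)"
  shows "closed_form M F E"
proof -
  note D' = D[unfolded dirichlet_form.simps]
  have psd: "psd_form F E"
    by (unfold_locales; (unfold real_scaleR_def)?; use D' in blast)
  interpret psd_form F E by (rule psd)
  have sub: "F \<subseteq> sq_int M" using D' by (simp add: L2_eq_sq_int)
  interpret L2_form M F E by (intro L2_form.intro psd L2_form_axioms.intro sub)
  show ?thesis
  proof (intro closed_form.intro L2_form_axioms closed_form_axioms.intro)
    have "\<forall>u\<in>F. \<forall>v\<in>borel_measurable M. (AE x in M. u x = v x) \<longrightarrow> v \<in> F"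
      using D' by (elim conjE) assumption
    then show "u \<in> F \<Longrightarrow> v \<in> borel_measurable M \<Longrightarrow> AE x in M. u x = v x \<Longrightarrow> v \<in> F" for u v by blast
    have "\<forall>u\<in>F. \<forall>u'\<in>F. \<forall>v\<in>F. (AE x in M. u x = u' x) \<longrightarrow> E (u, v) = E (u', v)"
      using D' by (elim conjE) assumption
    then show "u \<in> F \<Longrightarrow> u' \<in> F \<Longrightarrow> v \<in> F \<Longrightarrow> AE x in M. u x = u' x \<Longrightarrow> E (u, v) = E (u', v)" for u u' v
      by blast
    fix us assume us: "\<And>n::nat. us n \<in> F" and "E1.Cauchy_seq us"
    then have "\<forall>\<epsilon>>0. \<exists>N. \<forall>m\<ge>N. \<forall>n\<ge>N. form_norm M E (\<lambda>x. us m x - us n x) < \<epsilon>"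
      unfolding form_norm_Cauchy_iff by blast
    moreover have "\<forall>us. (\<forall>n. us n \<in> F) \<and>
        (\<forall>\<epsilon>>0. \<exists>N. \<forall>m\<ge>N. \<forall>n\<ge>N. form_norm M E (\<lambda>x. us m x - us n x) < \<epsilon>) \<longrightarrow>
        (\<exists>u\<in>F. (\<lambda>n::nat. form_norm M E (\<lambda>x. us n x - u x)) \<longlonglongrightarrow> 0)"
      using D' by (elim conjE) assumption
    ultimately obtain u where u: "u \<in> F" "(\<lambda>n. form_norm M E (\<lambda>x. us n x - u x)) \<longlonglongrightarrow> 0"
      using us by blast
    then have "E1.conv us u" using form_norm_tendsto_0_iff[of "\<lambda>n x. us n x - u x", OF diff_mem[OF us u(1)]] by blast
    with u(1) show "\<exists>u\<in>F. E1.conv us u" by blast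
  qed
qed

lemma dirichlet_form_imp_markovian_form:
  assumes D: "dirichlet_form M (E, F)"
  shows "markovian_form M F E"
proof (intro markovian_form.intro dirichlet_form_imp_closed_form[OF D] markovian_form_axioms.intro)
  note D' = D[unfolded dirichlet_form.simps]
  show "u \<in> F \<Longrightarrow> (\<lambda>x. min (max 0 (u x)) 1) \<in> F" for u using D' by blast
  show "u \<in> F \<Longrightarrow> E (\<lambda>x. min (max 0 (u x)) 1, \<lambda>x. min (max 0 (u x)) 1) \<le> E (u, u)" for u
    using D' by blast
qed

lemma dirichlet_formI:
  assumes "markovian_form M F E" "E \<in> extensional (F \<times> F)"
    and dense: "\<And>w \<epsilon>. w \<in> sq_int M \<Longrightarrow> \<epsilon> > 0 \<Longrightarrow> \<exists>u\<in>F. mean_sq M (\<lambda>x. w x - u x) < \<epsilon>"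
  shows "dirichlet_form M (E, F)"
proof -
  interpret markovian_form M F E by fact
  have d: "\<exists>u\<in>F. L2_norm M (\<lambda>x. w x - u x) < \<epsilon>" if w: "w \<in> L2 M" and e: "\<epsilon> > 0" for w \<epsilon>
  proof -
    obtain u where u: "u \<in> F" "mean_sq M (\<lambda>x. w x - u x) < \<epsilon>\<^sup>2"
      using dense[of w "\<epsilon>\<^sup>2"] w zero_less_power[OF e, of 2] unfolding L2_eq_sq_int by blast
    then show ?thesis unfolding L2_norm_eq using e by (intro bexI[of _ u] real_less_lsqrt) (auto simp: sq_inner_self)
  qed
  have c: "\<exists>u\<in>F. (\<lambda>n. form_norm M E (\<lambda>x. us n x - u x)) \<longlonglongrightarrow> 0"
    if us: "\<And>n::nat. us n \<in> F" and C: "\<forall>\<epsilon>>0. \<exists>N. \<forall>m\<ge>N. \<forall>n\<ge>N. form_norm M E (\<lambda>x. us m x - us n x) < \<epsilon>" for us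
  proof -
    obtain u where u: "u \<in> F" "E1.conv us u"
      using complete[of us, OF us] form_norm_Cauchy_iff[THEN iffD1, OF C] by blast
    then have "(\<lambda>n. form_norm M E (\<lambda>x. us n x - u x)) \<longlonglongrightarrow> 0"
      using form_norm_tendsto_0_iff[of "\<lambda>n x. us n x - u x", OF diff_mem[OF us u(1)]] by simp
    with u(1) show ?thesis by (intro bexI)
  qed
  show ?thesis unfolding dirichlet_form.simps
  proof (intro conjI)
    show "E \<in> extensional (F \<times> F)" by (rule assms(2))
    show "F \<subseteq> L2 M" using sub_sq_int by (simp add: L2_eq_sq_int)
    show "\<forall>u\<in>F. \<forall>v\<in>borel_measurable M. (AE x in M. u x = v x) \<longrightarrow> v \<in> F"
      by (intro ballI impI, erule AE_mem)
    show "\<forall>u\<in>F. \<forall>u'\<in>F. \<forall>v\<in>F. (AE x in M. u x = u' x) \<longrightarrow> E (u, v) = E (u', v)"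
      by (intro ballI impI, rule AE_cong_left)
    show "(\<lambda>x. 0) \<in> F" by (rule zero_mem)
    show "\<forall>u\<in>F. \<forall>v\<in>F. (\<lambda>x. u x + v x) \<in> F" using add_mem by blast
    show "\<forall>c. \<forall>u\<in>F. (\<lambda>x. c * u x) \<in> F" using scale_mem[unfolded real_scaleR_def] by blast
    show "\<forall>w\<in>L2 M. \<forall>\<epsilon>>0. \<exists>u\<in>F. L2_norm M (\<lambda>x. w x - u x) < \<epsilon>" using d by blast
    show "\<forall>u\<in>F. \<forall>v\<in>F. E (u, v) = E (v, u)" using sym by blast
    show "\<forall>u\<in>F. \<forall>v\<in>F. \<forall>w\<in>F. E (\<lambda>x. u x + v x, w) = E (u, w) + E (v, w)" using add_left by blast
    show "\<forall>c. \<forall>u\<in>F. \<forall>v\<in>F. E (\<lambda>x. c * u x, v) = c * E (u, v)"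
      using scale_left[unfolded real_scaleR_def] by blast
    show "\<forall>u\<in>F. 0 \<le> E (u, u)" using nonneg by blast
    show "\<forall>us. (\<forall>n. us n \<in> F) \<and>
        (\<forall>\<epsilon>>0. \<exists>N. \<forall>m\<ge>N. \<forall>n\<ge>N. form_norm M E (\<lambda>x. us m x - us n x) < \<epsilon>) \<longrightarrow>
        (\<exists>u\<in>F. (\<lambda>n::nat. form_norm M E (\<lambda>x. us n x - u x)) \<longlonglongrightarrow> 0)" using c by blast
    show "\<forall>u\<in>F. (\<lambda>x. min (max 0 (u x)) 1) \<in> F \<and>
        E (\<lambda>x. min (max 0 (u x)) 1, \<lambda>x. min (max 0 (u x)) 1) \<le> E (u, u)"
      using markov_mem markov_le by blast
  qed
qed

section \<open>Smooth functions\<close>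

lemma Cc_iff:
  "u \<in> Cc \<Gamma> \<longleftrightarrow> continuous_on UNIV u \<and> (\<exists>K. compact K \<and> K \<subseteq> \<Gamma> \<and> (\<forall>x. x \<notin> K \<longrightarrow> u x = 0))"
  for u :: "'a::t2_space \<Rightarrow> real"
proof
  assume "u \<in> Cc \<Gamma>"
  then show "continuous_on UNIV u \<and> (\<exists>K. compact K \<and> K \<subseteq> \<Gamma> \<and> (\<forall>x. x \<notin> K \<longrightarrow> u x = 0))"
    unfolding Cc_def using closure_subset[of "{x. u x \<noteq> 0}"] by blast
next
  assume R: "continuous_on UNIV u \<and> (\<exists>K. compact K \<and> K \<subseteq> \<Gamma> \<and> (\<forall>x. x \<notin> K \<longrightarrow> u x = 0))"
  then obtain K where K: "compact K" "K \<subseteq> \<Gamma>" "\<And>x. x \<notin> K \<Longrightarrow> u x = 0" by blast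
  have "closure {x. u x \<noteq> 0} \<subseteq> K"
    using K by (intro closure_minimal) (auto simp: compact_imp_closed)
  moreover from this have "compact (closure {x. u x \<noteq> 0})"
    using K(1) compact_Int_closed[OF K(1) closed_closure[of "{x. u x \<noteq> 0}"]] by (simp add: inf.absorb2)
  ultimately show "u \<in> Cc \<Gamma>" using R K unfolding Cc_def by auto
qed

text \<open>The local version of the classes \<open>Ck\<close>, needed because a holomorphic map is only defined on its
  domain.\<close>

primrec Ck_on :: "nat \<Rightarrow> 'a::euclidean_space set \<Rightarrow> ('a \<Rightarrow> real) set" where
  "Ck_on 0 S = {u. continuous_on S u}"
| "Ck_on (Suc k) S = {u. (\<forall>x\<in>S. u differentiable at x) \<and> (\<forall>b\<in>Basis. partial_deriv b u \<in> Ck_on k S)}"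

lemma Ck_on_UNIV: "Ck_on k UNIV = Ck k"
  by (induction k) (auto simp: differentiable_on_def)

lemma partial_deriv_eq:
  assumes "(u has_derivative D) (at x)"
  shows "partial_deriv b u x = D b"
  using frechet_derivative_at[OF assms] by (simp add: partial_deriv_def)

lemma differentiable_has_derivative:
  assumes "u differentiable at x"
  shows "(u has_derivative (\<lambda>h. \<Sum>b\<in>Basis. (h \<bullet> b) * partial_deriv b u x)) (at x)"
proof -
  have D: "(u has_derivative frechet_derivative u (at x)) (at x)"
    using assms frechet_derivative_works by blast
  then interpret bounded_linear "frechet_derivative u (at x)" by (rule has_derivative_bounded_linear)
  have "frechet_derivative u (at x) h = (\<Sum>b\<in>Basis. (h \<bullet> b) * partial_deriv b u x)" for h
  proof -
    have "frechet_derivative u (at x) h = frechet_derivative u (at x) (\<Sum>b\<in>Basis. (h \<bullet> b) *\<^sub>R b)"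
      by (simp add: euclidean_representation)
    then show ?thesis by (simp add: sum scaleR partial_deriv_def)
  qed
  then have "frechet_derivative u (at x) = (\<lambda>h. \<Sum>b\<in>Basis. (h \<bullet> b) * partial_deriv b u x)" by blast
  with D show ?thesis by simp
qed

lemma Ck_on_cong:
  assumes "open S" "\<And>x. x \<in> S \<Longrightarrow> u x = v x" "u \<in> Ck_on k S"
  shows "v \<in> Ck_on k S"
  using assms(2,3)
proof (induction k arbitrary: u v)
  case 0
  then show ?case using continuous_on_cong[of S S u v] by simp
next
  case (Suc k)
  have D: "(v has_derivative (\<lambda>h. \<Sum>b\<in>Basis. (h \<bullet> b) * partial_deriv b u x)) (at x)" if "x \<in> S" for x
    by (rule has_derivative_transform_within_open[OF differentiable_has_derivative \<open>open S\<close> that])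
      (use Suc.prems that in auto)
  have "v differentiable at x" if "x \<in> S" for x using D[OF that] by (rule differentiableI)
  moreover have "partial_deriv b v \<in> Ck_on k S" if b: "b \<in> Basis" for b
  proof (rule Suc.IH)
    show "partial_deriv b u \<in> Ck_on k S" using Suc.prems b by simp
    fix x assume "x \<in> S"
    then show "partial_deriv b u x = partial_deriv b v x"
      using Suc.prems(2) D b by (simp add: partial_deriv_eq[OF D] partial_deriv_eq[OF differentiable_has_derivative])
  qed
  ultimately show ?case by simp
qed

lemma Ck_on_SucI:
  assumes "open S"
    and "\<And>x. x \<in> S \<Longrightarrow> (u has_derivative (\<lambda>h. D h x)) (at x)"
    and "\<And>b. b \<in> Basis \<Longrightarrow> D b \<in> Ck_on k S"
  shows "u \<in> Ck_on (Suc k) S"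
proof -
  have "partial_deriv b u \<in> Ck_on k S" if "b \<in> Basis" for b
    by (rule Ck_on_cong[OF assms(1) _ assms(3)[OF that]]) (simp add: partial_deriv_eq[OF assms(2)])
  then show ?thesis using assms(2) by (auto intro: differentiableI)
qed

lemma Ck_on_SucD:
  assumes "u \<in> Ck_on (Suc k) S"
  shows "x \<in> S \<Longrightarrow> (u has_derivative (\<lambda>h. \<Sum>b\<in>Basis. (h \<bullet> b) * partial_deriv b u x)) (at x)"
    and "b \<in> Basis \<Longrightarrow> partial_deriv b u \<in> Ck_on k S"
  using assms by (auto intro: differentiable_has_derivative)

lemma Ck_on_Suc_imp: "u \<in> Ck_on (Suc k) S \<Longrightarrow> u \<in> Ck_on k S"
proof (induction k arbitrary: u)
  case 0
  then show ?case
    by (auto intro!: continuous_at_imp_continuous_on differentiable_imp_continuous_within)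
next
  case (Suc k)
  then show ?case by auto
qed

lemma Ck_on_Un: "open S \<Longrightarrow> open T \<Longrightarrow> u \<in> Ck_on k S \<Longrightarrow> u \<in> Ck_on k T \<Longrightarrow> u \<in> Ck_on k (S \<union> T)"
  by (induction k arbitrary: u) (auto intro: continuous_on_open_Un)

lemma Ck_on_const: "(\<lambda>x. c) \<in> Ck_on k S"
proof (induction k arbitrary: c)
  case (Suc k)
  have "partial_deriv b (\<lambda>x. c) = (\<lambda>x. 0)" for b :: 'a
    by (simp add: fun_eq_iff partial_deriv_eq[OF has_derivative_const])
  with Suc[of 0] show ?case by simp
qed simp

lemma Ck_on_add: "open S \<Longrightarrow> u \<in> Ck_on k S \<Longrightarrow> v \<in> Ck_on k S \<Longrightarrow> (\<lambda>x. u x + v x) \<in> Ck_on k S"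
proof (induction k arbitrary: u v)
  case (Suc k)
  show ?case
  proof (rule Ck_on_SucI[OF Suc.prems(1)])
    show "((\<lambda>x. u x + v x) has_derivative
        (\<lambda>h. (\<Sum>b\<in>Basis. (h \<bullet> b) * partial_deriv b u x) + (\<Sum>b\<in>Basis. (h \<bullet> b) * partial_deriv b v x))) (at x)"
      if "x \<in> S" for x
      by (intro has_derivative_add Ck_on_SucD(1)[OF Suc.prems(2) that] Ck_on_SucD(1)[OF Suc.prems(3) that])
    show "(\<lambda>x. (\<Sum>c\<in>Basis. (b \<bullet> c) * partial_deriv c u x) + (\<Sum>c\<in>Basis. (b \<bullet> c) * partial_deriv c v x)) \<in> Ck_on k S"
      if b: "b \<in> Basis" for b
      using Suc.IH[OF Suc.prems(1) Ck_on_SucD(2)[OF Suc.prems(2) b] Ck_on_SucD(2)[OF Suc.prems(3) b]] b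
      by (simp add: inner_Basis if_distrib[of "\<lambda>c. c * _"] cong: if_cong)
  qed
qed (simp add: continuous_on_add)

lemma Ck_on_mult: "open S \<Longrightarrow> u \<in> Ck_on k S \<Longrightarrow> v \<in> Ck_on k S \<Longrightarrow> (\<lambda>x. u x * v x) \<in> Ck_on k S"
proof (induction k arbitrary: u v)
  case (Suc k)
  show ?case
  proof (rule Ck_on_SucI[OF Suc.prems(1)])
    show "((\<lambda>x. u x * v x) has_derivative
        (\<lambda>h. u x * (\<Sum>b\<in>Basis. (h \<bullet> b) * partial_deriv b v x) + (\<Sum>b\<in>Basis. (h \<bullet> b) * partial_deriv b u x) * v x)) (at x)"
      if "x \<in> S" for x
      by (intro has_derivative_mult Ck_on_SucD(1)[OF Suc.prems(2) that] Ck_on_SucD(1)[OF Suc.prems(3) that])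
    show "(\<lambda>x. u x * (\<Sum>c\<in>Basis. (b \<bullet> c) * partial_deriv c v x) + (\<Sum>c\<in>Basis. (b \<bullet> c) * partial_deriv c u x) * v x) \<in> Ck_on k S"
      if b: "b \<in> Basis" for b
      using Ck_on_add[OF Suc.prems(1)
            Suc.IH[OF Suc.prems(1) Ck_on_Suc_imp[OF Suc.prems(2)] Ck_on_SucD(2)[OF Suc.prems(3) b]]
            Suc.IH[OF Suc.prems(1) Ck_on_SucD(2)[OF Suc.prems(2) b] Ck_on_Suc_imp[OF Suc.prems(3)]]] b
      by (simp add: inner_Basis if_distrib[of "\<lambda>c. c * _"] cong: if_cong)
  qed
qed (simp add: continuous_on_mult)

lemma Ck_on_scale: "open S \<Longrightarrow> u \<in> Ck_on k S \<Longrightarrow> (\<lambda>x. c * u x) \<in> Ck_on k S"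
  by (intro Ck_on_mult Ck_on_const)

lemma Ck_on_prod:
  "finite I \<Longrightarrow> open S \<Longrightarrow> (\<And>i. i \<in> I \<Longrightarrow> u i \<in> Ck_on k S) \<Longrightarrow> (\<lambda>x. \<Prod>i\<in>I. u i x) \<in> Ck_on k S"
  by (induction I rule: finite_induct) (auto intro: Ck_on_const Ck_on_mult)

lemma Ck_on_inverse:
  "open S \<Longrightarrow> u \<in> Ck_on k S \<Longrightarrow> (\<And>x. x \<in> S \<Longrightarrow> u x \<noteq> 0) \<Longrightarrow> (\<lambda>x. inverse (u x)) \<in> Ck_on k S"
proof (induction k arbitrary: u)
  case (Suc k)
  show ?case
  proof (rule Ck_on_SucI[OF Suc.prems(1)])
    show "((\<lambda>x. inverse (u x)) has_derivative
        (\<lambda>h. - (inverse (u x) * (\<Sum>b\<in>Basis. (h \<bullet> b) * partial_deriv b u x) * inverse (u x)))) (at x)"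
      if "x \<in> S" for x
      by (intro Deriv.has_derivative_inverse Ck_on_SucD(1)[OF Suc.prems(2) that] Suc.prems(3)[OF that])
    show "(\<lambda>x. - (inverse (u x) * (\<Sum>c\<in>Basis. (b \<bullet> c) * partial_deriv c u x) * inverse (u x))) \<in> Ck_on k S"
      if b: "b \<in> Basis" for b
    proof -
      have inv: "(\<lambda>x. inverse (u x)) \<in> Ck_on k S"
        by (rule Suc.IH[OF Suc.prems(1) Ck_on_Suc_imp[OF Suc.prems(2)] Suc.prems(3)])
      have "(\<lambda>x. (-1) * (inverse (u x) * partial_deriv b u x * inverse (u x))) \<in> Ck_on k S"
        by (intro Ck_on_scale Ck_on_mult Suc.prems(1) inv Ck_on_SucD(2)[OF Suc.prems(2) b])
      with b show ?thesis by (simp add: inner_Basis if_distrib[of "\<lambda>c. c * _"] cong: if_cong)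
    qed
  qed
qed (auto intro: continuous_on_inverse)

lemma Ck_on_inner: "open S \<Longrightarrow> (\<lambda>x. x \<bullet> a) \<in> Ck_on k S"
proof (cases k)
  case (Suc n)
  assume "open S"
  then show ?thesis unfolding Suc
    by (rule Ck_on_SucI[where D = "\<lambda>h x. h \<bullet> a"]) (auto intro: Ck_on_const has_derivative_inner_left has_derivative_ident)
qed (auto intro: continuous_intros)

text \<open>The function equal to \<open>p (1/t) exp (- 1/t)\<close> for positive \<open>t\<close>: a class of flat functions that
  is closed under differentiation.\<close>

definition flat :: "real poly \<Rightarrow> real \<Rightarrow> real" where
  "flat p t = (if t > 0 then poly p (1 / t) * exp (- 1 / t) else 0)"

lemma poly_times_exp_tendsto_0: "((\<lambda>s. poly p s * exp (- s)) \<longlongrightarrow> 0) at_top" for p :: "real poly"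
proof -
  have "((\<lambda>s. \<Sum>i\<le>degree p. coeff p i * (s ^ i / exp s)) \<longlongrightarrow> (\<Sum>i\<le>degree p. coeff p i * 0)) at_top"
    by (intro tendsto_intros tendsto_power_div_exp_0)
  then show ?thesis
    by (simp add: poly_altdef sum_distrib_right sum_divide_distrib exp_minus field_simps)
qed

lemma flat_tendsto_0: "(flat p \<longlongrightarrow> 0) (at 0)"
proof -
  have right: "(flat p \<longlongrightarrow> 0) (at_right 0)"
  proof (rule Lim_transform_eventually)
    show "((\<lambda>t. poly p (inverse t) * exp (- inverse t)) \<longlongrightarrow> 0) (at_right 0)"
      using filterlim_compose[OF poly_times_exp_tendsto_0 filterlim_inverse_at_top_right] by simp
    show "\<forall>\<^sub>F t in at_right 0. poly p (inverse t) * exp (- inverse t) = flat p t"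
      using eventually_at_right_less by eventually_elim (simp add: flat_def field_simps)
  qed
  have left: "(flat p \<longlongrightarrow> 0) (at_left 0)"
    by (rule tendsto_eventually) (auto simp: eventually_at_filter flat_def)
  from left right show ?thesis by (rule filterlim_split_at)
qed

lemma flat_has_derivative:
  "(flat p has_real_derivative flat ([:0, 0, 1:] * (p - pderiv p)) t) (at t)"
proof -
  consider "t > 0" | "t < 0" | "t = 0" by linarith
  then show ?thesis
  proof cases
    case 1
    have "((\<lambda>t. poly p (1 / t) * exp (- 1 / t)) has_real_derivative
        flat ([:0, 0, 1:] * (p - pderiv p)) t) (at t)"
      using 1 by (auto intro!: derivative_eq_intros poly_DERIV[THEN DERIV_chain2] simp: flat_def field_simps power2_eq_square)
    then show ?thesis
      by (rule has_field_derivative_transform_within_open[of _ _ _ "{0<..}"]) (use 1 in \<open>auto simp: flat_def\<close>)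
  next
    case 2
    have "((\<lambda>t. 0) has_real_derivative flat ([:0, 0, 1:] * (p - pderiv p)) t) (at t)"
      using 2 by (simp add: flat_def)
    then show ?thesis
      by (rule has_field_derivative_transform_within_open[of _ _ _ "{..<0}"]) (use 2 in \<open>auto simp: flat_def\<close>)
  next
    case 3
    have "((\<lambda>h. (flat p (0 + h) - flat p 0) / h) \<longlongrightarrow> 0) (at 0)"
    proof (rule Lim_transform_eventually[OF flat_tendsto_0[of "[:0, 1:] * p"]])
      show "\<forall>\<^sub>F h in at 0. flat ([:0, 1:] * p) h = (flat p (0 + h) - flat p 0) / h"
        by (auto simp: eventually_at_filter flat_def)
    qed
    then show ?thesis using 3 by (simp add: DERIV_def flat_def)
  qed
qed

lemma Ck_on_flat: "open S \<Longrightarrow> u \<in> Ck_on k S \<Longrightarrow> (\<lambda>x. flat p (u x)) \<in> Ck_on k S"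
proof (induction k arbitrary: p)
  case 0
  have "continuous_on UNIV (flat p)"
    by (intro continuous_at_imp_continuous_on ballI DERIV_isCont[OF flat_has_derivative])
  with 0 show ?case using continuous_on_compose2[of UNIV "flat p" S u] by simp
next
  case (Suc k)
  let ?q = "[:0, 0, 1:] * (p - pderiv p)"
  show ?case
  proof (rule Ck_on_SucI[OF Suc.prems(1)])
    show "((\<lambda>x. flat p (u x)) has_derivative
        (\<lambda>h. (\<Sum>b\<in>Basis. (h \<bullet> b) * partial_deriv b u x) * flat ?q (u x))) (at x)" if "x \<in> S" for x
    proof -
      have "(flat p has_derivative (\<lambda>h. h * flat ?q (u x))) (at (u x))"
      proof -
        have "(*) c = (\<lambda>h. h * c)" for c :: real by (simp add: fun_eq_iff mult.commute)
        then show ?thesis using flat_has_derivative[of p "u x"] unfolding has_field_derivative_def by metis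
      qed
      from has_derivative_compose[OF Ck_on_SucD(1)[OF Suc.prems(2) that] this] show ?thesis .
    qed
    show "(\<lambda>x. (\<Sum>c\<in>Basis. (b \<bullet> c) * partial_deriv c u x) * flat ?q (u x)) \<in> Ck_on k S"
      if b: "b \<in> Basis" for b
      using Ck_on_mult[OF Suc.prems(1) Ck_on_SucD(2)[OF Suc.prems(2) b]
          Suc.IH[OF Suc.prems(1) Ck_on_Suc_imp[OF Suc.prems(2)]], of ?q] b
      by (simp add: inner_Basis if_distrib[of "\<lambda>c. c * _"] cong: if_cong)
  qed
qed

lemma Cc_infinity_iff:
  "u \<in> Cc_infinity \<Gamma> \<longleftrightarrow> u \<in> Cc \<Gamma> \<and> (\<forall>k. u \<in> Ck_on k UNIV)"
  by (auto simp: Cc_infinity_def Ck_on_UNIV)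

lemma Cc_infinityI:
  assumes "compact K" "K \<subseteq> \<Gamma>" "\<And>x. x \<notin> K \<Longrightarrow> u x = 0" "\<And>k. u \<in> Ck_on k UNIV"
  shows "u \<in> Cc_infinity \<Gamma>"
  using assms(4)[of 0] assms unfolding Cc_infinity_iff Cc_iff by auto

lemma Cc_infinityE:
  assumes "u \<in> Cc_infinity \<Gamma>"
  obtains K where "compact K" "K \<subseteq> \<Gamma>" "\<And>x. x \<notin> K \<Longrightarrow> u x = 0" "\<And>k. u \<in> Ck_on k UNIV"
  using assms unfolding Cc_infinity_iff Cc_iff by blast

lemma Cc_infinity_subset_Cc: "Cc_infinity \<Gamma> \<subseteq> Cc \<Gamma>"
  by (auto simp: Cc_infinity_def)

lemma Cc_add: "u \<in> Cc \<Gamma> \<Longrightarrow> v \<in> Cc \<Gamma> \<Longrightarrow> (\<lambda>x. u x + v x) \<in> Cc \<Gamma>" for u :: "'a::t2_space \<Rightarrow> real"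
proof -
  assume "u \<in> Cc \<Gamma>" "v \<in> Cc \<Gamma>"
  then obtain K L where "compact K" "K \<subseteq> \<Gamma>" "\<forall>x. x \<notin> K \<longrightarrow> u x = 0" "compact L" "L \<subseteq> \<Gamma>" "\<forall>x. x \<notin> L \<longrightarrow> v x = 0"
    "continuous_on UNIV u" "continuous_on UNIV v"
    unfolding Cc_iff by blast
  then show ?thesis unfolding Cc_iff
    by (intro conjI exI[of _ "K \<union> L"] continuous_on_add compact_Un) auto
qed

lemma Cc_comp:
  fixes u :: "'a::t2_space \<Rightarrow> real"
  assumes "u \<in> Cc \<Gamma>" "continuous_on UNIV h" "h 0 = 0"
  shows "(\<lambda>x. h (u x)) \<in> Cc \<Gamma>"
  using assms continuous_on_compose2[OF assms(2), of UNIV u] unfolding Cc_iff by auto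

lemma Cc_scale: "u \<in> Cc \<Gamma> \<Longrightarrow> (\<lambda>x. c * u x) \<in> Cc \<Gamma>" for u :: "'a::t2_space \<Rightarrow> real"
  by (rule Cc_comp[where h = "\<lambda>t. c * t"]) (auto intro: continuous_intros)

lemma Cc_mult: "u \<in> Cc \<Gamma> \<Longrightarrow> continuous_on UNIV v \<Longrightarrow> (\<lambda>x. v x * u x) \<in> Cc \<Gamma>"
  for u :: "'a::t2_space \<Rightarrow> real"
  unfolding Cc_iff by (auto intro: continuous_on_mult)

lemma Cc_infinity_add: "u \<in> Cc_infinity \<Gamma> \<Longrightarrow> v \<in> Cc_infinity \<Gamma> \<Longrightarrow> (\<lambda>x. u x + v x) \<in> Cc_infinity \<Gamma>"
  unfolding Cc_infinity_iff by (auto intro: Cc_add Ck_on_add)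

lemma Cc_infinity_mult: "u \<in> Cc_infinity \<Gamma> \<Longrightarrow> (\<And>k. v \<in> Ck_on k UNIV) \<Longrightarrow> (\<lambda>x. v x * u x) \<in> Cc_infinity \<Gamma>"
proof -
  assume u: "u \<in> Cc_infinity \<Gamma>" and v: "\<And>k. v \<in> Ck_on k UNIV"
  have "continuous_on UNIV v" using v[of 0] by simp
  with u v show ?thesis unfolding Cc_infinity_iff by (auto intro: Cc_mult Ck_on_mult)
qed

lemma Cc_infinity_scale: "u \<in> Cc_infinity \<Gamma> \<Longrightarrow> (\<lambda>x. c * u x) \<in> Cc_infinity \<Gamma>"
  by (rule Cc_infinity_mult) (auto intro: Ck_on_const)

lemma Cc_infinity_zero: "(\<lambda>x. 0) \<in> Cc_infinity \<Gamma>"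
  by (rule Cc_infinityI[of "{}"]) (auto intro: Ck_on_const)

lemma Cc_infinity_has_derivative:
  assumes "u \<in> Cc_infinity \<Gamma>"
  shows "(u has_derivative (\<lambda>h. \<Sum>b\<in>Basis. (h \<bullet> b) * partial_deriv b u x)) (at x)"
proof -
  have "u \<in> Ck_on (Suc 0) UNIV" using assms unfolding Cc_infinity_iff by blast
  from Ck_on_SucD(1)[OF this] show ?thesis by simp
qed

lemma Cc_infinity_partial_deriv:
  assumes u: "u \<in> Cc_infinity \<Gamma>" and b: "b \<in> Basis"
  shows "partial_deriv b u \<in> Cc_infinity \<Gamma>"
proof -
  obtain K where K: "compact K" "K \<subseteq> \<Gamma>" "\<And>x. x \<notin> K \<Longrightarrow> u x = 0" "\<And>k. u \<in> Ck_on k UNIV"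
    using Cc_infinityE[OF u] by blast
  show ?thesis
  proof (rule Cc_infinityI[OF K(1,2)])
    show "partial_deriv b u \<in> Ck_on k UNIV" for k using Ck_on_SucD(2)[OF K(4) b] .
    fix x assume "x \<notin> K"
    have "(u has_derivative (\<lambda>h. 0)) (at x)"
    proof (rule has_derivative_transform_within_open[of "\<lambda>x. 0" _ _ _ "- K"])
      show "open (- K)" using K(1) by (simp add: compact_imp_closed open_Compl)
    qed (use \<open>x \<notin> K\<close> K(3) in auto)
    then show "partial_deriv b u x = 0" by (rule partial_deriv_eq)
  qed
qed

text \<open>The quotient \<open>a / (a + b)\<close>, where \<open>a\<close> is positive exactly in the large ball and \<open>b\<close> exactly
  outside of the small one.\<close>

lemma ball_cutoff:
  fixes a :: "'a::euclidean_space"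
  assumes "r > 0"
  obtains \<eta> where "\<And>k. \<eta> \<in> Ck_on k UNIV" "\<And>x. 0 \<le> \<eta> x \<and> \<eta> x \<le> 1"
    "\<And>x. x \<in> cball a r \<Longrightarrow> \<eta> x = 1" "\<And>x. x \<notin> cball a (2 * r) \<Longrightarrow> \<eta> x = (0::real)"
proof -
  define q where "q x = (\<Sum>b\<in>Basis. ((x - a) \<bullet> b) * ((x - a) \<bullet> b))" for x :: 'a
  have q_eq: "q x = (dist a x)\<^sup>2" for x
    unfolding q_def dist_norm power2_norm_eq_inner norm_minus_commute[of a x] by (rule euclidean_inner[symmetric])
  have q_smooth: "q \<in> Ck_on k UNIV" for k
  proof -
    have lin: "(\<lambda>x::'a. x \<bullet> b + - (a \<bullet> b)) \<in> Ck_on k UNIV" for b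
      by (intro Ck_on_add Ck_on_inner Ck_on_const open_UNIV)
    have "(\<lambda>x. \<Sum>b\<in>B. ((x - a) \<bullet> b) * ((x - a) \<bullet> b)) \<in> Ck_on k UNIV" if "finite B" for B
      using that
      by (induction B rule: finite_induct)
        (auto intro!: Ck_on_const Ck_on_add Ck_on_mult lin[simplified] simp: inner_diff_left)
    then show ?thesis unfolding q_def by simp
  qed
  define A B where "A x = flat 1 ((2 * r)\<^sup>2 + (-1) * q x)" and "B x = flat 1 (q x + - (r\<^sup>2))" for x
  have A: "A \<in> Ck_on k UNIV" and B: "B \<in> Ck_on k UNIV" for k
    unfolding A_def B_def by (intro Ck_on_flat Ck_on_add Ck_on_const Ck_on_scale q_smooth open_UNIV)+
  have rr: "r\<^sup>2 < (2 * r)\<^sup>2" using assms by (simp add: power_strict_mono)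
  have nn: "A x \<ge> 0" "B x \<ge> 0" "A x + B x > 0" for x
  proof -
    have flat1: "flat 1 t \<ge> 0" "t > 0 \<Longrightarrow> flat 1 t > 0" for t unfolding flat_def by auto
    show "A x \<ge> 0" "B x \<ge> 0" unfolding A_def B_def by (rule flat1)+
    have "(2 * r)\<^sup>2 + (-1) * q x > 0 \<or> q x + - (r\<^sup>2) > 0" using rr by linarith
    then show "A x + B x > 0" unfolding A_def B_def using flat1 by (metis add_nonneg_pos add_pos_nonneg)
  qed
  define \<eta> where "\<eta> x = A x * inverse (A x + B x)" for x
  show ?thesis
  proof
    show "\<eta> \<in> Ck_on k UNIV" for k unfolding \<eta>_def[abs_def]
      using nn(3) by (intro Ck_on_mult Ck_on_inverse Ck_on_add A B open_UNIV) (metis less_irrefl)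
    show "0 \<le> \<eta> x \<and> \<eta> x \<le> 1" for x
      unfolding \<eta>_def using nn[of x] by (auto simp: field_simps)
    show "\<eta> x = 1" if "x \<in> cball a r" for x
    proof -
      have "(dist a x)\<^sup>2 \<le> r\<^sup>2" using that by (simp add: power_mono)
      then have "B x = 0" unfolding B_def q_eq flat_def by simp
      then show ?thesis unfolding \<eta>_def using nn(3)[of x] by simp
    qed
    show "\<eta> x = 0" if "x \<notin> cball a (2 * r)" for x
    proof -
      have "(2 * r)\<^sup>2 \<le> (dist a x)\<^sup>2" using that assms by (intro power_mono) auto
      then have "A x = 0" unfolding A_def q_eq flat_def by simp
      then show ?thesis unfolding \<eta>_def by simp
    qed
  qed
qed

text \<open>Cover \<open>K\<close> by finitely many small balls: one minus the product of the complements of the cutoff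
  functions of these balls equals one as soon as one of them does.\<close>

lemma smooth_cutoff:
  fixes K :: "'a::euclidean_space set"
  assumes K: "compact K" and S: "open S" "K \<subseteq> S"
  obtains \<eta> where "\<eta> \<in> Cc_infinity S" "\<And>x. 0 \<le> \<eta> x \<and> \<eta> x \<le> 1" "\<And>x. x \<in> K \<Longrightarrow> \<eta> x = 1"
proof -
  have "\<forall>a\<in>K. \<exists>r>0. cball a (2 * r) \<subseteq> S"
  proof
    fix a assume "a \<in> K"
    then obtain e where "e > 0" "cball a e \<subseteq> S" using S open_contains_cball by blast
    then show "\<exists>r>0. cball a (2 * r) \<subseteq> S" by (intro exI[of _ "e/2"]) auto
  qed
  then obtain r where r: "\<And>a. a \<in> K \<Longrightarrow> r a > 0 \<and> cball a (2 * r a) \<subseteq> S" by metis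
  have "\<forall>a\<in>K. \<exists>\<eta>. (\<forall>k. \<eta> \<in> Ck_on k UNIV) \<and> (\<forall>x. 0 \<le> \<eta> x \<and> \<eta> x \<le> (1::real)) \<and>
      (\<forall>x. x \<in> cball a (r a) \<longrightarrow> \<eta> x = 1) \<and> (\<forall>x. x \<notin> cball a (2 * r a) \<longrightarrow> \<eta> x = 0)"
    using r ball_cutoff by metis
  then obtain c where c: "\<And>a k. a \<in> K \<Longrightarrow> c a \<in> Ck_on k UNIV" "\<And>a x. a \<in> K \<Longrightarrow> 0 \<le> c a x \<and> c a x \<le> (1::real)"
      "\<And>a x. a \<in> K \<Longrightarrow> x \<in> cball a (r a) \<Longrightarrow> c a x = 1"
      "\<And>a x. a \<in> K \<Longrightarrow> x \<notin> cball a (2 * r a) \<Longrightarrow> c a x = 0"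
    by metis
  obtain J where J: "J \<subseteq> K" "finite J" "K \<subseteq> (\<Union>a\<in>J. ball a (r a))"
    by (rule compactE_image[OF K, of K "\<lambda>a. ball a (r a)"]) (use r in force)+
  define \<eta> where "\<eta> x = 1 + (-1) * (\<Prod>a\<in>J. 1 + (-1) * c a x)" for x
  have bounds: "0 \<le> (\<Prod>a\<in>J. 1 + (-1) * c a x)" "(\<Prod>a\<in>J. 1 + (-1) * c a x) \<le> 1" for x
    using c(2) J(1) by (auto intro!: prod_nonneg prod_le_1 simp: subset_iff)
  show ?thesis
  proof
    show "\<eta> \<in> Cc_infinity S"
    proof (rule Cc_infinityI)
      show "compact (\<Union>a\<in>J. cball a (2 * r a))" using J(2) by auto
      show "(\<Union>a\<in>J. cball a (2 * r a)) \<subseteq> S" using r J(1) by auto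
      show "\<eta> \<in> Ck_on k UNIV" for k unfolding \<eta>_def[abs_def]
        using J c(1) by (intro Ck_on_add Ck_on_const Ck_on_scale Ck_on_prod open_UNIV) auto
      show "\<eta> x = 0" if "x \<notin> (\<Union>a\<in>J. cball a (2 * r a))" for x
      proof -
        have "(\<Prod>a\<in>J. 1 + (-1) * c a x) = 1" using that c(4) J(1) by (intro prod.neutral) auto
        then show ?thesis by (simp add: \<eta>_def)
      qed
    qed
    show "0 \<le> \<eta> x \<and> \<eta> x \<le> 1" for x unfolding \<eta>_def using bounds[of x] by simp
    show "\<eta> x = 1" if xK: "x \<in> K" for x
    proof -
      obtain a where a: "a \<in> J" "x \<in> cball a (r a)" using subsetD[OF J(3) xK] by force
      then have "c a x = 1" using c(3) J(1) by blast
      then have "(\<Prod>a\<in>J. 1 + (-1) * c a x) = 0" using a(1) J(2) by (intro prod_zero) auto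
      then show ?thesis by (simp add: \<eta>_def)
    qed
  qed
qed

text \<open>Composition with a holomorphic map: by the chain rule the partial derivatives are again
  combinations of functions composed with \<open>f\<close> and of real and imaginary parts of holomorphic
  functions.\<close>

lemma Re_holomorphic_Ck_on:
  assumes "open S" "h holomorphic_on S"
  shows "(\<lambda>z. Re (c * h z)) \<in> Ck_on k S"
  using assms(2)
proof (induction k arbitrary: c h)
  case 0
  then show ?case by (auto intro!: continuous_intros holomorphic_on_imp_continuous_on)
next
  case (Suc k)
  show ?case
  proof (rule Ck_on_SucI[OF assms(1)])
    show "((\<lambda>z. Re (c * h z)) has_derivative (\<lambda>b. Re ((c * b) * deriv h z))) (at z)" if "z \<in> S" for z
    proof -
      have "(h has_derivative (\<lambda>b. deriv h z * b)) (at z)"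
        using holomorphic_derivI[OF Suc.prems assms(1) that] by (simp add: has_field_derivative_def)
      then have "((\<lambda>z. Re (c * h z)) has_derivative (\<lambda>b. Re (c * (deriv h z * b)))) (at z)"
        by (intro has_derivative_Re has_derivative_mult_right)
      then show ?thesis by (simp add: mult_ac)
    qed
    show "(\<lambda>z. Re ((c * b) * deriv h z)) \<in> Ck_on k S" for b
      by (rule Suc.IH[OF holomorphic_deriv[OF Suc.prems assms(1)]])
  qed
qed

lemma Ck_on_comp_holomorphic:
  assumes S: "open S" and f: "f holomorphic_on S" "f ` S \<subseteq> T" and u: "u \<in> Ck_on k T"
  shows "(\<lambda>z. u (f z)) \<in> Ck_on k S"
  using u
proof (induction k arbitrary: u)
  case 0
  then show ?case
    using continuous_on_compose2[OF _ holomorphic_on_imp_continuous_on[OF f(1)] f(2), of u] by simp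
next
  case (Suc k)
  let ?D = "\<lambda>b z. partial_deriv 1 u (f z) * Re (b * deriv f z) + partial_deriv \<i> u (f z) * Re ((- \<i> * b) * deriv f z)"
  show ?case
  proof (rule Ck_on_SucI[OF S])
    show "((\<lambda>z. u (f z)) has_derivative (\<lambda>b. ?D b z)) (at z)" if "z \<in> S" for z
    proof -
      have "(f has_derivative (\<lambda>b. deriv f z * b)) (at z)"
        using holomorphic_derivI[OF f(1) S that] by (simp add: has_field_derivative_def)
      moreover have "f z \<in> T" using f(2) that by blast
      ultimately have "((\<lambda>z. u (f z)) has_derivative
          (\<lambda>b. \<Sum>c\<in>Basis. ((deriv f z * b) \<bullet> c) * partial_deriv c u (f z))) (at z)"
        using has_derivative_compose[OF _ Ck_on_SucD(1)[OF Suc.prems]] by blast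
      moreover have "(\<lambda>b. \<Sum>c\<in>Basis. ((deriv f z * b) \<bullet> c) * partial_deriv c u (f z)) = (\<lambda>b. ?D b z)"
        by (simp add: Basis_complex_def inner_complex_def algebra_simps fun_eq_iff)
      ultimately show ?thesis by simp
    qed
    have D: "(\<lambda>z. partial_deriv c u (f z)) \<in> Ck_on k S" if "c \<in> Basis" for c
      by (rule Suc.IH[OF Ck_on_SucD(2)[OF Suc.prems that]])
    show "?D b \<in> Ck_on k S" for b
      by (intro Ck_on_add Ck_on_mult S D Re_holomorphic_Ck_on holomorphic_deriv f(1)) (auto simp: Basis_complex_def)
  qed
qed

section \<open>Lebesgue measure on an open set\<close>

lemma sets_dx_on: "sets (dx_on \<Gamma>) = sets (restrict_space borel \<Gamma>)"
  by (rule sets_restrict_space_cong) simp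

lemma space_dx_on: "space (dx_on \<Gamma>) = \<Gamma>"
  by (simp add: space_restrict_space)

lemma measurable_dx_on: "borel_measurable (dx_on \<Gamma>) = borel_measurable (restrict_space borel \<Gamma>)"
  by (rule measurable_cong_sets[OF sets_dx_on refl])

lemma continuous_measurable_dx_on:
  "continuous_on \<Gamma> u \<Longrightarrow> u \<in> borel_measurable (dx_on \<Gamma>)" for u :: "'a::euclidean_space \<Rightarrow> 'b::topological_space"
  unfolding measurable_dx_on by (rule borel_measurable_continuous_on_restrict)

lemma measurable_dx_on_borel:
  "u \<in> borel_measurable borel \<Longrightarrow> u \<in> borel_measurable (dx_on \<Gamma>)" for u :: "'a::euclidean_space \<Rightarrow> 'b::topological_space"
  unfolding measurable_dx_on by (rule measurable_restrict_space1)

lemma borel_measurable_indicator_mult: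
  fixes u :: "'a::euclidean_space \<Rightarrow> 'b::real_normed_vector"
  assumes "open \<Gamma>" "u \<in> borel_measurable (dx_on \<Gamma>)"
  shows "(\<lambda>x. indicator \<Gamma> x *\<^sub>R u x) \<in> borel_measurable borel"
  using assms borel_measurable_restrict_space_iff[of \<Gamma> borel u]
  by (simp add: measurable_dx_on borel_open)

lemma integral_dx_on:
  fixes u :: "'a::euclidean_space \<Rightarrow> 'b::{banach, second_countable_topology}"
  assumes "open \<Gamma>"
  shows "(\<integral>x. u x \<partial>dx_on \<Gamma>) = (\<integral>x. indicator \<Gamma> x *\<^sub>R u x \<partial>lborel)"
  by (rule integral_restrict_space) (use assms in simp)

lemma integrable_dx_on:
  fixes u :: "'a::euclidean_space \<Rightarrow> 'b::{banach, second_countable_topology}"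
  assumes "open \<Gamma>"
  shows "integrable (dx_on \<Gamma>) u \<longleftrightarrow> integrable lborel (\<lambda>x. indicator \<Gamma> x *\<^sub>R u x)"
  by (rule integrable_restrict_space) (use assms in simp)

lemma AE_dx_on: "open \<Gamma> \<Longrightarrow> (AE x in dx_on \<Gamma>. P x) \<longleftrightarrow> (AE x in lborel. x \<in> \<Gamma> \<longrightarrow> P x)"
  by (rule AE_restrict_space_iff) simp

lemma integrable_indicator_compact: "compact K \<Longrightarrow> integrable lborel (indicator K :: 'a::euclidean_space \<Rightarrow> real)"
  using emeasure_bounded_finite[OF compact_imp_bounded, of K]
  by (intro integrable_real_indicator) (auto intro: borel_compact)

lemma integrable_compact_support:
  fixes u :: "'a::euclidean_space \<Rightarrow> 'b::euclidean_space"
  assumes "open \<Gamma>" "compact K" "u \<in> borel_measurable (dx_on \<Gamma>)"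
    and B: "\<And>x. norm (u x) \<le> B" and z: "\<And>x. x \<notin> K \<Longrightarrow> u x = 0"
  shows "integrable (dx_on \<Gamma>) u"
  unfolding integrable_dx_on[OF assms(1)]
proof (rule Bochner_Integration.integrable_bound)
  show "integrable lborel (\<lambda>x. B * indicator K x)"
    by (intro integrable_mult_right integrable_indicator_compact assms(2))
  show "(\<lambda>x. indicator \<Gamma> x *\<^sub>R u x) \<in> borel_measurable lborel"
    using borel_measurable_indicator_mult[OF assms(1,3)] by simp
  have "norm (indicator \<Gamma> x *\<^sub>R u x) \<le> norm (B * indicator K x)" for x
    using B[of x] z[of x] by (cases "x \<in> K"; cases "x \<in> \<Gamma>") (auto simp: indicator_def)
  then show "AE x in lborel. norm (indicator \<Gamma> x *\<^sub>R u x) \<le> norm (B * indicator K x)" by simp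
qed

lemma sq_int_compact_support:
  fixes u :: "'a::euclidean_space \<Rightarrow> 'b::euclidean_space"
  assumes "open \<Gamma>" "compact K" "u \<in> borel_measurable (dx_on \<Gamma>)"
    and B: "\<And>x. norm (u x) \<le> B" and z: "\<And>x. x \<notin> K \<Longrightarrow> u x = 0"
  shows "u \<in> sq_int (dx_on \<Gamma>)"
proof -
  have "integrable (dx_on \<Gamma>) (\<lambda>x. (norm (u x))\<^sup>2)"
  proof (rule integrable_compact_support[OF assms(1,2)])
    show "(\<lambda>x. (norm (u x))\<^sup>2) \<in> borel_measurable (dx_on \<Gamma>)" using assms(3) by measurable
    show "norm ((norm (u x))\<^sup>2) \<le> B\<^sup>2" for x using B[of x] by (simp add: power_mono)
  qed (use z in auto)
  then show ?thesis using assms(3) by (simp add: sq_int_def)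
qed

lemma Cc_bounded:
  assumes "u \<in> Cc \<Gamma>"
  obtains B where "\<And>x::'a::euclidean_space. \<bar>u x\<bar> \<le> B"
proof -
  obtain K where K: "compact K" "\<And>x. x \<notin> K \<Longrightarrow> u x = 0" and c: "continuous_on UNIV u"
    using assms unfolding Cc_iff by blast
  have "bounded (u ` K)"
    by (intro compact_imp_bounded compact_continuous_image K continuous_on_subset[OF c]) simp
  then obtain B where B: "\<And>x. x \<in> K \<Longrightarrow> \<bar>u x\<bar> \<le> B" unfolding bounded_iff by auto
  have "\<bar>u x\<bar> \<le> max 0 B" for x
    using B[of x] K(2)[of x] by (cases "x \<in> K") auto
  then show ?thesis using that by blast
qed

lemma Cc_sq_int:
  assumes "open \<Gamma>" "u \<in> Cc \<Delta>"
  shows "u \<in> sq_int (dx_on \<Gamma>)"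
proof -
  obtain K where K: "compact K" "\<And>x. x \<notin> K \<Longrightarrow> u x = 0" and c: "continuous_on UNIV u"
    using assms(2) unfolding Cc_iff by blast
  obtain B where "\<And>x. \<bar>u x\<bar> \<le> B" using Cc_bounded[OF assms(2)] by blast
  then show ?thesis
    using K c by (intro sq_int_compact_support[OF assms(1) K(1)] continuous_measurable_dx_on continuous_on_subset[OF c]) auto
qed

lemma Cc_infinity_sq_int: "open \<Gamma> \<Longrightarrow> u \<in> Cc_infinity \<Delta> \<Longrightarrow> u \<in> sq_int (dx_on \<Gamma>)"
  using Cc_sq_int Cc_infinity_subset_Cc by blast

text \<open>Fundamental lemma of the calculus of variations.  Cutoff functions of shrinking neighbourhoods
  show that \<open>h\<close> has integral zero over every compact set, hence that no compact set of positive
  measure is contained in the set where \<open>h\<close> is positive; inner regularity finishes the proof.\<close>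

lemma AE_zero_if_orthogonal:
  fixes h :: "'a::euclidean_space \<Rightarrow> real"
  assumes \<Gamma>: "open \<Gamma>" and h: "h \<in> sq_int (dx_on \<Gamma>)"
    and orth: "\<And>\<phi>. \<phi> \<in> Cc_infinity \<Gamma> \<Longrightarrow> (\<integral>x. h x * \<phi> x \<partial>dx_on \<Gamma>) = 0"
  shows "AE x in dx_on \<Gamma>. h x = 0"
proof -
  have hm [measurable]: "h \<in> borel_measurable (dx_on \<Gamma>)" by (rule sq_int_measurable[OF h])
  have compact_zero: "(\<integral>x. indicator K x * h x \<partial>dx_on \<Gamma>) = 0 \<and> integrable (dx_on \<Gamma>) (\<lambda>x. indicator K x * h x)"
    if K: "compact K" "K \<subseteq> \<Gamma>" "K \<noteq> {}" for K
  proof -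
    obtain \<eta> where \<eta>: "\<eta> \<in> Cc_infinity \<Gamma>" "\<And>x. 0 \<le> \<eta> x \<and> \<eta> x \<le> 1" "\<And>x. x \<in> K \<Longrightarrow> \<eta> x = 1"
      using smooth_cutoff[OF K(1) \<Gamma> K(2)] by metis
    define S where "S n = {x. infdist x K < 1 / real (Suc n)}" for n
    have "open (S n)" for n unfolding S_def by (intro open_Collect_less continuous_intros)
    moreover have "K \<subseteq> S n" for n unfolding S_def by auto
    ultimately have "\<exists>c. c \<in> Cc_infinity (S n) \<and> (\<forall>x. 0 \<le> c x \<and> c x \<le> (1::real)) \<and> (\<forall>x\<in>K. c x = 1)" for n
      using smooth_cutoff[OF K(1)] by metis
    then obtain c where c: "\<And>n. c n \<in> Cc_infinity (S n)" "\<And>n x. 0 \<le> c n x \<and> c n x \<le> (1::real)"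
        "\<And>n x. x \<in> K \<Longrightarrow> c n x = 1"
      by metis
    have c_smooth: "c n \<in> Ck_on k UNIV" for n k using c(1)[of n] unfolding Cc_infinity_iff by blast
    have prod: "(\<lambda>x. c n x * \<eta> x) \<in> Cc_infinity \<Gamma>" for n by (rule Cc_infinity_mult[OF \<eta>(1) c_smooth])
    have int\<eta>: "integrable (dx_on \<Gamma>) (\<lambda>x. h x * \<eta> x)"
      using integrable_inner_sq_int[OF h Cc_infinity_sq_int[OF \<Gamma> \<eta>(1)]] by simp
    have [measurable]: "\<eta> \<in> borel_measurable (dx_on \<Gamma>)" "(\<lambda>x. c n x * \<eta> x) \<in> borel_measurable (dx_on \<Gamma>)" for n
      using Cc_infinity_sq_int[OF \<Gamma>] \<eta>(1) prod sq_int_measurable by blast+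
    have [measurable]: "indicator K \<in> borel_measurable (dx_on \<Gamma>)"
      by (intro measurable_dx_on_borel borel_measurable_indicator borel_compact K(1))
    have lim: "(\<lambda>n. \<integral>x. h x * (c n x * \<eta> x) \<partial>dx_on \<Gamma>) \<longlonglongrightarrow> (\<integral>x. indicator K x * h x \<partial>dx_on \<Gamma>)"
    proof (rule integral_dominated_convergence[where w = "\<lambda>x. \<bar>h x * \<eta> x\<bar>"])
      have "(\<lambda>n. h x * (c n x * \<eta> x)) \<longlonglongrightarrow> indicator K x * h x" for x
      proof (cases "x \<in> K")
        case True
        then show ?thesis using c(3) \<eta>(3) by simp
      next
        case False
        then have pos: "infdist x K > 0"
          using K compact_imp_closed in_closed_iff_infdist_zero[of K x] infdist_nonneg[of x K] by fastforce
        obtain N where N: "1 / real (Suc N) < infdist x K" using nat_approx_posE[OF pos] by blast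
        have "h x * (c n x * \<eta> x) = 0" if "n \<ge> N" for n
        proof -
          have "1 / real (Suc n) \<le> 1 / real (Suc N)" using that by (simp add: frac_le)
          then have "x \<notin> S n" unfolding S_def using N by simp
          moreover obtain L where "L \<subseteq> S n" "\<And>x. x \<notin> L \<Longrightarrow> c n x = 0" using Cc_infinityE[OF c(1)] by metis
          ultimately show ?thesis by auto
        qed
        then have "(\<lambda>n. h x * (c n x * \<eta> x)) \<longlonglongrightarrow> 0"
          by (intro tendsto_eventually) (auto simp: eventually_sequentially)
        with False show ?thesis by simp
      qed
      then show "AE x in dx_on \<Gamma>. (\<lambda>n. h x * (c n x * \<eta> x)) \<longlonglongrightarrow> indicator K x * h x" by simp
      show "AE x in dx_on \<Gamma>. norm (h x * (c n x * \<eta> x)) \<le> \<bar>h x * \<eta> x\<bar>" for n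
      proof (rule AE_I2)
        fix x
        have "\<bar>c n x\<bar> * \<bar>h x * \<eta> x\<bar> \<le> 1 * \<bar>h x * \<eta> x\<bar>" using c(2)[of n x] by (intro mult_right_mono) auto
        then show "norm (h x * (c n x * \<eta> x)) \<le> \<bar>h x * \<eta> x\<bar>" by (simp add: abs_mult mult_ac)
      qed
      show "integrable (dx_on \<Gamma>) (\<lambda>x. \<bar>h x * \<eta> x\<bar>)" using int\<eta> by simp
    qed measurable
    have "integrable (dx_on \<Gamma>) (\<lambda>x. indicator K x * h x)"
    proof (rule Bochner_Integration.integrable_bound[OF int\<eta>])
      have "norm (indicator K x * h x) \<le> norm (h x * \<eta> x)" for x
        using \<eta>(3) by (auto simp: indicator_def)
      then show "AE x in dx_on \<Gamma>. norm (indicator K x * h x) \<le> norm (h x * \<eta> x)" by simp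
    qed measurable
    with lim show ?thesis using orth[OF prod] by (simp add: LIMSEQ_const_iff)
  qed
  define hh where "hh x = indicator \<Gamma> x * h x" for x
  have hh [measurable]: "hh \<in> borel_measurable borel"
    using borel_measurable_indicator_mult[OF \<Gamma> hm] unfolding hh_def[abs_def] by simp
  \<comment> \<open>With \<open>s = 1\<close> and \<open>s = -1\<close> this covers both signs of \<open>h\<close>.\<close>
  have sign: "{x. s * hh x > 0} \<in> null_sets lborel" for s :: real
  proof -
    let ?P = "{x. s * hh x > 0}"
    have P: "?P \<in> sets borel" by measurable
    then have "?P \<in> sets lebesgue" by simp
    then obtain C N where CN: "fsigma C" "N \<in> null_sets lebesgue" "C \<union> N = ?P"
      using lebesgue_set_almost_fsigma by metis
    obtain F :: "nat \<Rightarrow> 'a set" where F: "range F \<subseteq> Collect compact" "C = \<Union>(range F)"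
      using CN(1) fsigma_Union_compact by metis
    have "F n \<in> null_sets lebesgue" for n
    proof (cases "F n = {}")
      case False
      have K: "compact (F n)" using F by auto
      have sub: "F n \<subseteq> ?P" using F CN by auto
      have sub\<Gamma>: "F n \<subseteq> \<Gamma>"
      proof
        fix x assume "x \<in> F n"
        then have "hh x \<noteq> 0" using sub by auto
        then show "x \<in> \<Gamma>" by (simp add: hh_def split: split_indicator_asm)
      qed
      have int: "integrable (dx_on \<Gamma>) (\<lambda>x. s * (indicator (F n) x * h x))"
        "(\<integral>x. s * (indicator (F n) x * h x) \<partial>dx_on \<Gamma>) = 0"
        using compact_zero[OF K sub\<Gamma> False] by auto
      have nn: "0 \<le> s * (indicator (F n) x * h x)" for x
        using sub sub\<Gamma> by (cases "x \<in> F n") (auto simp: hh_def indicator_def subset_iff less_imp_le)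
      have "AE x in dx_on \<Gamma>. s * (indicator (F n) x * h x) = 0"
        using integral_nonneg_eq_0_iff_AE[OF int(1)] int(2) nn by simp
      then have "AE x in lborel. x \<in> \<Gamma> \<longrightarrow> s * (indicator (F n) x * h x) = 0"
        by (simp only: AE_dx_on[OF \<Gamma>])
      then have "AE x in lborel. x \<notin> F n"
      proof eventually_elim
        case (elim x)
        show ?case
        proof
          assume "x \<in> F n"
          then show False using elim sub sub\<Gamma> by (auto simp: hh_def indicator_def subset_iff)
        qed
      qed
      then have "F n \<in> null_sets lborel"
        using K by (subst (asm) AE_iff_null_sets[symmetric]) (auto intro: borel_compact)
      then show ?thesis by (rule null_sets_completionI)
    qed simp
    then have "C \<in> null_sets lebesgue" unfolding F(2) by (intro null_sets_UN) auto
    then have "?P \<in> null_sets lebesgue" using CN by (metis null_sets.Un)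
    then show ?thesis using P by (subst (asm) null_sets_completion_iff) auto
  qed
  have "AE x in lborel. x \<notin> {x. 1 * hh x > 0}" "AE x in lborel. x \<notin> {x. (-1) * hh x > 0}"
    by (intro AE_not_in sign)+
  then have "AE x in lborel. x \<in> \<Gamma> \<longrightarrow> h x = 0"
    by eventually_elim (auto simp: hh_def)
  then show ?thesis by (simp only: AE_dx_on[OF \<Gamma>])
qed

text \<open>The integral of a directional derivative is the derivative at \<open>0\<close> of the integrals of the
  translates, which are all equal.\<close>

lemma integral_partial_deriv_eq_0:
  fixes u :: "'a::euclidean_space \<Rightarrow> real"
  assumes u: "u \<in> Cc_infinity UNIV" and b: "b \<in> Basis"
  shows "(\<integral>x. partial_deriv b u x \<partial>lborel) = 0"
proof -
  obtain K where K: "compact K" "\<And>x. x \<notin> K \<Longrightarrow> u x = 0" using Cc_infinityE[OF u] by metis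
  obtain B where B: "\<And>x. \<bar>partial_deriv b u x\<bar> \<le> B"
    using Cc_bounded Cc_infinity_subset_Cc Cc_infinity_partial_deriv[OF u b] by blast
  have cont: "continuous_on UNIV u" "continuous_on UNIV (partial_deriv b u)"
    using u Cc_infinity_partial_deriv[OF u b] unfolding Cc_infinity_iff Cc_iff by auto
  have [measurable]: "u \<in> borel_measurable borel" "partial_deriv b u \<in> borel_measurable borel"
    using cont by (auto intro: borel_measurable_continuous_onI)
  define f where "f n x = real (Suc n) * (u (x + (1 / real (Suc n)) *\<^sub>R b) - u x)" for n x
  have [measurable]: "f n \<in> borel_measurable borel" for n unfolding f_def by measurable
  \<comment> \<open>All the difference quotients vanish off the union of the segments of length one that end in \<open>K\<close>.\<close>
  define K' where "K' = (\<lambda>(x, t). x - t *\<^sub>R b) ` (K \<times> {0..1})"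
  have K': "compact K'" unfolding K'_def case_prod_unfold
    by (intro compact_continuous_image continuous_intros compact_Times K compact_Icc)
  have line: "((\<lambda>t. u (x + t *\<^sub>R b)) has_real_derivative partial_deriv b u (x + t *\<^sub>R b)) (at t)" for x t
  proof -
    have "((\<lambda>t. u (x + t *\<^sub>R b)) has_derivative
        (\<lambda>h. \<Sum>c\<in>Basis. ((h *\<^sub>R b) \<bullet> c) * partial_deriv c u (x + t *\<^sub>R b))) (at t)"
      by (rule has_derivative_compose[OF _ Cc_infinity_has_derivative[OF u], of "\<lambda>t. x + t *\<^sub>R b" "\<lambda>h. h *\<^sub>R b"])
        (auto intro!: derivative_eq_intros)
    moreover have "(\<Sum>c\<in>Basis. ((h *\<^sub>R b) \<bullet> c) * partial_deriv c u (x + t *\<^sub>R b)) = h * partial_deriv b u (x + t *\<^sub>R b)" for h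
      using b by (simp add: inner_Basis if_distrib[of "\<lambda>c. c * _"] if_distrib[of "\<lambda>c. _ * c"] cong: if_cong)
    ultimately show ?thesis by (simp add: has_field_derivative_def mult.commute[of _ "partial_deriv b u (x + t *\<^sub>R b)"])
  qed
  have bound: "\<bar>f n x\<bar> \<le> B * indicator K' x" for n x
  proof (cases "x \<in> K'")
    case True
    define \<epsilon> where "\<epsilon> = 1 / real (Suc n)"
    have "\<epsilon> > 0" unfolding \<epsilon>_def by simp
    obtain z where "u (x + \<epsilon> *\<^sub>R b) - u (x + 0 *\<^sub>R b) = (\<epsilon> - 0) * partial_deriv b u (x + z *\<^sub>R b)"
      using MVT2[OF \<open>\<epsilon> > 0\<close>, of "\<lambda>t. u (x + t *\<^sub>R b)" "\<lambda>t. partial_deriv b u (x + t *\<^sub>R b)"] line by blast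
    then have "f n x = partial_deriv b u (x + z *\<^sub>R b)" unfolding f_def \<epsilon>_def by simp
    then show ?thesis using True B by simp
  next
    case False
    have "x + t *\<^sub>R b \<notin> K" if "t \<in> {0..1}" for t
    proof
      assume "x + t *\<^sub>R b \<in> K"
      then have "x \<in> K'" unfolding K'_def using that by (intro image_eqI[of _ _ "(x + t *\<^sub>R b, t)"]) auto
      then show False using False by simp
    qed
    from this[of 0] this[of "1 / real (Suc n)"] show ?thesis using False K(2) by (simp add: f_def)
  qed
  have int_u: "integrable lborel u"
  proof -
    obtain C where "\<And>x. \<bar>u x\<bar> \<le> C" using Cc_bounded Cc_infinity_subset_Cc u by blast
    then have "integrable (dx_on UNIV) u"
      by (intro integrable_compact_support[OF open_UNIV K(1)] continuous_measurable_dx_on cont K(2)) auto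
    then show ?thesis by (simp add: integrable_dx_on)
  qed
  have "(\<lambda>n. \<integral>x. f n x \<partial>lborel) \<longlonglongrightarrow> (\<integral>x. partial_deriv b u x \<partial>lborel)"
  proof (rule integral_dominated_convergence[where w = "\<lambda>x. B * indicator K' x"])
    show "integrable lborel (\<lambda>x. B * indicator K' x)"
      by (intro integrable_mult_right integrable_indicator_compact K')
    have "(\<lambda>n. f n x) \<longlonglongrightarrow> partial_deriv b u x" for x
    proof -
      have "((\<lambda>h. (u (x + (0 + h) *\<^sub>R b) - u (x + 0 *\<^sub>R b)) / h) \<longlongrightarrow> partial_deriv b u (x + 0 *\<^sub>R b)) (at 0)"
        using line[of x 0] unfolding DERIV_def by simp
      moreover have "filterlim (\<lambda>n. 1 / real (Suc n)) (at 0) sequentially"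
        unfolding filterlim_at by (intro conjI LIMSEQ_Suc lim_1_over_n) auto
      ultimately have "(\<lambda>n. (u (x + (0 + 1 / real (Suc n)) *\<^sub>R b) - u (x + 0 *\<^sub>R b)) / (1 / real (Suc n))) \<longlonglongrightarrow> partial_deriv b u (x + 0 *\<^sub>R b)"
        by (rule filterlim_compose)
      then show ?thesis unfolding f_def by (simp add: mult.commute)
    qed
    then show "AE x in lborel. (\<lambda>n. f n x) \<longlonglongrightarrow> partial_deriv b u x" by simp
    show "AE x in lborel. norm (f n x) \<le> B * indicator K' x" for n using bound by simp
  qed measurable
  moreover have "(\<integral>x. f n x \<partial>lborel) = 0" for n
  proof -
    let ?c = "(1 / real (Suc n)) *\<^sub>R b"
    have tr: "integrable lborel (\<lambda>x. u (?c + x))" "(\<integral>x. u (?c + x) \<partial>lborel) = (\<integral>x. u x \<partial>lborel)"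
      using integrable_distr_eq[of "(+) ?c" lborel borel u] integral_distr[of "(+) ?c" lborel borel u] int_u
      by (simp_all add: lborel_distr_plus)
    have "(\<integral>x. f n x \<partial>lborel) = real (Suc n) * (\<integral>x. (u (?c + x) - u x) \<partial>lborel)"
      unfolding f_def by (simp add: add.commute)
    also have "\<dots> = 0" using tr int_u by simp
    finally show ?thesis .
  qed
  ultimately show ?thesis by (simp add: LIMSEQ_const_iff)
qed

section \<open>Weak gradients and the Sobolev space with zero boundary values\<close>

abbreviation energy :: "'a::euclidean_space set \<Rightarrow> ('a \<Rightarrow> real) \<Rightarrow> real" where
  "energy \<Gamma> u \<equiv> dirichlet_integral \<Gamma> (u, u)"

abbreviation energy_conv :: "'a::euclidean_space set \<Rightarrow> (nat \<Rightarrow> 'a \<Rightarrow> real) \<Rightarrow> ('a \<Rightarrow> real) \<Rightarrow> bool" where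
  "energy_conv \<Gamma> us u \<equiv> (\<lambda>n. dirichlet_integral \<Gamma> (\<lambda>x. us n x - u x, \<lambda>x. us n x - u x)) \<longlonglongrightarrow> 0"

lemma sq_int_componentwise:
  fixes g :: "'a \<Rightarrow> 'b::euclidean_space"
  shows "g \<in> sq_int M \<longleftrightarrow> (\<forall>b\<in>Basis. (\<lambda>x. g x \<bullet> b) \<in> sq_int M)"
proof
  assume g: "g \<in> sq_int M"
  show "\<forall>b\<in>Basis. (\<lambda>x. g x \<bullet> b) \<in> sq_int M"
  proof
    fix b :: 'b assume "b \<in> Basis"
    then have "AE x in M. norm (g x \<bullet> b) \<le> norm (g x)" by (simp add: Basis_le_norm)
    then show "(\<lambda>x. g x \<bullet> b) \<in> sq_int M"
      using sq_int_measurable[OF g]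
      by (intro sq_int_bound[OF g] borel_measurable_inner borel_measurable_const) auto
  qed
next
  assume c: "\<forall>b\<in>Basis. (\<lambda>x. g x \<bullet> b) \<in> sq_int M"
  have [measurable]: "g \<in> borel_measurable M"
    using c sq_int_measurable by (subst borel_measurable_euclidean_space) blast
  have "integrable M (\<lambda>x. \<Sum>b\<in>Basis. (norm (g x \<bullet> b))\<^sup>2)"
    using c sq_int_norm_sq by (intro Bochner_Integration.integrable_sum) blast
  moreover have "(norm (g x))\<^sup>2 = (\<Sum>b\<in>Basis. (norm (g x \<bullet> b))\<^sup>2)" for x
    unfolding power2_norm_eq_inner[of "g x"] euclidean_inner[of "g x" "g x"] by (simp add: power2_eq_square)
  ultimately show "g \<in> sq_int M" by (simp add: sq_int_def)
qed

lemma sq_int_scaleR_Basis: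
  "\<phi> \<in> sq_int M \<Longrightarrow> (\<lambda>x. \<phi> x *\<^sub>R b) \<in> sq_int M" for \<phi> :: "'a \<Rightarrow> real" and b :: "'b::euclidean_space"
proof -
  assume p: "\<phi> \<in> sq_int M"
  have "(\<lambda>x. \<phi> x *\<^sub>R b) \<in> borel_measurable M" using sq_int_measurable[OF p] by measurable
  then show ?thesis using sq_int_norm_sq[OF p] by (simp add: sq_int_def power_mult_distrib)
qed

text \<open>Attaching the direction \<open>b\<close> to the test function turns both sides of the defining identity into
  inner products in L2, which are linear and continuous in \<open>u\<close> and \<open>g\<close>.\<close>

lemma L2_weak_gradient_iff:
  "L2_weak_gradient \<Gamma> u g \<longleftrightarrow> g \<in> sq_int (dx_on \<Gamma>) \<and>
    (\<forall>\<phi>\<in>Cc_infinity \<Gamma>. \<forall>b\<in>Basis.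
      sq_inner (dx_on \<Gamma>) (u, partial_deriv b \<phi>) = - sq_inner (dx_on \<Gamma>) (g, \<lambda>x. \<phi> x *\<^sub>R b))"
  unfolding L2_weak_gradient_def sq_int_componentwise[of g] L2_eq_sq_int sq_inner_def prod.case
  by (simp add: inner_commute mult.commute)

lemma L2_weak_gradient_add:
  assumes "open \<Gamma>" "u \<in> sq_int (dx_on \<Gamma>)" "v \<in> sq_int (dx_on \<Gamma>)" "L2_weak_gradient \<Gamma> u g" "L2_weak_gradient \<Gamma> v h"
  shows "L2_weak_gradient \<Gamma> (\<lambda>x. u x + v x) (\<lambda>x. g x + h x)"
proof -
  have "sq_inner (dx_on \<Gamma>) (\<lambda>x. u x + v x, partial_deriv b \<phi>) =
      sq_inner (dx_on \<Gamma>) (u, partial_deriv b \<phi>) + sq_inner (dx_on \<Gamma>) (v, partial_deriv b \<phi>)"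
    if "\<phi> \<in> Cc_infinity \<Gamma>" "b \<in> Basis" for \<phi> b
    by (rule sq_int.add_left[OF assms(2,3) Cc_infinity_sq_int[OF assms(1) Cc_infinity_partial_deriv[OF that]]])
  then show ?thesis using assms(4,5) unfolding L2_weak_gradient_iff
    by (auto simp: sq_int.add_left sq_int.add_mem assms(1) Cc_infinity_sq_int sq_int_scaleR_Basis)
qed

lemma L2_weak_gradient_scale:
  assumes "open \<Gamma>" "u \<in> sq_int (dx_on \<Gamma>)" "L2_weak_gradient \<Gamma> u g"
  shows "L2_weak_gradient \<Gamma> (\<lambda>x. c * u x) (\<lambda>x. c *\<^sub>R g x)"
proof -
  have "sq_inner (dx_on \<Gamma>) (\<lambda>x. c * u x, partial_deriv b \<phi>) = c * sq_inner (dx_on \<Gamma>) (u, partial_deriv b \<phi>)"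
    if "\<phi> \<in> Cc_infinity \<Gamma>" "b \<in> Basis" for \<phi> b
    using sq_int.scale_left[OF assms(2) Cc_infinity_sq_int[OF assms(1) Cc_infinity_partial_deriv[OF that]], of c] by simp
  then show ?thesis using assms(3) unfolding L2_weak_gradient_iff
    by (auto simp: sq_int.scale_left sq_int.scale_mem assms(1) Cc_infinity_sq_int sq_int_scaleR_Basis)
qed

lemma L2_weak_gradient_diff:
  assumes "open \<Gamma>" "u \<in> sq_int (dx_on \<Gamma>)" "v \<in> sq_int (dx_on \<Gamma>)" "L2_weak_gradient \<Gamma> u g" "L2_weak_gradient \<Gamma> v h"
  shows "L2_weak_gradient \<Gamma> (\<lambda>x. u x - v x) (\<lambda>x. g x - h x)"
  using L2_weak_gradient_add[OF assms(1,2) sq_int.minus_mem[OF assms(3)] assms(4)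
      L2_weak_gradient_scale[OF assms(1,3,5), of "-1", simplified]] by simp

lemma L2_weak_gradient_limit:
  assumes \<Gamma>: "open \<Gamma>" and us: "\<And>n. us n \<in> sq_int (dx_on \<Gamma>)" "u \<in> sq_int (dx_on \<Gamma>)"
    "mean_conv (dx_on \<Gamma>) us u"
    and gs: "\<And>n. L2_weak_gradient \<Gamma> (us n) (gs n)" "g \<in> sq_int (dx_on \<Gamma>)"
    "mean_conv (dx_on \<Gamma>) gs g"
  shows "L2_weak_gradient \<Gamma> u g"
  unfolding L2_weak_gradient_iff
proof (intro conjI ballI gs(2))
  fix \<phi> :: "'a \<Rightarrow> real" and b :: 'a
  assume \<phi>: "\<phi> \<in> Cc_infinity \<Gamma>" and b: "b \<in> Basis"
  have gs': "gs n \<in> sq_int (dx_on \<Gamma>)" for n using gs(1) L2_weak_gradient_iff by blast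
  have "(\<lambda>n. sq_inner (dx_on \<Gamma>) (us n, partial_deriv b \<phi>)) \<longlonglongrightarrow> sq_inner (dx_on \<Gamma>) (u, partial_deriv b \<phi>)"
    by (intro sq_int.tendsto_form_right us Cc_infinity_sq_int[OF \<Gamma> Cc_infinity_partial_deriv[OF \<phi> b]])
  moreover have "(\<lambda>n. - sq_inner (dx_on \<Gamma>) (gs n, \<lambda>x. \<phi> x *\<^sub>R b)) \<longlonglongrightarrow> - sq_inner (dx_on \<Gamma>) (g, \<lambda>x. \<phi> x *\<^sub>R b)"
    by (intro tendsto_minus sq_int.tendsto_form_right gs gs' sq_int_scaleR_Basis Cc_infinity_sq_int[OF \<Gamma> \<phi>])
  moreover have "sq_inner (dx_on \<Gamma>) (us n, partial_deriv b \<phi>) = - sq_inner (dx_on \<Gamma>) (gs n, \<lambda>x. \<phi> x *\<^sub>R b)" for n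
    using gs(1) \<phi> b unfolding L2_weak_gradient_iff by blast
  ultimately show "sq_inner (dx_on \<Gamma>) (u, partial_deriv b \<phi>) = - sq_inner (dx_on \<Gamma>) (g, \<lambda>x. \<phi> x *\<^sub>R b)"
    using LIMSEQ_unique by simp
qed

lemma L2_weak_gradient_unique:
  assumes \<Gamma>: "open \<Gamma>" and u: "u \<in> sq_int (dx_on \<Gamma>)" "u' \<in> sq_int (dx_on \<Gamma>)" "AE x in dx_on \<Gamma>. u x = u' x"
    and g: "L2_weak_gradient \<Gamma> u g" "L2_weak_gradient \<Gamma> u' g'"
  shows "AE x in dx_on \<Gamma>. g x = g' x"
proof -
  have gi: "g \<in> sq_int (dx_on \<Gamma>)" "g' \<in> sq_int (dx_on \<Gamma>)" using g L2_weak_gradient_iff by blast+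
  define h where "h x = g x - g' x" for x
  have h: "h \<in> sq_int (dx_on \<Gamma>)" unfolding h_def by (intro sq_int.diff_mem gi)
  have "AE x in dx_on \<Gamma>. h x \<bullet> b = 0" if b: "b \<in> Basis" for b
  proof (rule AE_zero_if_orthogonal[OF \<Gamma>])
    show "(\<lambda>x. h x \<bullet> b) \<in> sq_int (dx_on \<Gamma>)" using h b sq_int_componentwise by blast
    fix \<phi> assume \<phi>: "\<phi> \<in> Cc_infinity \<Gamma>"
    have "sq_inner (dx_on \<Gamma>) (u, partial_deriv b \<phi>) = sq_inner (dx_on \<Gamma>) (u', partial_deriv b \<phi>)"
      using sq_int_measurable[OF Cc_infinity_sq_int[OF \<Gamma> Cc_infinity_partial_deriv[OF \<phi> b]]] u
      by (intro sq_inner_AE_cong) (auto dest: sq_int_measurable)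
    then have "sq_inner (dx_on \<Gamma>) (g, \<lambda>x. \<phi> x *\<^sub>R b) = sq_inner (dx_on \<Gamma>) (g', \<lambda>x. \<phi> x *\<^sub>R b)"
      using g \<phi> b unfolding L2_weak_gradient_iff by (metis neg_equal_iff_equal)
    then have "sq_inner (dx_on \<Gamma>) (h, \<lambda>x. \<phi> x *\<^sub>R b) = 0"
      unfolding h_def by (simp add: sq_int.diff_left gi sq_int_scaleR_Basis Cc_infinity_sq_int[OF \<Gamma> \<phi>])
    then show "(\<integral>x. (h x \<bullet> b) * \<phi> x \<partial>dx_on \<Gamma>) = 0"
      by (simp add: sq_inner_def mult.commute)
  qed
  then have "AE x in dx_on \<Gamma>. \<forall>b\<in>Basis. h x \<bullet> b = 0" by (simp add: AE_ball_countable countable_finite)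
  then show ?thesis
    by eventually_elim (auto simp: h_def intro!: euclidean_eqI[where 'a = 'a] simp: inner_diff_left)
qed

definition grad :: "('a::euclidean_space \<Rightarrow> real) \<Rightarrow> 'a \<Rightarrow> 'a" where
  "grad u x = (\<Sum>b\<in>Basis. partial_deriv b u x *\<^sub>R b)"

lemma grad_inner_Basis: "b \<in> Basis \<Longrightarrow> grad u x \<bullet> b = partial_deriv b u x"
  by (simp add: grad_def inner_sum_left inner_Basis if_distrib[of "\<lambda>c. _ * c"] cong: if_cong)

lemma Cc_infinity_has_derivative_grad:
  "u \<in> Cc_infinity \<Gamma> \<Longrightarrow> (u has_derivative (\<lambda>h. grad u x \<bullet> h)) (at x)"
proof -
  have "(\<Sum>b\<in>Basis. (h \<bullet> b) * partial_deriv b u x) = grad u x \<bullet> h" for h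
    unfolding grad_def inner_sum_left by (intro sum.cong) (auto simp: inner_commute)
  then show "u \<in> Cc_infinity \<Gamma> \<Longrightarrow> ?thesis" using Cc_infinity_has_derivative[of u \<Gamma> x] by simp
qed

lemma grad_eqI:
  assumes "(u has_derivative (\<lambda>h. a \<bullet> h)) (at x)"
  shows "grad u x = a"
  by (rule euclidean_eqI) (simp add: grad_inner_Basis partial_deriv_eq[OF assms])

lemma grad_sq_int: "open \<Gamma> \<Longrightarrow> \<phi> \<in> Cc_infinity \<Delta> \<Longrightarrow> grad \<phi> \<in> sq_int (dx_on \<Gamma>)"
  unfolding sq_int_componentwise[of "grad \<phi>"]
  using Cc_infinity_sq_int Cc_infinity_partial_deriv by (fastforce simp: grad_inner_Basis)

lemma L2_weak_gradient_grad:
  assumes \<Gamma>: "open \<Gamma>" and u: "u \<in> Cc_infinity \<Gamma>"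
  shows "L2_weak_gradient \<Gamma> u (grad u)"
  unfolding L2_weak_gradient_iff
proof (intro conjI ballI grad_sq_int[OF \<Gamma> u])
  fix \<phi> :: "'a \<Rightarrow> real" and b :: 'a
  assume \<phi>: "\<phi> \<in> Cc_infinity \<Gamma>" and b: "b \<in> Basis"
  have smooth: "u \<in> Ck_on k UNIV" for k using u by (simp add: Cc_infinity_iff)
  have prod: "(\<lambda>x. u x * \<phi> x) \<in> Cc_infinity \<Gamma>" by (rule Cc_infinity_mult[OF \<phi> smooth])
  have "((\<lambda>x. u x * \<phi> x) has_derivative (\<lambda>h. u x * (grad \<phi> x \<bullet> h) + (grad u x \<bullet> h) * \<phi> x)) (at x)" for x
    by (intro has_derivative_mult Cc_infinity_has_derivative_grad[OF u] Cc_infinity_has_derivative_grad[OF \<phi>])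
  from partial_deriv_eq[OF this] have deriv:
    "partial_deriv b (\<lambda>x. u x * \<phi> x) x = u x * partial_deriv b \<phi> x + \<phi> x * partial_deriv b u x" for x
    using b by (simp add: grad_inner_Basis mult.commute)
  obtain K where K: "K \<subseteq> \<Gamma>" "\<And>x. x \<notin> K \<Longrightarrow> partial_deriv b (\<lambda>x. u x * \<phi> x) x = 0"
    using Cc_infinityE[OF Cc_infinity_partial_deriv[OF prod b]] by metis
  have "(\<integral>x. partial_deriv b (\<lambda>x. u x * \<phi> x) x \<partial>dx_on \<Gamma>) = (\<integral>x. partial_deriv b (\<lambda>x. u x * \<phi> x) x \<partial>lborel)"
    unfolding integral_dx_on[OF \<Gamma>]
    by (intro Bochner_Integration.integral_cong) (use K in \<open>auto simp: indicator_def\<close>)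
  also have "\<dots> = 0"
    using prod by (intro integral_partial_deriv_eq_0[OF _ b]) (auto simp: Cc_infinity_iff Cc_def)
  finally have zero: "(\<integral>x. u x * partial_deriv b \<phi> x + \<phi> x * partial_deriv b u x \<partial>dx_on \<Gamma>) = 0"
    unfolding deriv .
  note L = Cc_infinity_sq_int[OF \<Gamma>]
  have "integrable (dx_on \<Gamma>) (\<lambda>x. u x * partial_deriv b \<phi> x)" "integrable (dx_on \<Gamma>) (\<lambda>x. \<phi> x * partial_deriv b u x)"
    using integrable_inner_sq_int[OF L[OF u] L[OF Cc_infinity_partial_deriv[OF \<phi> b]]]
      integrable_inner_sq_int[OF L[OF \<phi>] L[OF Cc_infinity_partial_deriv[OF u b]]] by simp_all
  with zero show "sq_inner (dx_on \<Gamma>) (u, partial_deriv b \<phi>) = - sq_inner (dx_on \<Gamma>) (grad u, \<lambda>x. \<phi> x *\<^sub>R b)"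
    using b by (simp add: sq_inner_def grad_inner_Basis)
qed

lemma H1_iff: "u \<in> H1 \<Gamma> \<longleftrightarrow> u \<in> sq_int (dx_on \<Gamma>) \<and> (\<exists>g. L2_weak_gradient \<Gamma> u g)"
  by (simp add: H1_def L2_eq_sq_int)

lemma H1_weak_gradient: "u \<in> H1 \<Gamma> \<Longrightarrow> L2_weak_gradient \<Gamma> u (weak_gradient \<Gamma> u)"
  unfolding weak_gradient_def H1_iff using someI_ex[of "L2_weak_gradient \<Gamma> u"] by blast

lemma weak_gradient_sq_int: "u \<in> H1 \<Gamma> \<Longrightarrow> weak_gradient \<Gamma> u \<in> sq_int (dx_on \<Gamma>)"
  using H1_weak_gradient L2_weak_gradient_iff by blast

lemma dirichlet_integral_eq:
  assumes \<Gamma>: "open \<Gamma>" and u: "u \<in> sq_int (dx_on \<Gamma>)" "L2_weak_gradient \<Gamma> u g"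
    and v: "v \<in> sq_int (dx_on \<Gamma>)" "L2_weak_gradient \<Gamma> v h"
  shows "dirichlet_integral \<Gamma> (u, v) = sq_inner (dx_on \<Gamma>) (g, h)"
proof -
  have uv: "u \<in> H1 \<Gamma>" "v \<in> H1 \<Gamma>" using u v H1_iff by blast+
  have "sq_inner (dx_on \<Gamma>) (weak_gradient \<Gamma> u, weak_gradient \<Gamma> v) = sq_inner (dx_on \<Gamma>) (g, h)"
  proof (rule sq_inner_AE_cong)
    show "AE x in dx_on \<Gamma>. weak_gradient \<Gamma> u x = g x"
      by (rule L2_weak_gradient_unique[OF \<Gamma> u(1) u(1) _ H1_weak_gradient[OF uv(1)] u(2)]) simp
    show "AE x in dx_on \<Gamma>. weak_gradient \<Gamma> v x = h x"
      by (rule L2_weak_gradient_unique[OF \<Gamma> v(1) v(1) _ H1_weak_gradient[OF uv(2)] v(2)]) simp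
  qed (use weak_gradient_sq_int uv u v L2_weak_gradient_iff sq_int_measurable in blast)+
  then show ?thesis by (simp add: dirichlet_integral_def sq_inner_def)
qed

lemma dirichlet_integral_grad:
  assumes "open \<Gamma>" "\<phi> \<in> Cc_infinity \<Gamma>" "\<psi> \<in> Cc_infinity \<Gamma>"
  shows "dirichlet_integral \<Gamma> (\<phi>, \<psi>) = sq_inner (dx_on \<Gamma>) (grad \<phi>, grad \<psi>)"
  using assms by (intro dirichlet_integral_eq L2_weak_gradient_grad Cc_infinity_sq_int)

text \<open>Completeness: the functions and their gradients converge in L2 separately, and the identity that
  defines weak gradients passes to the limit.\<close>

lemma closed_form_H1:
  assumes \<Gamma>: "open (\<Gamma> :: 'a::euclidean_space set)"
  shows "closed_form (dx_on \<Gamma>) (H1 \<Gamma>) (dirichlet_integral \<Gamma>)"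
proof -
  let ?M = "dx_on \<Gamma>" and ?D = "dirichlet_integral \<Gamma>" and ?W = "weak_gradient \<Gamma>"
  have W: "u \<in> sq_int ?M" "L2_weak_gradient \<Gamma> u (?W u)" "?W u \<in> sq_int ?M" if "u \<in> H1 \<Gamma>" for u
    using that H1_weak_gradient weak_gradient_sq_int H1_iff by blast+
  note eq = dirichlet_integral_eq[OF \<Gamma>]
  have D: "?D (u, v) = sq_inner ?M (?W u, ?W v)" if "u \<in> H1 \<Gamma>" "v \<in> H1 \<Gamma>" for u v
    by (intro eq W that)
  have psd: "psd_form (H1 \<Gamma>) ?D"
  proof
    show "(\<lambda>x. 0) \<in> H1 \<Gamma>"
      using L2_weak_gradient_grad[OF \<Gamma> Cc_infinity_zero] sq_int.zero_mem H1_iff by blast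
    fix u v :: "'a \<Rightarrow> real" and c :: real assume uv: "u \<in> H1 \<Gamma>" "v \<in> H1 \<Gamma>"
    have "(\<lambda>x. u x + v x) \<in> sq_int ?M" by (intro sq_int.add_mem W uv)
    then show "(\<lambda>x. u x + v x) \<in> H1 \<Gamma>"
      using L2_weak_gradient_add[OF \<Gamma> W(1)[OF uv(1)] W(1)[OF uv(2)] W(2)[OF uv(1)] W(2)[OF uv(2)]] H1_iff by blast
    have "(\<lambda>x. c * u x) \<in> sq_int ?M" using sq_int.scale_mem[OF W(1)[OF uv(1)], of c] by simp
    then show "(\<lambda>x. c *\<^sub>R u x) \<in> H1 \<Gamma>"
      using L2_weak_gradient_scale[OF \<Gamma> W(1)[OF uv(1)] W(2)[OF uv(1)]] H1_iff unfolding real_scaleR_def by blast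
    show "?D (u, v) = ?D (v, u)" unfolding D[OF uv] D[OF uv(2,1)] by (intro sq_int.sym W uv)
    show "0 \<le> ?D (u, u)" unfolding D[OF uv(1,1)] by (intro sq_int.nonneg W uv)
    show "?D (\<lambda>x. c *\<^sub>R u x, v) = c * ?D (u, v)"
      unfolding real_scaleR_def
      using eq[OF sq_int.scale_mem[OF W(1)[OF uv(1)], of c, simplified]
          L2_weak_gradient_scale[OF \<Gamma> W(1)[OF uv(1)] W(2)[OF uv(1)]] W(1)[OF uv(2)] W(2)[OF uv(2)]]
      by (simp add: D uv sq_int.scale_left W)
  next
    fix u v w :: "'a \<Rightarrow> real" assume uvw: "u \<in> H1 \<Gamma>" "v \<in> H1 \<Gamma>" "w \<in> H1 \<Gamma>"
    show "?D (\<lambda>x. u x + v x, w) = ?D (u, w) + ?D (v, w)"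
      using eq[OF sq_int.add_mem[OF W(1)[OF uvw(1)] W(1)[OF uvw(2)]]
          L2_weak_gradient_add[OF \<Gamma> W(1)[OF uvw(1)] W(1)[OF uvw(2)] W(2)[OF uvw(1)] W(2)[OF uvw(2)]]
          W(1)[OF uvw(3)] W(2)[OF uvw(3)]]
      by (simp add: D uvw sq_int.add_left W)
  qed
  interpret H: L2_form ?M "H1 \<Gamma>" ?D
    by (intro L2_form.intro psd L2_form_axioms.intro) (use H1_iff in blast)
  show ?thesis
  proof (intro closed_form.intro H.L2_form_axioms closed_form_axioms.intro)
    show "v \<in> H1 \<Gamma>" if u: "u \<in> H1 \<Gamma>" and v: "v \<in> borel_measurable ?M" "AE x in ?M. u x = v x" for u v
    proof -
      have vi: "v \<in> sq_int ?M"
        using v by (intro sq_int_bound[OF W(1)[OF u] v(1)]) (auto elim: eventually_mono)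
      have "sq_inner ?M (v, partial_deriv b \<phi>) = sq_inner ?M (u, partial_deriv b \<phi>)"
        if "\<phi> \<in> Cc_infinity \<Gamma>" "b \<in> Basis" for \<phi> b
        using sq_int_measurable[OF Cc_infinity_sq_int[OF \<Gamma> Cc_infinity_partial_deriv[OF that]]]
          sq_int_measurable[OF W(1)[OF u]] v
        by (intro sq_inner_AE_cong) (auto elim: eventually_mono)
      then have "L2_weak_gradient \<Gamma> v (?W u)" using W(2)[OF u] unfolding L2_weak_gradient_iff by simp
      with vi show ?thesis using H1_iff by blast
    qed
    show "?D (u, v) = ?D (u', v)" if u: "u \<in> H1 \<Gamma>" "u' \<in> H1 \<Gamma>" "v \<in> H1 \<Gamma>" "AE x in ?M. u x = u' x" for u u' v
      unfolding D[OF u(1,3)] D[OF u(2,3)]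
    proof (rule sq_inner_AE_cong)
      show "AE x in ?M. ?W u x = ?W u' x" by (rule L2_weak_gradient_unique[OF \<Gamma> _ _ u(4)]) (intro W u)+
    qed (use W(3) u sq_int_measurable in auto)
    fix us :: "nat \<Rightarrow> 'a \<Rightarrow> real"
    assume us: "\<And>n. us n \<in> H1 \<Gamma>" and "H.E1.Cauchy_seq us"
    then have C: "H.Cauchy_seq us" "sq_int.Cauchy_seq ?M us" using H.E1_Cauchy_seq_iff[of us] by blast+
    obtain u where u: "u \<in> sq_int ?M" "mean_conv ?M us u"
      using sq_int_complete[OF W(1)[OF us] C(2)] by blast
    have diff: "L2_weak_gradient \<Gamma> (\<lambda>x. us m x - us n x) (\<lambda>x. ?W (us m) x - ?W (us n) x)" for m n
      by (intro L2_weak_gradient_diff[OF \<Gamma>] W us)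
    have "?D (\<lambda>x. us m x - us n x, \<lambda>x. us m x - us n x) =
        mean_sq ?M (\<lambda>x. ?W (us m) x - ?W (us n) x)" for m n
      by (intro eq diff sq_int.diff_mem W us)
    then have "sq_int.Cauchy_seq ?M (\<lambda>n. ?W (us n))"
      using C(1) unfolding H.Cauchy_seq_def sq_int.Cauchy_seq_def by simp
    then obtain g where g: "g \<in> sq_int ?M"
        "(\<lambda>n. mean_sq ?M (\<lambda>x. ?W (us n) x - g x)) \<longlonglongrightarrow> 0"
      using sq_int_complete[of "\<lambda>n. ?W (us n)", OF W(3)[OF us]] by blast
    have ug: "L2_weak_gradient \<Gamma> u g"
      by (rule L2_weak_gradient_limit[OF \<Gamma> W(1)[OF us] u W(2)[OF us] g])
    have "?D (\<lambda>x. us n x - u x, \<lambda>x. us n x - u x) = mean_sq ?M (\<lambda>x. ?W (us n) x - g x)" for n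
      by (intro eq L2_weak_gradient_diff[OF \<Gamma>] sq_int.diff_mem W us u ug)
    then have "H.conv us u" using g by simp
    moreover have uH: "u \<in> H1 \<Gamma>" using u ug H1_iff by blast
    ultimately have "H.E1.conv us u" using u(2) H.E1_conv_iff[of us u] us by blast
    with uH show "\<exists>u\<in>H1 \<Gamma>. H.E1.conv us u" by blast
  qed
qed

lemma L2_form_H1: "open \<Gamma> \<Longrightarrow> L2_form (dx_on \<Gamma>) (H1 \<Gamma>) (dirichlet_integral \<Gamma>)"
  using closed_form.axioms(1)[OF closed_form_H1] .

lemma Cc_infinity_subset_H1: "open \<Gamma> \<Longrightarrow> Cc_infinity \<Gamma> \<subseteq> H1 \<Gamma>"
  using L2_weak_gradient_grad Cc_infinity_sq_int H1_iff by blast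

lemma H10_eq: "open \<Gamma> \<Longrightarrow> H10 \<Gamma> = L2_form.form_closure (dx_on \<Gamma>) (H1 \<Gamma>) (dirichlet_integral \<Gamma>) (Cc_infinity \<Gamma>)"
  by (simp add: H10_def L2_form.form_closure_def[OF L2_form_H1])

lemma closed_form_H10: "open \<Gamma> \<Longrightarrow> closed_form (dx_on \<Gamma>) (H10 \<Gamma>) (dirichlet_integral \<Gamma>)"
  unfolding H10_eq
  by (intro closed_form.closed_form_form_closure[OF closed_form_H1] Cc_infinity_subset_H1
      Cc_infinity_zero Cc_infinity_add Cc_infinity_scale)

lemma Cc_infinity_subset_H10: "open \<Gamma> \<Longrightarrow> Cc_infinity \<Gamma> \<subseteq> H10 \<Gamma>"
  unfolding H10_eq using L2_form.form_closure_base[OF L2_form_H1 Cc_infinity_subset_H1] by blast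

lemma H10_approx:
  assumes "open \<Gamma>" "u \<in> H10 \<Gamma>"
  obtains \<phi> where "\<And>n::nat. \<phi> n \<in> Cc_infinity \<Gamma>"
    "energy_conv \<Gamma> \<phi> u"
    "mean_conv (dx_on \<Gamma>) \<phi> u"
  using L2_form.form_closureE[OF L2_form_H1[OF assms(1)] Cc_infinity_subset_H1[OF assms(1)]]
    assms(2) unfolding H10_eq[OF assms(1)] by blast

text \<open>By the product rule, the energy of \<open>\<eta> \<psi>\<close> is bounded by a multiple of the squared form norm of \<open>\<psi>\<close>,
  for smooth \<open>\<psi>\<close>.  So the products are Cauchy in energy, and closedness identifies their limit.\<close>

lemma dirichlet_integral_mult_tendsto:
  assumes \<Gamma>: "open \<Gamma>" and u: "u \<in> H10 \<Gamma>" and \<eta>: "\<eta> \<in> Cc_infinity \<Gamma>" and \<phi>: "\<And>n::nat. \<phi> n \<in> Cc_infinity \<Gamma>"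
    and lim: "energy_conv \<Gamma> \<phi> u"
    "mean_conv (dx_on \<Gamma>) \<phi> u"
  shows "(\<lambda>x. \<eta> x * u x) \<in> H10 \<Gamma>"
    "(\<lambda>n. energy \<Gamma> (\<lambda>x. \<eta> x * \<phi> n x - \<eta> x * u x)) \<longlonglongrightarrow> 0"
    "(\<lambda>n. mean_sq (dx_on \<Gamma>) (\<lambda>x. \<eta> x * \<phi> n x - \<eta> x * u x)) \<longlonglongrightarrow> 0"
proof -
  let ?M = "dx_on \<Gamma>"
  interpret H: closed_form ?M "H10 \<Gamma>" "dirichlet_integral \<Gamma>" by (rule closed_form_H10[OF \<Gamma>])
  have \<eta>_smooth: "\<eta> \<in> Ck_on k UNIV" for k using \<eta> by (simp add: Cc_infinity_iff)
  have prod: "(\<lambda>x. \<eta> x * \<psi> x) \<in> Cc_infinity \<Gamma>" if "\<psi> \<in> Cc_infinity \<Gamma>" for \<psi>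
    by (rule Cc_infinity_mult[OF that \<eta>_smooth])
  obtain B where B: "\<And>x. \<bar>\<eta> x\<bar> \<le> B" using Cc_bounded Cc_infinity_subset_Cc \<eta> by blast
  have "\<forall>b\<in>Basis. \<exists>C. \<forall>x. \<bar>partial_deriv b \<eta> x\<bar> \<le> C"
  proof
    fix b :: 'a assume "b \<in> Basis"
    then have "partial_deriv b \<eta> \<in> Cc \<Gamma>"
      using Cc_infinity_partial_deriv[OF \<eta>] Cc_infinity_subset_Cc by blast
    from Cc_bounded[OF this] show "\<exists>C. \<forall>x. \<bar>partial_deriv b \<eta> x\<bar> \<le> C" by metis
  qed
  from bchoice[OF this] obtain C where C: "\<And>b x. b \<in> Basis \<Longrightarrow> \<bar>partial_deriv b \<eta> x\<bar> \<le> C b" by blast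
  have gB: "norm (grad \<eta> x) \<le> sum C Basis" for x
    unfolding grad_def using C by (intro order_trans[OF norm_sum] sum_mono) simp
  have \<eta>m [measurable]: "\<eta> \<in> borel_measurable ?M" and gm [measurable]: "grad \<eta> \<in> borel_measurable ?M"
    using Cc_infinity_sq_int[OF \<Gamma> \<eta>] grad_sq_int[OF \<Gamma> \<eta>] sq_int_measurable by blast+
  have u1: "u \<in> sq_int ?M" using H.mem_sq_int[OF u] .
  have \<eta>_le: "norm (\<eta> x *\<^sub>R v) \<le> B * norm v" for x and v :: "'b::euclidean_space"
    using mult_right_mono[OF B[of x], of "norm v"] by simp
  have \<eta>_mult: "(\<lambda>x. \<eta> x * v x) \<in> sq_int ?M" "mean_sq ?M (\<lambda>x. \<eta> x * v x) \<le> B\<^sup>2 * mean_sq ?M v"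
    if v: "v \<in> sq_int ?M" for v
    using sq_int_dominated[OF v, of "\<lambda>x. \<eta> x * v x" B] \<eta>_le[of _ "v _"] sq_int_measurable[OF v] by simp_all
  have lim2: "(\<lambda>n. mean_sq ?M (\<lambda>x. \<eta> x * \<phi> n x - \<eta> x * u x)) \<longlonglongrightarrow> 0"
  proof (rule tendsto_0_le_scale[OF _ _ lim(2)])
    show "0 \<le> mean_sq ?M (\<lambda>x. \<eta> x * \<phi> n x - \<eta> x * u x)" for n by (simp add: sq_inner_self)
    show "mean_sq ?M (\<lambda>x. \<eta> x * \<phi> n x - \<eta> x * u x) \<le> B\<^sup>2 * mean_sq ?M (\<lambda>x. \<phi> n x - u x)" for n
      using \<eta>_mult(2)[OF sq_int.diff_mem[OF Cc_infinity_sq_int[OF \<Gamma> \<phi>] u1], of n] by (simp add: right_diff_distrib)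
  qed
  define R where "R = 2 * B\<^sup>2 + 2 * (sum C Basis)\<^sup>2 + 1"
  have key: "energy \<Gamma> (\<lambda>x. \<eta> x * \<psi> x) \<le> R * H.E1 (\<psi>, \<psi>)" if \<psi>: "\<psi> \<in> Cc_infinity \<Gamma>" for \<psi>
  proof -
    have gr: "grad (\<lambda>x. \<eta> x * \<psi> x) = (\<lambda>x. \<eta> x *\<^sub>R grad \<psi> x + \<psi> x *\<^sub>R grad \<eta> x)"
    proof (rule ext, rule grad_eqI)
      fix x
      have "((\<lambda>x. \<eta> x * \<psi> x) has_derivative (\<lambda>h. \<eta> x * (grad \<psi> x \<bullet> h) + (grad \<eta> x \<bullet> h) * \<psi> x)) (at x)"
        by (intro has_derivative_mult Cc_infinity_has_derivative_grad[OF \<eta>] Cc_infinity_has_derivative_grad[OF \<psi>])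
      then show "((\<lambda>x. \<eta> x * \<psi> x) has_derivative (\<lambda>h. (\<eta> x *\<^sub>R grad \<psi> x + \<psi> x *\<^sub>R grad \<eta> x) \<bullet> h)) (at x)"
        by (simp add: inner_add_left mult.commute)
    qed
    have \<psi>i: "\<psi> \<in> sq_int ?M" "grad \<psi> \<in> sq_int ?M" by (rule Cc_infinity_sq_int[OF \<Gamma> \<psi>], rule grad_sq_int[OF \<Gamma> \<psi>])
    have [measurable]: "\<psi> \<in> borel_measurable ?M" "grad \<psi> \<in> borel_measurable ?M"
      using \<psi>i sq_int_measurable by blast+
    define a b where "a x = \<eta> x *\<^sub>R grad \<psi> x" and "b x = \<psi> x *\<^sub>R grad \<eta> x" for x
    have [measurable]: "a \<in> borel_measurable ?M" "b \<in> borel_measurable ?M"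
      unfolding a_def b_def by measurable
    have "norm (b x) \<le> sum C Basis * norm (\<psi> x)" for x
      using mult_left_mono[OF gB[of x], of "\<bar>\<psi> x\<bar>"] by (simp add: b_def mult.commute)
    note b = sq_int_dominated[OF \<psi>i(1) \<open>b \<in> borel_measurable ?M\<close> this]
    have "norm (a x) \<le> B * norm (grad \<psi> x)" for x unfolding a_def by (rule \<eta>_le)
    note a = sq_int_dominated[OF \<psi>i(2) \<open>a \<in> borel_measurable ?M\<close> this]
    define d q where "d = energy \<Gamma> \<psi>" and "q = mean_sq ?M \<psi>"
    have nn: "d \<ge> 0" "q \<ge> 0"
      unfolding d_def q_def using H.nonneg Cc_infinity_subset_H10[OF \<Gamma>] \<psi> by (auto simp: sq_inner_self)
    have "energy \<Gamma> (\<lambda>x. \<eta> x * \<psi> x) = mean_sq ?M (\<lambda>x. a x + b x)"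
      unfolding dirichlet_integral_grad[OF \<Gamma> prod[OF \<psi>] prod[OF \<psi>]] gr a_def b_def ..
    also have "\<dots> \<le> 2 * mean_sq ?M a + 2 * mean_sq ?M b" by (rule sq_int.sq_add_le[OF a(1) b(1)])
    also have "\<dots> \<le> (2 * B\<^sup>2) * d + (2 * (sum C Basis)\<^sup>2) * q"
      using a(2) b(2) unfolding d_def q_def dirichlet_integral_grad[OF \<Gamma> \<psi> \<psi>] by linarith
    also have "\<dots> \<le> R * d + R * q"
      unfolding R_def by (intro add_mono mult_right_mono nn) auto
    finally show ?thesis unfolding H.E1_apply d_def q_def by (simp add: distrib_left)
  qed
  have \<phi>H: "\<phi> n \<in> H10 \<Gamma>" for n using \<phi> Cc_infinity_subset_H10[OF \<Gamma>] by blast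
  have \<eta>\<phi>H: "(\<lambda>x. \<eta> x * \<phi> n x) \<in> H10 \<Gamma>" for n using prod[OF \<phi>] Cc_infinity_subset_H10[OF \<Gamma>] by blast
  have "H.E1.conv \<phi> u" using H.E1_conv_iff[of \<phi> u] \<phi>H u lim by blast
  then have C1: "H.E1.Cauchy_seq \<phi>" by (rule H.E1.convergent_Cauchy_seq[OF \<phi>H u])
  have "H.Cauchy_seq (\<lambda>n x. \<eta> x * \<phi> n x)"
    unfolding H.Cauchy_seq_def
  proof (rule H.E1.Cauchy_seq_dominated[OF C1])
    show "R > 0" unfolding R_def by (simp add: add_nonneg_pos)
    fix m n
    have "(\<lambda>x. \<phi> m x - \<phi> n x) \<in> Cc_infinity \<Gamma>"
      using Cc_infinity_add[OF \<phi>[of m] Cc_infinity_scale[OF \<phi>[of n], of "-1"]] by simp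
    from key[OF this] show "energy \<Gamma> (\<lambda>x. \<eta> x * \<phi> m x - \<eta> x * \<phi> n x) \<le> R * H.E1.sq (\<lambda>x. \<phi> m x - \<phi> n x)"
      by (simp add: right_diff_distrib)
  qed
  from H.Cauchy_limit[of "\<lambda>n x. \<eta> x * \<phi> n x", OF \<eta>\<phi>H this \<eta>_mult(1)[OF u1] lim2]
  show "(\<lambda>x. \<eta> x * u x) \<in> H10 \<Gamma>"
    "(\<lambda>n. energy \<Gamma> (\<lambda>x. \<eta> x * \<phi> n x - \<eta> x * u x)) \<longlonglongrightarrow> 0"
    by blast+
  show "(\<lambda>n. mean_sq ?M (\<lambda>x. \<eta> x * \<phi> n x - \<eta> x * u x)) \<longlonglongrightarrow> 0"
    by (rule lim2)
qed

section \<open>Conformal change of variables\<close>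

text \<open>The change of variables theorem is stated for the spaces \<open>real ^ 'n\<close>.  It is moved to the complex
  plane along the obvious isometry, which preserves Lebesgue measure.\<close>

definition cplx :: "real ^ 2 \<Rightarrow> complex" where
  "cplx x = Complex (x $ 1) (x $ 2)"

definition vec2 :: "complex \<Rightarrow> real ^ 2" where
  "vec2 z = vector [Re z, Im z]"

lemma cplx_vec2 [simp]: "cplx (vec2 z) = z" "vec2 (cplx x) = x"
  by (simp_all add: cplx_def vec2_def complex_eq_iff vec_eq_iff forall_2)

lemma cplx_linear: "bounded_linear cplx"
proof -
  have "linear cplx" by (rule linearI) (simp_all add: cplx_def complex_eq_iff)
  then show ?thesis by (simp add: linear_conv_bounded_linear)
qed

lemma vec2_linear: "bounded_linear vec2"
proof -
  have "linear vec2" by (rule linearI) (simp_all add: vec2_def vec_eq_iff forall_2)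
  then show ?thesis by (simp add: linear_conv_bounded_linear)
qed

lemma cplx_measurable [measurable]: "cplx \<in> borel_measurable borel"
  by (intro borel_measurable_continuous_onI linear_continuous_on cplx_linear)

lemma Basis_vec2: "(Basis :: (real ^ 2) set) = {axis 1 1, axis 2 1}"
  by (auto simp: Basis_vec_def UNIV_2)

lemma distr_cplx: "distr lborel borel cplx = lborel"
proof (rule lborel_eqI[symmetric])
  fix l u :: complex assume le: "\<And>b. b \<in> Basis \<Longrightarrow> l \<bullet> b \<le> u \<bullet> b"
  have le': "Re l \<le> Re u" "Im l \<le> Im u" using le[of 1] le[of \<i>] by (auto simp: Basis_complex_def)
  have ax: "axis 1 1 \<noteq> (axis 2 1 :: real ^ 2)" by (simp add: axis_eq_axis)
  have "cplx -` box l u = box (vec2 l) (vec2 u)"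
    by (auto simp: box_def Basis_vec2 Basis_complex_def inner_axis cplx_def vec2_def)
  then have "emeasure (distr lborel borel cplx) (box l u) = emeasure lborel (box (vec2 l) (vec2 u))"
    by (simp add: emeasure_distr)
  also have "\<dots> = (\<Prod>b\<in>Basis. (vec2 u - vec2 l) \<bullet> b)"
    by (rule emeasure_lborel_box) (use le' in \<open>auto simp: Basis_vec2 inner_axis vec2_def\<close>)
  also have "(\<Prod>b\<in>Basis. (vec2 u - vec2 l) \<bullet> b) = (\<Prod>b\<in>Basis. (u - l) \<bullet> b)"
    using ax by (simp add: Basis_vec2 Basis_complex_def inner_axis vec2_def)
  finally show "emeasure (distr lborel borel cplx) (box l u) = (\<Prod>b\<in>Basis. (u - l) \<bullet> b)" .
qed simp

lemma det_complex_mult: "det (matrix (\<lambda>h. vec2 (a * cplx h))) = (norm a)\<^sup>2"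
  unfolding cmod_power2 by (simp add: det_2 matrix_def cplx_def vec2_def axis_def power2_eq_square)

text \<open>Both directions of the biholomorphic map are named, so that every result can also be applied to
  the inverse map.\<close>

locale conformal =
  fixes f g :: "complex \<Rightarrow> complex" and U V :: "complex set"
  assumes open_dom: "open U" and open_ran: "open V"
    and hol: "f holomorphic_on U" and hol_inv: "g holomorphic_on V"
    and maps: "x \<in> U \<Longrightarrow> f x \<in> V" and inv: "x \<in> U \<Longrightarrow> g (f x) = x"
    and maps_inv: "y \<in> V \<Longrightarrow> g y \<in> U" and inv': "y \<in> V \<Longrightarrow> f (g y) = y"

lemma conformal_sym: "conformal f g U V \<Longrightarrow> conformal g f V U"
  by (auto simp: conformal_def)

lemma biholomorphic_imp_conformal:
  assumes "open U" "open V" "biholomorphic f U V"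
  shows "conformal f (the_inv_into U f) U V"
proof -
  have bij: "bij_betw f U V" using assms by (simp add: biholomorphic_def)
  then have inj: "inj_on f U" and im: "f ` U = V" by (auto simp: bij_betw_def)
  show ?thesis
  proof
    show "the_inv_into U f (f x) = x" if "x \<in> U" for x by (rule the_inv_into_f_f[OF inj that])
    show "the_inv_into U f y \<in> U" if "y \<in> V" for y using the_inv_into_into[OF inj, of y U] im that by blast
    show "f (the_inv_into U f y) = y" if "y \<in> V" for y using f_the_inv_into_f[OF inj, of y] im that by blast
  qed (use assms im in \<open>auto simp: biholomorphic_def\<close>)
qed

text \<open>Extension by zero outside of the domain, because membership in \<open>Cc\<close> concerns the function on the
  whole plane.\<close>

definition pull :: "('a \<Rightarrow> 'b) \<Rightarrow> 'a set \<Rightarrow> ('b \<Rightarrow> real) \<Rightarrow> 'a \<Rightarrow> real" where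
  "pull f U w x = (if x \<in> U then w (f x) else 0)"

context conformal begin

lemma image_eq: "T \<subseteq> U \<Longrightarrow> f ` T = {y \<in> V. g y \<in> T}"
  using maps inv maps_inv inv' by (auto simp: image_iff) (metis subsetD)+

lemma deriv_at: "x \<in> U \<Longrightarrow> (f has_field_derivative deriv f x) (at x)"
  by (rule holomorphic_derivI[OF hol open_dom])

lemma continuous_f: "continuous_on U f"
  by (rule holomorphic_on_imp_continuous_on[OF hol])

lemma continuous_deriv: "continuous_on U (deriv f)"
  by (rule holomorphic_on_imp_continuous_on[OF holomorphic_deriv[OF hol open_dom]])

lemma deriv_inv:
  assumes x: "x \<in> U"
  shows "deriv g (f x) * deriv f x = 1"
proof -
  have "((\<lambda>x. g (f x)) has_field_derivative deriv g (f x) * deriv f x) (at x)"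
    by (rule DERIV_chain2[OF holomorphic_derivI[OF hol_inv open_ran maps[OF x]] deriv_at[OF x]])
  then have "((\<lambda>x. x) has_field_derivative deriv g (f x) * deriv f x) (at x)"
    by (rule has_field_derivative_transform_within_open[OF _ open_dom x]) (rule inv)
  then show ?thesis using DERIV_ident DERIV_unique by blast
qed

lemma measurable_f: "f \<in> dx_on U \<rightarrow>\<^sub>M dx_on V"
proof (rule measurable_restrict_space2)
  show "f \<in> space (dx_on U) \<rightarrow> V" using maps by (simp add: space_dx_on)
  show "f \<in> dx_on U \<rightarrow>\<^sub>M lborel"
    using continuous_measurable_dx_on[OF continuous_f] by (simp add: measurable_def)
qed

lemma measurable_comp: "u \<in> borel_measurable (dx_on V) \<Longrightarrow> (\<lambda>x. u (f x)) \<in> borel_measurable (dx_on U)"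
  by (rule measurable_compose[OF measurable_f])

lemma image_borel:
  assumes "T \<in> sets borel" "T \<subseteq> U"
  shows "f ` T \<in> sets borel"
proof -
  have "g \<in> borel_measurable (restrict_space borel V)"
    by (rule borel_measurable_continuous_on_restrict[OF holomorphic_on_imp_continuous_on[OF hol_inv]])
  then have "g -` T \<inter> V \<in> sets (restrict_space borel V)"
    using assms(1) measurable_sets[of g "restrict_space borel V" borel T] by (simp add: space_restrict_space)
  then have "g -` T \<inter> V \<in> sets borel"
    using open_ran by (subst (asm) sets_restrict_space_iff) (auto simp: borel_open)
  moreover have "f ` T = g -` T \<inter> V" using image_eq[OF assms(2)] by auto
  ultimately show ?thesis by simp
qed

text \<open>The inverse map is differentiable, hence maps null sets to null sets.\<close>

lemma AE_comp:
  assumes "AE y in dx_on V. P y"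
  shows "AE x in dx_on U. P (f x)"
proof -
  have "AE y in lborel. y \<in> V \<longrightarrow> P y" using assms by (simp only: AE_dx_on[OF open_ran])
  then obtain N where N: "N \<in> null_sets lborel" "{y. \<not> (y \<in> V \<longrightarrow> P y)} \<subseteq> N"
    by (auto simp: eventually_ae_filter)
  have "negligible (N \<inter> V)"
    using null_sets_completionI[OF N(1)] negligible_iff_null_sets negligible_Int by blast
  then have "negligible (g ` (N \<inter> V))"
  proof (rule negligible_differentiable_image_negligible[OF order_refl])
    show "g differentiable_on N \<inter> V"
      using holomorphic_on_imp_differentiable_on[OF hol_inv] differentiable_on_subset by blast
  qed
  then have "AE x in lborel. x \<notin> g ` (N \<inter> V)"
    using AE_not_in[of "g ` (N \<inter> V)" lebesgue] by (simp add: negligible_iff_null_sets AE_completion_iff)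
  then have "AE x in lborel. x \<in> U \<longrightarrow> P (f x)"
  proof eventually_elim
    case (elim x)
    show ?case
    proof
      assume x: "x \<in> U"
      have "f x \<notin> N"
      proof
        assume "f x \<in> N"
        then have "x \<in> g ` (N \<inter> V)" using x maps inv by (intro image_eqI[of _ _ "f x"]) auto
        with elim show False by simp
      qed
      then show "P (f x)" using N(2) maps[OF x] by auto
    qed
  qed
  then show ?thesis by (simp only: AE_dx_on[OF open_dom])
qed

text \<open>The Jacobian determinant of multiplication by a complex number is the square of its norm.  If the
  image has infinite measure, then so has the integral, since a finite integral would give the image
  finite measure.\<close>

lemma emeasure_image:
  assumes T: "T \<in> sets borel" "T \<subseteq> U"
  shows "emeasure lborel (f ` T) = (\<integral>\<^sup>+x. ennreal ((norm (deriv f x))\<^sup>2) * indicator T x \<partial>lborel)"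
proof -
  define S where "S = cplx -` T"
  define F where "F x = vec2 (f (cplx x))" for x
  define J where "J x = (norm (deriv f (cplx x)))\<^sup>2" for x
  have S: "S \<in> sets borel"
    unfolding S_def using measurable_sets[OF cplx_measurable T(1)] by simp
  have FS: "F ` S = cplx -` (f ` T)"
  proof
    show "F ` S \<subseteq> cplx -` (f ` T)" unfolding F_def S_def by auto
    show "cplx -` (f ` T) \<subseteq> F ` S"
    proof
      fix x assume "x \<in> cplx -` (f ` T)"
      then obtain t where t: "t \<in> T" "cplx x = f t" by auto
      then have "x = F (vec2 t)" unfolding F_def by (metis cplx_vec2)
      then show "x \<in> F ` S" using t(1) unfolding S_def by auto
    qed
  qed
  have FS_borel: "F ` S \<in> sets borel"
    unfolding FS using measurable_sets[OF cplx_measurable image_borel[OF T]] by simp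
  have inj: "inj_on F S"
  proof (rule inj_onI)
    fix x y assume xy: "x \<in> S" "y \<in> S" "F x = F y"
    then have "f (cplx x) = f (cplx y)" unfolding F_def by (metis cplx_vec2(1))
    then have "cplx x = cplx y" using xy T(2) inv unfolding S_def by (metis subsetD vimageD)
    then show "x = y" by (metis cplx_vec2(2))
  qed
  have der: "(F has_derivative (\<lambda>h. vec2 (deriv f (cplx x) * cplx h))) (at x within S)" if "x \<in> S" for x
  proof -
    have "cplx x \<in> U" using that T(2) unfolding S_def by auto
    then have "(f has_derivative (\<lambda>h. deriv f (cplx x) * h)) (at (cplx x))"
      using deriv_at unfolding has_field_derivative_def by simp
    from has_derivative_compose[OF bounded_linear_imp_has_derivative[OF cplx_linear] this]
    have "((\<lambda>x. f (cplx x)) has_derivative (\<lambda>h. deriv f (cplx x) * cplx h)) (at x)" .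
    from bounded_linear.has_derivative[OF vec2_linear this]
    show ?thesis unfolding F_def by (rule has_derivative_at_withinI)
  qed
  have cov: "(F ` S \<in> lmeasurable \<and> measure lebesgue (F ` S) = m) \<longleftrightarrow> (J has_integral m) S" for m
    using has_measure_differentiable_image[of S F "\<lambda>x h. vec2 (deriv f (cplx x) * cplx h)" m, OF _ der inj] S
    by (simp add: det_complex_mult J_def[abs_def])
  have J_nn: "J x \<ge> 0" for x unfolding J_def by simp
  have em: "emeasure lborel (f ` T) = emeasure lborel (F ` S)"
    unfolding FS using distr_cplx emeasure_distr[of cplx lborel borel "f ` T"] image_borel[OF T] by simp
  have meas: "(\<lambda>x. ennreal ((norm (deriv f x))\<^sup>2) * indicator T x) \<in> borel_measurable borel"
  proof -
    have "deriv f \<in> borel_measurable (dx_on U)" by (rule continuous_measurable_dx_on[OF continuous_deriv])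
    then have "(\<lambda>x. indicator U x *\<^sub>R deriv f x) \<in> borel_measurable borel"
      by (rule borel_measurable_indicator_mult[OF open_dom])
    then have "(\<lambda>x. ennreal ((norm (indicator U x *\<^sub>R deriv f x))\<^sup>2) * indicator T x) \<in> borel_measurable borel"
      using T(1) by measurable
    moreover have "ennreal ((norm (indicator U x *\<^sub>R deriv f x))\<^sup>2) * indicator T x =
        ennreal ((norm (deriv f x))\<^sup>2) * indicator T x" for x
      using T(2) by (auto simp: indicator_def)
    ultimately show ?thesis by simp
  qed
  have "(\<integral>\<^sup>+x. ennreal ((norm (deriv f x))\<^sup>2) * indicator T x \<partial>lborel) =
      (\<integral>\<^sup>+x. ennreal ((norm (deriv f x))\<^sup>2) * indicator T x \<partial>distr lborel borel cplx)"
    by (simp add: distr_cplx)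
  also have "\<dots> = (\<integral>\<^sup>+x. ennreal ((norm (deriv f (cplx x)))\<^sup>2) * indicator T (cplx x) \<partial>lborel)"
    using meas by (subst nn_integral_distr) auto
  also have "\<dots> = (\<integral>\<^sup>+x. ennreal (J x) * indicator S x \<partial>lborel)"
    by (simp add: J_def S_def indicator_def)
  finally have nn: "(\<integral>\<^sup>+x. ennreal ((norm (deriv f x))\<^sup>2) * indicator T x \<partial>lborel) =
      (\<integral>\<^sup>+x. ennreal (J x) * indicator S x \<partial>lborel)" .
  have JS: "(\<lambda>x. ennreal (J x) * indicator S x) \<in> borel_measurable borel"
    using measurable_compose[OF cplx_measurable meas] by (simp add: J_def S_def indicator_def)
  have eqJ: "ennreal (indicator S x * J x) = ennreal (J x) * indicator S x" for x
    by (auto simp: indicator_def)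
  have JSr: "(\<lambda>x. indicator S x * J x) \<in> borel_measurable borel"
  proof -
    have "(\<lambda>x. enn2real (ennreal (J x) * indicator S x)) \<in> borel_measurable borel" using JS by measurable
    moreover have "enn2real (ennreal (J x) * indicator S x) = indicator S x * J x" for x
      using J_nn[of x] by (auto simp: indicator_def)
    ultimately show ?thesis by simp
  qed
  have "emeasure lborel (F ` S) = (\<integral>\<^sup>+x. ennreal (J x) * indicator S x \<partial>lborel)"
  proof (cases "F ` S \<in> lmeasurable")
    case True
    then have "(J has_integral measure lebesgue (F ` S)) S" using cov by blast
    then have "(\<integral>\<^sup>+x. ennreal (J x) * indicator S x \<partial>lborel) = ennreal (measure lebesgue (F ` S))"
      by (intro nn_integral_has_integral_lebesgue' J_nn)
    also have "\<dots> = emeasure lebesgue (F ` S)" using emeasure_eq_ennreal_measure[OF fmeasurableD2[OF True]] by simp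
    finally show ?thesis using FS_borel by simp
  next
    case False
    then have "\<not> emeasure lborel (F ` S) < \<infinity>" using FS_borel by (auto simp: fmeasurable_def)
    then have inf: "emeasure lborel (F ` S) = \<infinity>" by (metis infinity_ennreal_def top.not_eq_extremum)
    have "(\<integral>\<^sup>+x. ennreal (J x) * indicator S x \<partial>lborel) = \<infinity>"
    proof (rule ccontr)
      assume "(\<integral>\<^sup>+x. ennreal (J x) * indicator S x \<partial>lborel) \<noteq> \<infinity>"
      then have "(\<lambda>x. indicator S x * J x) integrable_on UNIV"
        using J_nn by (intro nn_integral_integrable_on JSr) (auto simp: eqJ less_top)
      moreover have "(\<lambda>x. indicator S x * J x) = (\<lambda>x. if x \<in> S then J x else 0)" by (auto simp: fun_eq_iff)
      ultimately have "J integrable_on S" using integrable_restrict_UNIV[of S J] by simp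
      then have "(J has_integral integral S J) S" by (rule integrable_integral)
      with cov False show False by blast
    qed
    with inf show ?thesis by simp
  qed
  then show ?thesis unfolding em nn .
qed

text \<open>Equality of measures gives the change of variables formula for all integrands at once.\<close>

lemma distr_density_deriv:
  "distr (density (dx_on U) (\<lambda>x. ennreal ((norm (deriv f x))\<^sup>2))) (dx_on V) f = dx_on V"
proof (rule measure_eqI)
  let ?J = "\<lambda>x. ennreal ((norm (deriv f x))\<^sup>2)"
  have [measurable]: "deriv f \<in> borel_measurable (dx_on U)"
    by (rule continuous_measurable_dx_on[OF continuous_deriv])
  note [measurable] = measurable_f
  fix B assume "B \<in> sets (distr (density (dx_on U) ?J) (dx_on V) f)"
  then have B [measurable]: "B \<in> sets (dx_on V)" by simp
  then have B': "B \<in> sets borel" "B \<subseteq> V"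
    using open_ran by (auto simp: sets_dx_on sets_restrict_space_iff borel_open)
  define T where "T = f -` B \<inter> U"
  have "T \<in> sets (dx_on U)" using measurable_sets[OF measurable_f B] by (simp add: T_def space_dx_on)
  then have T: "T \<in> sets borel" "T \<subseteq> U"
    using open_dom by (auto simp: sets_dx_on sets_restrict_space_iff borel_open)
  have "f ` T = {y \<in> V. g y \<in> T}" by (rule image_eq[OF T(2)])
  also have "\<dots> = B" unfolding T_def using B'(2) inv' maps_inv by auto
  finally have fT: "f ` T = B" .
  have "emeasure (distr (density (dx_on U) ?J) (dx_on V) f) B = emeasure (density (dx_on U) ?J) T"
    using measurable_f by (subst emeasure_distr) (simp_all add: T_def space_dx_on B)
  also have "\<dots> = (\<integral>\<^sup>+x. ?J x * indicator T x \<partial>dx_on U)"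
    using \<open>T \<in> sets (dx_on U)\<close> by (subst emeasure_density) auto
  also have "\<dots> = (\<integral>\<^sup>+x. ?J x * indicator T x * indicator U x \<partial>lborel)"
    using open_dom by (subst nn_integral_restrict_space) auto
  also have "\<dots> = (\<integral>\<^sup>+x. ?J x * indicator T x \<partial>lborel)"
    using T(2) by (intro nn_integral_cong) (auto simp: indicator_def)
  also have "\<dots> = emeasure lborel B" using emeasure_image[OF T] by (simp add: fT)
  also have "\<dots> = emeasure (dx_on V) B"
    using open_ran B'(2) by (subst emeasure_restrict_space) auto
  finally show "emeasure (distr (density (dx_on U) ?J) (dx_on V) f) B = emeasure (dx_on V) B" .
qed simp

lemma change_of_variables:
  fixes h :: "complex \<Rightarrow> real"
  assumes h [measurable]: "h \<in> borel_measurable (dx_on V)"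
  shows "integrable (dx_on V) h \<longleftrightarrow> integrable (dx_on U) (\<lambda>x. (norm (deriv f x))\<^sup>2 * h (f x))"
    and "(\<integral>y. h y \<partial>dx_on V) = (\<integral>x. (norm (deriv f x))\<^sup>2 * h (f x) \<partial>dx_on U)"
proof -
  let ?J = "\<lambda>x. ennreal ((norm (deriv f x))\<^sup>2)"
  have [measurable]: "deriv f \<in> borel_measurable (dx_on U)"
    by (rule continuous_measurable_dx_on[OF continuous_deriv])
  note [measurable] = measurable_f measurable_comp[OF h]
  have f': "f \<in> density (dx_on U) ?J \<rightarrow>\<^sub>M dx_on V" using measurable_f by simp
  have "integrable (dx_on V) h \<longleftrightarrow> integrable (distr (density (dx_on U) ?J) (dx_on V) f) h"
    by (simp add: distr_density_deriv)
  also have "\<dots> \<longleftrightarrow> integrable (dx_on U) (\<lambda>x. (norm (deriv f x))\<^sup>2 * h (f x))"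
    by (simp add: integrable_distr_eq[OF f' h] integrable_density)
  finally show "integrable (dx_on V) h \<longleftrightarrow> integrable (dx_on U) (\<lambda>x. (norm (deriv f x))\<^sup>2 * h (f x))" .
  have "(\<integral>y. h y \<partial>dx_on V) = (\<integral>y. h y \<partial>distr (density (dx_on U) ?J) (dx_on V) f)"
    by (simp add: distr_density_deriv)
  also have "\<dots> = (\<integral>x. (norm (deriv f x))\<^sup>2 * h (f x) \<partial>dx_on U)"
    by (simp add: integral_distr[OF f' h] integral_density)
  finally show "(\<integral>y. h y \<partial>dx_on V) = (\<integral>x. (norm (deriv f x))\<^sup>2 * h (f x) \<partial>dx_on U)" .
qed

section \<open>Conformal invariance of the Dirichlet integral\<close>

lemma continuous_extension_by_zero:
  fixes h :: "complex \<Rightarrow> real"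
  assumes "continuous_on U h" "compact K" "K \<subseteq> U" "\<And>x. x \<notin> K \<Longrightarrow> h x = 0"
  shows "continuous_on UNIV h"
proof -
  have "continuous_on (- K) h"
    using continuous_on_cong[of "- K" "- K" h "\<lambda>_. 0"] assms(4) by simp
  moreover have "open (- K)" using assms(2) by (simp add: compact_imp_closed open_Compl)
  ultimately have "continuous_on (U \<union> - K) h" using assms(1) open_dom by (intro continuous_on_open_Un)
  moreover have "U \<union> - K = UNIV" using assms(3) by auto
  ultimately show ?thesis by simp
qed

lemma pull_support:
  assumes "compact K" "K \<subseteq> V" "\<And>y. y \<notin> K \<Longrightarrow> w y = 0"
  shows "compact (g ` K)" "g ` K \<subseteq> U" "\<And>x. x \<notin> g ` K \<Longrightarrow> pull f U w x = 0"
proof -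
  show "compact (g ` K)"
    using assms(1) by (intro compact_continuous_image continuous_on_subset[OF holomorphic_on_imp_continuous_on[OF hol_inv] assms(2)])
  show "g ` K \<subseteq> U"
  proof
    fix x assume "x \<in> g ` K"
    then obtain y where "y \<in> K" "x = g y" by blast
    with assms(2) show "x \<in> U" using maps_inv[of y] by blast
  qed
  fix x assume "x \<notin> g ` K"
  then show "pull f U w x = 0"
    unfolding pull_def using assms(3)[of "f x"] inv by (metis image_eqI)
qed

lemma pull_Cc:
  assumes "w \<in> Cc V"
  shows "pull f U w \<in> Cc U"
proof -
  obtain K where K: "compact K" "K \<subseteq> V" "\<And>y. y \<notin> K \<Longrightarrow> w y = 0" and c: "continuous_on UNIV w"
    using assms unfolding Cc_iff by blast
  have "continuous_on U (\<lambda>x. w (f x))"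
    by (rule continuous_on_compose2[OF c continuous_f]) simp
  then have "continuous_on U (pull f U w)"
    using continuous_on_cong[of U U "pull f U w" "\<lambda>x. w (f x)"] by (simp add: pull_def)
  then have "continuous_on UNIV (pull f U w)"
    by (rule continuous_extension_by_zero[OF _ pull_support[of K w, OF K]])
  then show ?thesis unfolding Cc_iff
    by (intro conjI exI[of _ "g ` K"] allI impI pull_support[of K w, OF K])
qed

lemma pull_Cc_infinity:
  assumes "w \<in> Cc_infinity V"
  shows "pull f U w \<in> Cc_infinity U"
proof -
  obtain K where K: "compact K" "K \<subseteq> V" "\<And>y. y \<notin> K \<Longrightarrow> w y = 0" "\<And>k. w \<in> Ck_on k UNIV"
    using Cc_infinityE[OF assms] by blast
  note S = pull_support[of K w, OF K(1-3)]
  have "pull f U w \<in> Ck_on k UNIV" for k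
  proof -
    have "(\<lambda>x. w (f x)) \<in> Ck_on k U" by (rule Ck_on_comp_holomorphic[OF open_dom hol _ K(4)]) simp
    then have "pull f U w \<in> Ck_on k U" by (rule Ck_on_cong[OF open_dom, rotated]) (simp add: pull_def)
    moreover have op: "open (- (g ` K))" using S(1) by (simp add: compact_imp_closed open_Compl)
    moreover have "pull f U w \<in> Ck_on k (- (g ` K))"
      by (rule Ck_on_cong[OF op _ Ck_on_const[of 0]]) (use S(3) in simp)
    ultimately have "pull f U w \<in> Ck_on k (U \<union> - (g ` K))" using open_dom by (intro Ck_on_Un)
    moreover have "U \<union> - (g ` K) = UNIV" using S(2) by auto
    ultimately show ?thesis by simp
  qed
  with S show ?thesis by (intro Cc_infinityI[where K = "g ` K"])
qed

lemma pull_pull: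
  assumes "w \<in> Cc V"
  shows "pull g V (pull f U w) = w"
proof
  obtain K where "K \<subseteq> V" "\<And>y. y \<notin> K \<Longrightarrow> w y = 0" using assms unfolding Cc_iff by blast
  then show "pull g V (pull f U w) x = w x" for x
    unfolding pull_def using maps_inv inv' by auto
qed

lemma pull_zero: "pull f U (\<lambda>x. 0) = (\<lambda>x. 0)"
  and pull_add: "pull f U (\<lambda>x. u x + v x) = (\<lambda>x. pull f U u x + pull f U v x)"
  and pull_diff: "pull f U (\<lambda>x. u x - v x) = (\<lambda>x. pull f U u x - pull f U v x)"
  and pull_scale: "pull f U (\<lambda>x. c * u x) = (\<lambda>x. c * pull f U u x)"
  by (auto simp: pull_def fun_eq_iff)

lemma pull_measurable: "u \<in> borel_measurable (dx_on V) \<Longrightarrow> pull f U u \<in> borel_measurable (dx_on U)"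
  using measurable_comp[of u] measurable_cong[of "dx_on U" "pull f U u" "\<lambda>x. u (f x)" borel]
  by (simp add: pull_def space_dx_on)

text \<open>By the Cauchy--Riemann equations the gradient of \<open>w \<circ> f\<close> is the gradient of \<open>w\<close> multiplied by
  the conjugate of the derivative of \<open>f\<close>, so that inner products of gradients are multiplied by
  exactly the Jacobian determinant of \<open>f\<close>.\<close>

lemma grad_pull:
  assumes w: "w \<in> Cc_infinity V" and x: "x \<in> U"
  shows "grad (pull f U w) x = cnj (deriv f x) * grad w (f x)"
proof (rule grad_eqI)
  have "(f has_derivative (\<lambda>h. deriv f x * h)) (at x)"
    using deriv_at[OF x] by (simp add: has_field_derivative_def)
  from has_derivative_compose[OF this Cc_infinity_has_derivative_grad[OF w]]
  have "((\<lambda>x. w (f x)) has_derivative (\<lambda>h. grad w (f x) \<bullet> (deriv f x * h))) (at x)" .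
  moreover have "grad w (f x) \<bullet> (deriv f x * h) = (cnj (deriv f x) * grad w (f x)) \<bullet> h" for h
    by (simp add: inner_complex_def algebra_simps)
  ultimately have "((\<lambda>x. w (f x)) has_derivative (\<lambda>h. (cnj (deriv f x) * grad w (f x)) \<bullet> h)) (at x)" by simp
  then show "(pull f U w has_derivative (\<lambda>h. (cnj (deriv f x) * grad w (f x)) \<bullet> h)) (at x)"
    by (rule has_derivative_transform_within_open[OF _ open_dom x]) (simp add: pull_def)
qed

lemma dirichlet_integral_pull_smooth:
  assumes v: "v \<in> Cc_infinity V" and w: "w \<in> Cc_infinity V"
  shows "dirichlet_integral U (pull f U v, pull f U w) = dirichlet_integral V (v, w)"
proof -
  have inner: "(cnj a * b) \<bullet> (cnj a * c) = (norm a)\<^sup>2 * (b \<bullet> c)" for a b c :: complex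
    unfolding cmod_power2 by (simp add: inner_complex_def power2_eq_square algebra_simps)
  have [measurable]: "grad v \<in> borel_measurable (dx_on V)" "grad w \<in> borel_measurable (dx_on V)"
    using grad_sq_int[OF open_ran] v w sq_int_measurable by blast+
  have "dirichlet_integral U (pull f U v, pull f U w) = sq_inner (dx_on U) (grad (pull f U v), grad (pull f U w))"
    by (rule dirichlet_integral_grad[OF open_dom pull_Cc_infinity[OF v] pull_Cc_infinity[OF w]])
  also have "\<dots> = (\<integral>x. (norm (deriv f x))\<^sup>2 * (grad v (f x) \<bullet> grad w (f x)) \<partial>dx_on U)"
    unfolding sq_inner_def prod.case
    by (intro Bochner_Integration.integral_cong) (auto simp: space_dx_on grad_pull v w inner)
  also have "\<dots> = (\<integral>y. grad v y \<bullet> grad w y \<partial>dx_on V)"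
    by (rule change_of_variables(2)[symmetric]) measurable
  also have "\<dots> = dirichlet_integral V (v, w)"
    unfolding dirichlet_integral_grad[OF open_ran v w] by (simp add: sq_inner_def)
  finally show ?thesis .
qed

text \<open>On a compact subset of \<open>V\<close> the Jacobian determinant of the inverse map is bounded.\<close>

lemma pull_sq_int_bound:
  assumes "compact K" "K \<subseteq> V"
  obtains B where "B \<ge> 0" "\<And>w. w \<in> sq_int (dx_on V) \<Longrightarrow> (\<And>y. y \<notin> K \<Longrightarrow> w y = 0) \<Longrightarrow>
    pull f U w \<in> sq_int (dx_on U) \<and> mean_sq (dx_on U) (pull f U w) \<le> B * mean_sq (dx_on V) w"
proof -
  have "continuous_on K (\<lambda>y. deriv g y)"
    by (rule continuous_on_subset[OF conformal.continuous_deriv[OF conformal_sym] assms(2)]) unfold_locales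
  then have "bounded (deriv g ` K)" by (intro compact_imp_bounded compact_continuous_image assms(1))
  then obtain C where C: "\<And>y. y \<in> K \<Longrightarrow> norm (deriv g y) \<le> C" unfolding bounded_iff by auto
  have bound: "pull f U w \<in> sq_int (dx_on U) \<and> mean_sq (dx_on U) (pull f U w) \<le> C\<^sup>2 * mean_sq (dx_on V) w"
    if w: "w \<in> sq_int (dx_on V)" and z: "\<And>y. y \<notin> K \<Longrightarrow> w y = 0" for w
  proof -
    have [measurable]: "w \<in> borel_measurable (dx_on V)" by (rule sq_int_measurable[OF w])
    note pm [measurable] = pull_measurable[OF sq_int_measurable[OF w]]
    have int: "integrable (dx_on U) (\<lambda>x. C\<^sup>2 * ((norm (deriv f x))\<^sup>2 * (norm (w (f x)))\<^sup>2))"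
      using change_of_variables(1)[of "\<lambda>y. (norm (w y))\<^sup>2"] sq_int_norm_sq[OF w] by simp
    have le: "(norm (pull f U w x))\<^sup>2 \<le> C\<^sup>2 * ((norm (deriv f x))\<^sup>2 * (norm (w (f x)))\<^sup>2)" for x
    proof (cases "x \<in> U \<and> f x \<in> K")
      case True
      \<comment> \<open>The derivatives of \<open>f\<close> and of its inverse are reciprocal.\<close>
      have "norm (deriv g (f x)) * norm (deriv f x) = 1"
        using deriv_inv[of x] True by (metis norm_mult norm_one)
      then have "1 \<le> C * norm (deriv f x)"
        using mult_right_mono[OF C[of "f x"], of "norm (deriv f x)"] True by simp
      then have "1 \<le> (C * norm (deriv f x))\<^sup>2" by (simp add: one_le_power)
      from mult_right_mono[OF this, of "(norm (w (f x)))\<^sup>2"]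
      show ?thesis using True by (simp add: pull_def power_mult_distrib mult.assoc)
    next
      case False
      then have "pull f U w x = 0" using z by (auto simp: pull_def)
      then show ?thesis by simp
    qed
    have i1: "integrable (dx_on U) (\<lambda>x. (norm (pull f U w x))\<^sup>2)"
      by (rule Bochner_Integration.integrable_bound[OF int]) (use le in \<open>auto intro!: AE_I2\<close>)
    then have "pull f U w \<in> sq_int (dx_on U)" by (simp add: sq_int_def)
    moreover have "(\<integral>x. (norm (pull f U w x))\<^sup>2 \<partial>dx_on U) \<le> (\<integral>x. C\<^sup>2 * ((norm (deriv f x))\<^sup>2 * (norm (w (f x)))\<^sup>2) \<partial>dx_on U)"
      by (rule integral_mono[OF i1 int le])
    moreover have "(\<integral>x. (norm (deriv f x))\<^sup>2 * (norm (w (f x)))\<^sup>2 \<partial>dx_on U) = (\<integral>y. (norm (w y))\<^sup>2 \<partial>dx_on V)"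
      by (rule change_of_variables(2)[symmetric]) measurable
    ultimately show ?thesis unfolding sq_inner_self by simp
  qed
  show ?thesis by (rule that[of "C\<^sup>2"]) (use bound in auto)
qed

text \<open>A function in \<open>H10 V \<inter> Cc V\<close> is a limit of smooth functions that are supported in a fixed
  compact set.  There the two L2 norms are comparable, so the pulled back approximations converge
  in both parts of the norm.\<close>

lemma pull_approx:
  assumes w: "w \<in> H10 V \<inter> Cc V"
  obtains \<psi> where "\<And>n::nat. \<psi> n \<in> Cc_infinity V"
    "energy_conv V \<psi> w"
    "pull f U w \<in> H10 U"
    "(\<lambda>n. energy U (\<lambda>x. pull f U (\<psi> n) x - pull f U w x)) \<longlonglongrightarrow> 0"
proof -
  interpret HV: closed_form "dx_on V" "H10 V" "dirichlet_integral V" by (rule closed_form_H10[OF open_ran])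
  interpret HU: closed_form "dx_on U" "H10 U" "dirichlet_integral U" by (rule closed_form_H10[OF open_dom])
  obtain K where K: "compact K" "K \<subseteq> V" "\<And>y. y \<notin> K \<Longrightarrow> w y = 0"
    using IntD2[OF w] unfolding Cc_iff by blast
  obtain \<eta> where \<eta>: "\<eta> \<in> Cc_infinity V" "\<And>x. x \<in> K \<Longrightarrow> \<eta> x = 1"
    using smooth_cutoff[OF K(1) open_ran K(2)] by metis
  obtain \<phi> where \<phi>: "\<And>n::nat. \<phi> n \<in> Cc_infinity V"
    "energy_conv V \<phi> w"
    "mean_conv (dx_on V) \<phi> w"
    using H10_approx[OF open_ran] w by blast
  define \<psi> where "\<psi> n x = \<eta> x * \<phi> n x" for n x
  have \<eta>w: "(\<lambda>x. \<eta> x * w x) = w" using \<eta>(2) K(3) by (auto simp: fun_eq_iff)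
  have wH: "w \<in> H10 V" using w by blast
  have wL: "w \<in> sq_int (dx_on V)" by (rule HV.mem_sq_int[OF wH])
  have lim: "energy_conv V \<psi> w"
    "mean_conv (dx_on V) \<psi> w"
    using dirichlet_integral_mult_tendsto(2,3)[OF open_ran wH \<eta>(1) \<phi>] fun_cong[OF \<eta>w] unfolding \<psi>_def by simp_all
  have "\<And>k. \<eta> \<in> Ck_on k UNIV" using \<eta>(1) by (simp add: Cc_infinity_iff)
  then have \<psi>: "\<psi> n \<in> Cc_infinity V" for n
    unfolding \<psi>_def[abs_def] by (rule Cc_infinity_mult[OF \<phi>(1)])
  have \<psi>H: "\<psi> n \<in> H10 V" for n using \<psi> Cc_infinity_subset_H10[OF open_ran] by blast
  have p\<psi>: "pull f U (\<psi> n) \<in> H10 U" for n using pull_Cc_infinity[OF \<psi>] Cc_infinity_subset_H10[OF open_dom] by blast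
  obtain L where L: "compact L" "L \<subseteq> V" "\<And>y. y \<notin> L \<Longrightarrow> \<eta> y = 0" using Cc_infinityE[OF \<eta>(1)] by metis
  obtain B where B: "B \<ge> 0" "\<And>w. w \<in> sq_int (dx_on V) \<Longrightarrow> (\<And>y. y \<notin> L \<Longrightarrow> w y = 0) \<Longrightarrow>
    pull f U w \<in> sq_int (dx_on U) \<and> mean_sq (dx_on U) (pull f U w) \<le> B * mean_sq (dx_on V) w"
    using pull_sq_int_bound[OF L(1,2)] by metis
  have zero: "y \<notin> L \<Longrightarrow> w y = 0" "y \<notin> L \<Longrightarrow> \<psi> n y = 0" for y n
    using L(3)[of y] fun_cong[OF \<eta>w, of y] unfolding \<psi>_def by auto
  have pw: "pull f U w \<in> sq_int (dx_on U)" using B(2)[OF wL] zero by blast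
  have L2lim: "(\<lambda>n. mean_sq (dx_on U) (\<lambda>x. pull f U (\<psi> n) x - pull f U w x)) \<longlonglongrightarrow> 0"
  proof (rule tendsto_0_le_scale[OF _ _ lim(2)])
    show "0 \<le> mean_sq (dx_on U) (\<lambda>x. pull f U (\<psi> n) x - pull f U w x)" for n by (simp add: sq_inner_self)
    show "mean_sq (dx_on U) (\<lambda>x. pull f U (\<psi> n) x - pull f U w x) \<le> B * mean_sq (dx_on V) (\<lambda>x. \<psi> n x - w x)" for n
      using B(2)[OF sq_int.diff_mem[OF HV.mem_sq_int[OF \<psi>H] wL], of n] zero unfolding pull_diff by simp
  qed
  have "HV.Cauchy_seq \<psi>" by (rule HV.convergent_Cauchy_seq[OF \<psi>H wH lim(1)])
  moreover have "energy U (\<lambda>x. pull f U (\<psi> m) x - pull f U (\<psi> n) x)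
      = energy V (\<lambda>x. \<psi> m x - \<psi> n x)" for m n
  proof -
    have "(\<lambda>x. \<psi> m x - \<psi> n x) \<in> Cc_infinity V"
      using Cc_infinity_add[OF \<psi>[of m] Cc_infinity_scale[OF \<psi>[of n], of "-1"]] by simp
    from dirichlet_integral_pull_smooth[OF this this] show ?thesis unfolding pull_diff .
  qed
  ultimately have "HU.Cauchy_seq (\<lambda>n. pull f U (\<psi> n))"
    unfolding HU.Cauchy_seq_def HV.Cauchy_seq_def by simp
  from HU.Cauchy_limit[of "\<lambda>n. pull f U (\<psi> n)", OF p\<psi> this pw L2lim] that[of \<psi>] \<psi> lim(1) show ?thesis by blast
qed

lemma pull_H10: "w \<in> H10 V \<inter> Cc V \<Longrightarrow> pull f U w \<in> H10 U \<inter> Cc U"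
  using pull_approx pull_Cc by blast

lemma dirichlet_integral_pull:
  assumes v: "v \<in> H10 V \<inter> Cc V" and w: "w \<in> H10 V \<inter> Cc V"
  shows "dirichlet_integral U (pull f U v, pull f U w) = dirichlet_integral V (v, w)"
proof -
  interpret HV: closed_form "dx_on V" "H10 V" "dirichlet_integral V" by (rule closed_form_H10[OF open_ran])
  interpret HU: closed_form "dx_on U" "H10 U" "dirichlet_integral U" by (rule closed_form_H10[OF open_dom])
  obtain \<phi> where \<phi>: "\<And>n::nat. \<phi> n \<in> Cc_infinity V"
    "energy_conv V \<phi> v" "pull f U v \<in> H10 U"
    "(\<lambda>n. energy U (\<lambda>x. pull f U (\<phi> n) x - pull f U v x)) \<longlonglongrightarrow> 0"
    using pull_approx[OF v] by blast
  obtain \<psi> where \<psi>: "\<And>n::nat. \<psi> n \<in> Cc_infinity V"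
    "energy_conv V \<psi> w" "pull f U w \<in> H10 U"
    "(\<lambda>n. energy U (\<lambda>x. pull f U (\<psi> n) x - pull f U w x)) \<longlonglongrightarrow> 0"
    using pull_approx[OF w] by blast
  note H = Cc_infinity_subset_H10[OF open_ran, THEN subsetD] Cc_infinity_subset_H10[OF open_dom, THEN subsetD]
  have "(\<lambda>n. dirichlet_integral V (\<phi> n, \<psi> n)) \<longlonglongrightarrow> dirichlet_integral V (v, w)"
    by (rule HV.tendsto_form[OF H(1)[OF \<phi>(1)] H(1)[OF \<psi>(1)] _ _ \<phi>(2) \<psi>(2)]) (use v w in auto)
  moreover have "(\<lambda>n. dirichlet_integral U (pull f U (\<phi> n), pull f U (\<psi> n))) \<longlonglongrightarrow> dirichlet_integral U (pull f U v, pull f U w)"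
    by (rule HU.tendsto_form[OF H(2)[OF pull_Cc_infinity[OF \<phi>(1)]] H(2)[OF pull_Cc_infinity[OF \<psi>(1)]] \<phi>(3) \<psi>(3) \<phi>(4) \<psi>(4)])
  ultimately show ?thesis
    unfolding dirichlet_integral_pull_smooth[OF \<phi>(1) \<psi>(1)] using LIMSEQ_unique by blast
qed

end

section \<open>Regular subspaces of the form of absorbing Brownian motion\<close>

context closed_form begin

text \<open>The contractions of an approximating sequence stay in \<open>C\<close>, converge in L2 and have bounded energy;
  by \<open>bounded_energy_limit\<close> their limit is in the closure of \<open>C\<close>.\<close>

lemma form_closure_markov:
  assumes C: "C \<subseteq> F" "\<And>u v. u \<in> C \<Longrightarrow> v \<in> C \<Longrightarrow> (\<lambda>x. (1/2) * (u x + v x)) \<in> C"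
    and T: "\<And>u. u \<in> C \<Longrightarrow> (\<lambda>x. min (max 0 (u x)) 1) \<in> C"
      "\<And>u. u \<in> C \<Longrightarrow> E (\<lambda>x. min (max 0 (u x)) 1, \<lambda>x. min (max 0 (u x)) 1) \<le> E (u, u)"
    and u: "u \<in> form_closure C"
  shows "(\<lambda>x. min (max 0 (u x)) 1) \<in> form_closure C"
    "E (\<lambda>x. min (max 0 (u x)) 1, \<lambda>x. min (max 0 (u x)) 1) \<le> E (u, u)"
proof -
  define t :: "real \<Rightarrow> real" where "t a = min (max 0 a) 1" for a
  have t_lip: "\<bar>t a - t b\<bar> \<le> \<bar>a - b\<bar>" for a b unfolding t_def by (auto simp: min_def max_def)
  have uF: "u \<in> F" using u form_closure_sub by blast
  note [measurable] = mem_measurable[OF uF]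
  obtain vs where vs: "\<And>n::nat. vs n \<in> C" "(\<lambda>n. sq (\<lambda>x. vs n x - u x)) \<longlonglongrightarrow> 0"
    "mean_conv M vs u"
    using form_closureE[OF C(1) u] by blast
  have vsF: "vs n \<in> F" for n using vs C by blast
  have tu: "(\<lambda>x. t (u x)) \<in> sq_int M"
    by (rule sq_int_bound[OF mem_sq_int[OF uF]]) (auto simp: t_def)
  have tv: "(\<lambda>x. t (vs n x)) \<in> C" "sq (\<lambda>x. t (vs n x)) \<le> sq (vs n)" for n
    using T[OF vs(1)] unfolding t_def by auto
  have le: "mean_sq M (\<lambda>x. t (vs n x) - t (u x)) \<le> mean_sq M (\<lambda>x. vs n x - u x)" for n
  proof -
    have "(\<lambda>x. t (vs n x) - t (u x)) \<in> sq_int M"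
      using tv(1) C(1) mem_sq_int by (intro sq_int.diff_mem tu) blast
    from sq_int_dominated(2)[OF sq_int.diff_mem[OF mem_sq_int[OF vsF] mem_sq_int[OF uF]] sq_int_measurable[OF this], of 1]
    show ?thesis using t_lip by simp
  qed
  have lim: "(\<lambda>n. sq (vs n)) \<longlonglongrightarrow> sq u" by (rule tendsto_form[OF vsF vsF uF uF vs(2) vs(2)])
  have approx: "\<exists>v\<in>C. mean_sq M (\<lambda>x. v x - t (u x)) < \<epsilon> \<and> sq v \<le> sq u + \<delta>"
    if "\<delta> > 0" "\<epsilon> > 0" for \<epsilon> \<delta>
  proof -
    have "\<forall>\<^sub>F n in sequentially. sq (vs n) < sq u + \<delta>" using order_tendstoD(2)[OF lim] that by simp
    moreover have "\<forall>\<^sub>F n in sequentially. mean_sq M (\<lambda>x. vs n x - u x) < \<epsilon>"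
      using order_tendstoD(2)[OF vs(3)] that by simp
    ultimately have "\<forall>\<^sub>F n in sequentially. sq (vs n) < sq u + \<delta> \<and> mean_sq M (\<lambda>x. vs n x - u x) < \<epsilon>"
      by (rule eventually_conj)
    then obtain n where "sq (vs n) < sq u + \<delta>" "mean_sq M (\<lambda>x. vs n x - u x) < \<epsilon>"
      using eventually_happens'[OF sequentially_bot] by blast
    then show ?thesis using tv[of n] le[of n] by (intro bexI[of _ "\<lambda>x. t (vs n x)"]) auto
  qed
  have tuF: "(\<lambda>x. t (u x)) \<in> F"
    by (rule bounded_energy_limit(1)[OF C tu approx[OF zero_less_one]])
  have "(\<lambda>x. t (u x)) \<in> form_closure C"
    by (rule bounded_energy_limit(3)[OF C tu approx[OF zero_less_one]])
  then show "(\<lambda>x. min (max 0 (u x)) 1) \<in> form_closure C" unfolding t_def .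
  have "sq (\<lambda>x. t (u x)) \<le> sq u"
    by (rule field_le_epsilon) (rule bounded_energy_limit(2)[OF C tu approx])
  then show "sq (\<lambda>x. min (max 0 (u x)) 1) \<le> sq u" unfolding t_def .
qed

end

lemma markovian_form_scale:
  assumes "markovian_form M F E" "c > 0" "\<And>u v. u \<in> F \<Longrightarrow> v \<in> F \<Longrightarrow> E' (u, v) = c * E (u, v)"
  shows "markovian_form M F E'"
proof -
  interpret markovian_form M F E by fact
  show ?thesis
    using assms(2,3) markov_mem markov_le
    by (intro markovian_form.intro closed_form_scale[OF assms(2,3)] markovian_form_axioms.intro) auto
qed

text \<open>Restricted to \<open>F \<times> F\<close>, because forms are extensional outside of their domain.\<close>

definition half_dirichlet :: "'a::euclidean_space set \<Rightarrow> ('a \<Rightarrow> real) set \<Rightarrow> 'a form" where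
  "half_dirichlet \<Gamma> F = (restrict (\<lambda>(u, v). 1/2 * dirichlet_integral \<Gamma> (u, v)) (F \<times> F), F)"

lemma absorbing_BM_form_eq: "absorbing_BM_form \<Gamma> = half_dirichlet \<Gamma> (H10 \<Gamma>)"
  by (simp add: absorbing_BM_form_def half_dirichlet_def)

text \<open>A regular subspace is thus given by its domain alone.\<close>

lemma regular_subspace_eq_half_dirichlet:
  assumes "regular_subspace \<Gamma> M (E, F) (absorbing_BM_form \<Gamma>)"
  shows "(E, F) = half_dirichlet \<Gamma> F" "F \<subseteq> H10 \<Gamma>"
proof -
  note A = assms[unfolded absorbing_BM_form_def regular_subspace.simps]
  have "regular_dirichlet_form \<Gamma> M (E, F)" using A by (elim conjE) assumption
  then have "dirichlet_form M (E, F)" unfolding regular_dirichlet_form.simps by (rule conjunct1)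
  then have *: "E \<in> extensional (F \<times> F)" unfolding dirichlet_form.simps by (rule conjunct1)
  have sub: "F \<subseteq> H10 \<Gamma>" using A by (elim conjE) assumption
  have eq: "\<forall>u\<in>F. \<forall>v\<in>F. restrict (\<lambda>(u, v). 1/2 * dirichlet_integral \<Gamma> (u, v)) (H10 \<Gamma> \<times> H10 \<Gamma>) (u, v) = E (u, v)"
    using A by (elim conjE) assumption
  have "E p = restrict (\<lambda>(u, v). 1/2 * dirichlet_integral \<Gamma> (u, v)) (F \<times> F) p" for p
  proof (cases "p \<in> F \<times> F")
    case True
    then obtain u v where "p = (u, v)" "u \<in> F" "v \<in> F" by auto
    with eq sub show ?thesis by (auto simp: restrict_def subset_iff)
  next
    case False
    then show ?thesis using extensional_arb[OF * False] by (simp add: restrict_def)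
  qed
  then show "(E, F) = half_dirichlet \<Gamma> F" by (simp add: half_dirichlet_def fun_eq_iff)
  show "F \<subseteq> H10 \<Gamma>" by (rule sub)
qed

lemma regular_subspace_half_dirichlet_iff:
  "regular_subspace \<Gamma> (dx_on \<Gamma>) (half_dirichlet \<Gamma> F) (absorbing_BM_form \<Gamma>) \<longleftrightarrow>
    regular_dirichlet_form \<Gamma> (dx_on \<Gamma>) (half_dirichlet \<Gamma> F) \<and>
    regular_dirichlet_form \<Gamma> (dx_on \<Gamma>) (half_dirichlet \<Gamma> (H10 \<Gamma>)) \<and> F \<subseteq> H10 \<Gamma>"
proof -
  have "restrict (\<lambda>(u, v). 1/2 * dirichlet_integral \<Gamma> (u, v)) (H10 \<Gamma> \<times> H10 \<Gamma>) (u, v) =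
      restrict (\<lambda>(u, v). 1/2 * dirichlet_integral \<Gamma> (u, v)) (F \<times> F) (u, v)"
    if "F \<subseteq> H10 \<Gamma>" "u \<in> F" "v \<in> F" for u v using that by (auto simp: restrict_def)
  then show ?thesis
    unfolding absorbing_BM_form_eq half_dirichlet_def regular_subspace.simps by blast
qed

lemma regular_half_dirichletD:
  assumes "regular_dirichlet_form \<Gamma> (dx_on \<Gamma>) (half_dirichlet \<Gamma> F)"
  shows "markovian_form (dx_on \<Gamma>) F (dirichlet_integral \<Gamma>)"
    and "\<And>u \<epsilon>. u \<in> F \<Longrightarrow> \<epsilon> > 0 \<Longrightarrow> \<exists>w\<in>F \<inter> Cc \<Gamma>.
      energy \<Gamma> (\<lambda>x. u x - w x) < \<epsilon> \<and> mean_sq (dx_on \<Gamma>) (\<lambda>x. u x - w x) < \<epsilon>"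
    and "\<And>u \<epsilon>. u \<in> Cc \<Gamma> \<Longrightarrow> \<epsilon> > 0 \<Longrightarrow> \<exists>w\<in>F \<inter> Cc \<Gamma>. \<forall>x. \<bar>u x - w x\<bar> < \<epsilon>"
proof -
  let ?M = "dx_on \<Gamma>"
  define E where "E = restrict (\<lambda>(u, v). 1/2 * dirichlet_integral \<Gamma> (u, v)) (F \<times> F)"
  have E: "E (u, v) = 1/2 * dirichlet_integral \<Gamma> (u, v)" if "u \<in> F" "v \<in> F" for u v
    using that by (simp add: E_def)
  have R: "regular_dirichlet_form \<Gamma> ?M (E, F)" using assms unfolding half_dirichlet_def E_def .
  have R1: "\<forall>u\<in>F. \<forall>\<epsilon>>0. \<exists>w\<in>F \<inter> Cc \<Gamma>. form_norm ?M E (\<lambda>x. u x - w x) < \<epsilon>"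
    using R[unfolded regular_dirichlet_form.simps] by (elim conjE) assumption
  have R2: "\<forall>u\<in>Cc \<Gamma>. \<forall>\<epsilon>>0. \<exists>w\<in>F \<inter> Cc \<Gamma>. \<forall>x. \<bar>u x - w x\<bar> < \<epsilon>"
    using R[unfolded regular_dirichlet_form.simps] by (elim conjE) assumption
  from R interpret E: markovian_form ?M F E
    unfolding regular_dirichlet_form.simps by (intro dirichlet_form_imp_markovian_form) (rule conjunct1)
  show "markovian_form ?M F (dirichlet_integral \<Gamma>)"
    by (rule markovian_form_scale[OF E.markovian_form_axioms, of 2]) (simp_all add: E)
  show "\<exists>w\<in>F \<inter> Cc \<Gamma>. \<forall>x. \<bar>u x - w x\<bar> < \<epsilon>" if "u \<in> Cc \<Gamma>" "\<epsilon> > 0" for u \<epsilon>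
    using R2 that by blast
  show "\<exists>w\<in>F \<inter> Cc \<Gamma>. energy \<Gamma> (\<lambda>x. u x - w x) < \<epsilon> \<and>
      mean_sq ?M (\<lambda>x. u x - w x) < \<epsilon>" if u: "u \<in> F" and e: "\<epsilon> > 0" for u \<epsilon>
  proof -
    have e2: "\<epsilon> / 2 > 0" using e by simp
    then have "sqrt (\<epsilon> / 2) > 0" by simp
    then obtain w where w: "w \<in> F \<inter> Cc \<Gamma>" "form_norm ?M E (\<lambda>x. u x - w x) < sqrt (\<epsilon> / 2)"
      using R1 u by blast
    then have lt: "E (\<lambda>x. u x - w x, \<lambda>x. u x - w x) + mean_sq ?M (\<lambda>x. u x - w x) < \<epsilon> / 2"
      using E.E1_less_iff[OF e2] unfolding E.E1_apply by blast
    have d: "(\<lambda>x. u x - w x) \<in> F" using E.diff_mem[OF u] w by blast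
    show ?thesis
      using w(1) lt E[OF d d] E.nonneg[OF d] sq_int.nonneg[OF E.mem_sq_int[OF d]] e
      by (intro bexI[of _ w]) linarith+
  qed
qed

lemma regular_half_dirichletI:
  assumes mf: "markovian_form (dx_on \<Gamma>) F (dirichlet_integral \<Gamma>)"
    and dense: "\<And>w \<epsilon>. w \<in> sq_int (dx_on \<Gamma>) \<Longrightarrow> \<epsilon> > 0 \<Longrightarrow> \<exists>u\<in>F. mean_sq (dx_on \<Gamma>) (\<lambda>x. w x - u x) < \<epsilon>"
    and core: "\<And>u \<epsilon>. u \<in> F \<Longrightarrow> \<epsilon> > 0 \<Longrightarrow> \<exists>w\<in>F \<inter> Cc \<Gamma>. form_norm (dx_on \<Gamma>) (dirichlet_integral \<Gamma>) (\<lambda>x. u x - w x) < \<epsilon>"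
    and unif: "\<And>u \<epsilon>. u \<in> Cc \<Gamma> \<Longrightarrow> \<epsilon> > 0 \<Longrightarrow> \<exists>w\<in>F \<inter> Cc \<Gamma>. \<forall>x. \<bar>u x - w x\<bar> < \<epsilon>"
  shows "regular_dirichlet_form \<Gamma> (dx_on \<Gamma>) (half_dirichlet \<Gamma> F)"
proof -
  let ?M = "dx_on \<Gamma>"
  define E where "E = restrict (\<lambda>(u, v). 1/2 * dirichlet_integral \<Gamma> (u, v)) (F \<times> F)"
  have E: "E (u, v) = 1/2 * dirichlet_integral \<Gamma> (u, v)" if "u \<in> F" "v \<in> F" for u v
    using that by (simp add: E_def)
  interpret D: markovian_form ?M F "dirichlet_integral \<Gamma>" by (rule mf)
  have "markovian_form ?M F E" by (rule markovian_form_scale[OF mf, of "1/2"]) (simp_all add: E)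
  then have df: "dirichlet_form ?M (E, F)"
    by (rule dirichlet_formI[OF _ _ dense]) (auto simp: E_def)
  have "\<exists>w\<in>F \<inter> Cc \<Gamma>. form_norm ?M E (\<lambda>x. u x - w x) < \<epsilon>" if u: "u \<in> F" and e: "\<epsilon> > 0" for u \<epsilon>
  proof -
    obtain w where w: "w \<in> F \<inter> Cc \<Gamma>" "form_norm ?M (dirichlet_integral \<Gamma>) (\<lambda>x. u x - w x) < \<epsilon>"
      using core[OF u e] by blast
    have d: "(\<lambda>x. u x - w x) \<in> F" using D.diff_mem[OF u] w by blast
    have "form_norm ?M E (\<lambda>x. u x - w x) \<le> form_norm ?M (dirichlet_integral \<Gamma>) (\<lambda>x. u x - w x)"
      unfolding form_norm_def E[OF d d] using D.nonneg[OF d] by (intro real_sqrt_le_mono) simp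
    with w show ?thesis by (intro bexI[of _ w]) auto
  qed
  with df unif have "regular_dirichlet_form \<Gamma> ?M (E, F)" unfolding regular_dirichlet_form.simps by blast
  then show ?thesis unfolding half_dirichlet_def E_def .
qed

lemma regular_half_dirichlet_core:
  assumes "regular_dirichlet_form \<Gamma> (dx_on \<Gamma>) (half_dirichlet \<Gamma> F)" "u \<in> F"
  obtains w where "\<And>n::nat. w n \<in> F \<inter> Cc \<Gamma>"
    "energy_conv \<Gamma> w u"
    "mean_conv (dx_on \<Gamma>) w u"
proof -
  interpret D: markovian_form "dx_on \<Gamma>" F "dirichlet_integral \<Gamma>" by (rule regular_half_dirichletD(1)[OF assms(1)])
  have "\<forall>n. \<exists>w. w \<in> F \<inter> Cc \<Gamma> \<and> energy \<Gamma> (\<lambda>x. u x - w x) < 1 / real (Suc n) \<and>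
      mean_sq (dx_on \<Gamma>) (\<lambda>x. u x - w x) < 1 / real (Suc n)"
    using regular_half_dirichletD(2)[OF assms, of "1 / real (Suc n)" for n] by (simp add: Bex_def)
  from choice[OF this] obtain w where w: "\<And>n. w n \<in> F \<inter> Cc \<Gamma>"
    "\<And>n. energy \<Gamma> (\<lambda>x. u x - w n x) < 1 / real (Suc n)"
    "\<And>n. mean_sq (dx_on \<Gamma>) (\<lambda>x. u x - w n x) < 1 / real (Suc n)" by blast
  have wF: "w n \<in> F" for n using w(1) by blast
  have inv: "(\<lambda>n. 1 / real (Suc n)) \<longlonglongrightarrow> 0" by (intro LIMSEQ_Suc lim_1_over_n)
  have "energy_conv \<Gamma> w u"
  proof (rule Lim_null_comparison[OF _ inv], intro always_eventually allI)
    fix n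
    show "norm (energy \<Gamma> (\<lambda>x. w n x - u x)) \<le> 1 / real (Suc n)"
      using w(2)[of n] D.nonneg[OF D.diff_mem[OF wF[of n] assms(2)]] D.sq_diff_commute[OF wF[of n] assms(2)]
      by (simp del: of_nat_Suc)
  qed
  moreover have "mean_conv (dx_on \<Gamma>) w u"
  proof (rule Lim_null_comparison[OF _ inv], intro always_eventually allI)
    fix n
    show "norm (mean_sq (dx_on \<Gamma>) (\<lambda>x. w n x - u x)) \<le> 1 / real (Suc n)"
      using w(3)[of n] sq_int.sq_diff_commute[OF D.mem_sq_int[OF wF[of n]] D.mem_sq_int[OF assms(2)]]
      by (simp add: sq_inner_self del: of_nat_Suc)
  qed
  ultimately show ?thesis using that w(1) by blast
qed

context conformal begin

definition pulled_core :: "(complex \<Rightarrow> real) set \<Rightarrow> (complex \<Rightarrow> real) set" where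
  "pulled_core F = pull f U ` (F \<inter> Cc V)"

definition pulled_domain :: "(complex \<Rightarrow> real) set \<Rightarrow> (complex \<Rightarrow> real) set" where
  "pulled_domain F = L2_form.form_closure (dx_on U) (H10 U) (dirichlet_integral U) (pulled_core F)"

lemma pull_pull': "u \<in> Cc U \<Longrightarrow> pull f U (pull g V u) = u"
  using conformal.pull_pull[OF conformal_sym] conformal_axioms by blast

lemma pull_back_Cc: "u \<in> Cc U \<Longrightarrow> pull g V u \<in> Cc V"
  using conformal.pull_Cc[OF conformal_sym] conformal_axioms by blast

text \<open>The core is a linear space that is stable under the unit contraction, since composition with \<open>f\<close>
  commutes with these operations and preserves energies.  Approximating a continuous function with
  compact support uniformly by the core does not control supports, hence not L2 distances; subtracting
  from an approximation its truncation at the level of the error repairs this.  Then a function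
  orthogonal to the core is orthogonal to all test functions, hence zero.\<close>

lemma regular_pulled_domain:
  assumes R: "regular_dirichlet_form V (dx_on V) (half_dirichlet V F)" and sub: "F \<subseteq> H10 V"
  shows "regular_dirichlet_form U (dx_on U) (half_dirichlet U (pulled_domain F))"
    and "pulled_domain F \<subseteq> H10 U" and "pulled_core F \<subseteq> pulled_domain F \<inter> Cc U"
proof -
  let ?D = "dirichlet_integral U" and ?M = "dx_on U"
  interpret HU: closed_form ?M "H10 U" ?D by (rule closed_form_H10[OF open_dom])
  interpret FV: markovian_form "dx_on V" F "dirichlet_integral V" by (rule regular_half_dirichletD(1)[OF R])
  let ?C = "pulled_core F"
  have CH: "?C \<subseteq> H10 U" using pull_H10 sub unfolding pulled_core_def by blast
  have CCc: "?C \<subseteq> Cc U" using pull_Cc unfolding pulled_core_def by blast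
  have C_zero: "(\<lambda>x. 0) \<in> ?C"
    unfolding pulled_core_def using FV.zero_mem pull_zero Cc_infinity_subset_Cc Cc_infinity_zero
    by (intro image_eqI[of _ _ "\<lambda>x. 0"]) (auto simp: subset_iff)
  have C_add: "(\<lambda>x. u x + v x) \<in> ?C" if uv: "u \<in> ?C" "v \<in> ?C" for u v
  proof -
    obtain a b where "u = pull f U a" "v = pull f U b" "a \<in> F \<inter> Cc V" "b \<in> F \<inter> Cc V"
      using uv unfolding pulled_core_def by blast
    then show ?thesis unfolding pulled_core_def
      by (intro image_eqI[of _ _ "\<lambda>x. a x + b x"]) (auto simp: pull_add intro: FV.add_mem Cc_add)
  qed
  have C_scale: "(\<lambda>x. c * u x) \<in> ?C" if u: "u \<in> ?C" for u c
  proof -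
    obtain a where "u = pull f U a" "a \<in> F \<inter> Cc V" using u unfolding pulled_core_def by blast
    then show ?thesis unfolding pulled_core_def using FV.scale_mem[of a c]
      by (intro image_eqI[of _ _ "\<lambda>x. c * a x"]) (auto simp: pull_scale intro: Cc_scale)
  qed
  have C_mid: "(\<lambda>x. (1/2) * (u x + v x)) \<in> ?C" if "u \<in> ?C" "v \<in> ?C" for u v
    by (rule C_scale[OF C_add[OF that]])
  have C_markov: "(\<lambda>x. min (max 0 (u x)) 1) \<in> ?C \<and>
      ?D (\<lambda>x. min (max 0 (u x)) 1, \<lambda>x. min (max 0 (u x)) 1) \<le> ?D (u, u)" if u: "u \<in> ?C" for u
  proof -
    obtain a where a: "u = pull f U a" "a \<in> F" "a \<in> Cc V" using u unfolding pulled_core_def by blast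
    define b where "b x = min (max 0 (a x)) 1" for x
    have b: "b \<in> F" "energy V b \<le> energy V a"
      using FV.markov_mem[OF a(2)] FV.markov_le[OF a(2)] unfolding b_def by auto
    have bC: "b \<in> Cc V" unfolding b_def
      by (rule Cc_comp[OF a(3), where h = "\<lambda>t. min (max 0 t) 1"]) (auto intro!: continuous_intros)
    have eq: "(\<lambda>x. min (max 0 (u x)) 1) = pull f U b" unfolding a(1) b_def pull_def by auto
    have "?D (pull f U b, pull f U b) = energy V b"
      "?D (u, u) = energy V a"
      unfolding a(1) using sub a b bC by (auto intro!: dirichlet_integral_pull)
    then show ?thesis unfolding eq using b bC unfolding pulled_core_def by auto
  qed
  have unif: "\<exists>w\<in>?C. \<forall>x. \<bar>u x - w x\<bar> < \<epsilon>" if u: "u \<in> Cc U" and e: "\<epsilon> > 0" for u \<epsilon>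
  proof -
    obtain a where a: "a \<in> F \<inter> Cc V" "\<And>y. \<bar>pull g V u y - a y\<bar> < \<epsilon>"
      using regular_half_dirichletD(3)[OF R pull_back_Cc[OF u] e] by blast
    have "\<bar>pull f U (pull g V u) x - pull f U a x\<bar> < \<epsilon>" for x
      using a(2)[of "f x"] e by (auto simp: pull_def)
    then show ?thesis using a(1) unfolding pull_pull'[OF u] pulled_core_def by blast
  qed
  have dom: "pulled_domain F = HU.form_closure ?C" by (simp add: pulled_domain_def)
  show sub': "pulled_domain F \<subseteq> H10 U" unfolding dom by (rule HU.form_closure_sub)
  have base: "?C \<subseteq> pulled_domain F" unfolding dom using HU.form_closure_base[OF CH] by blast
  with CCc show core: "?C \<subseteq> pulled_domain F \<inter> Cc U" by blast
  have closed: "closed_form ?M (pulled_domain F) ?D"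
    unfolding dom by (rule HU.closed_form_form_closure[OF CH C_zero C_add C_scale])
  have mf: "markovian_form ?M (pulled_domain F) ?D"
  proof (intro markovian_form.intro closed markovian_form_axioms.intro)
    fix u assume "u \<in> pulled_domain F"
    then have u: "u \<in> HU.form_closure ?C" unfolding dom .
    note m = HU.form_closure_markov[OF CH C_mid C_markov[THEN conjunct1] C_markov[THEN conjunct2] u]
    show "(\<lambda>x. min (max 0 (u x)) 1) \<in> pulled_domain F" unfolding dom by (rule m(1))
    show "?D (\<lambda>x. min (max 0 (u x)) 1, \<lambda>x. min (max 0 (u x)) 1) \<le> ?D (u, u)" by (rule m(2))
  qed
  \<comment> \<open>Soft thresholding turns a uniform approximation into one with controlled support.\<close>
  have thresh: "\<exists>w\<in>?C. (\<forall>x. \<bar>w x - u x\<bar> \<le> 2 * \<epsilon>) \<and> (\<forall>x. u x = 0 \<longrightarrow> w x = 0)"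
    if u: "u \<in> Cc U" and e: "\<epsilon> > 0" for u \<epsilon>
  proof -
    obtain c where c: "c \<in> ?C" "\<And>x. \<bar>u x - c x\<bar> < \<epsilon>" using unif[OF u e] by blast
    define t :: "real \<Rightarrow> real" where "t a = min (max 0 a) 1" for a
    \<comment> \<open>The contractions of the two multiples of \<open>c\<close> combine to its truncation to \<open>[-\<epsilon>, \<epsilon>]\<close>.\<close>
    define w where "w x = c x + ((-\<epsilon>) * t ((1/\<epsilon>) * c x) + \<epsilon> * t ((-1/\<epsilon>) * c x))" for x
    have "w \<in> ?C" unfolding w_def t_def
      by (intro C_add C_scale c(1) C_markov[THEN conjunct1])
    moreover have w_eq: "w x = (if c x > \<epsilon> then c x - \<epsilon> else if c x < - \<epsilon> then c x + \<epsilon> else 0)" for x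
      using e unfolding w_def t_def by (auto simp: min_def max_def field_simps)
    have "\<bar>w x - u x\<bar> \<le> 2 * \<epsilon>" for x using c(2)[of x] e unfolding w_eq by (auto simp: abs_if split: if_splits)
    moreover have "w x = 0" if "u x = 0" for x using c(2)[of x] that unfolding w_eq by auto
    ultimately show ?thesis by blast
  qed
  have orth: "AE x in ?M. h x = 0" if h: "h \<in> sq_int ?M" "\<forall>u\<in>?C. sq_inner ?M (h, u) = 0" for h
  proof (rule AE_zero_if_orthogonal[OF open_dom h(1)])
    fix \<phi> assume \<phi>: "\<phi> \<in> Cc_infinity U"
    then have \<phi>C: "\<phi> \<in> Cc U" using Cc_infinity_subset_Cc by blast
    obtain K where K: "compact K" "\<And>x. x \<notin> K \<Longrightarrow> \<phi> x = 0" using Cc_infinityE[OF \<phi>] by metis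
    have "\<exists>w\<in>?C. (\<forall>x. \<bar>w x - \<phi> x\<bar> \<le> 2 * (1 / real (Suc n))) \<and> (\<forall>x. \<phi> x = 0 \<longrightarrow> w x = 0)" for n
      by (rule thresh[OF \<phi>C]) simp
    then obtain w where w: "\<And>n. w n \<in> ?C" "\<And>n x. \<bar>w n x - \<phi> x\<bar> \<le> 2 * (1 / real (Suc n))"
        "\<And>n x. \<phi> x = 0 \<Longrightarrow> w n x = 0" by metis
    have wL: "w n \<in> sq_int ?M" for n using w(1) CH HU.mem_sq_int by blast
    have \<phi>L: "\<phi> \<in> sq_int ?M" by (rule Cc_infinity_sq_int[OF open_dom \<phi>])
    have KL: "(\<lambda>x. 2 * indicator K x :: real) \<in> sq_int ?M"
    proof (rule sq_int_compact_support[OF open_dom K(1), where B = 2])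
      show "(\<lambda>x. 2 * indicator K x :: real) \<in> borel_measurable ?M"
        by (intro measurable_dx_on_borel borel_measurable_times borel_measurable_const
            borel_measurable_indicator borel_compact K(1))
    qed (auto split: split_indicator)
    have "(\<lambda>n. mean_sq ?M (\<lambda>x. w n x - \<phi> x)) \<longlonglongrightarrow> 0"
    proof (rule sq_int_dominated_tendsto_0[OF _ KL])
      show "(\<lambda>x. w n x - \<phi> x) \<in> borel_measurable ?M" for n
        using sq_int_measurable[OF sq_int.diff_mem[OF wL \<phi>L]] .
      show "AE x in ?M. norm (w n x - \<phi> x) \<le> norm (2 * indicator K x :: real)" for n
      proof (rule AE_I2)
        fix x
        have "1 / real (Suc n) \<le> 1" by simp
        then have "\<bar>w n x - \<phi> x\<bar> \<le> 2" using w(2)[of n x] by linarith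
        then show "norm (w n x - \<phi> x) \<le> norm (2 * indicator K x :: real)"
          using K(2)[of x] w(3)[of x n] by (cases "x \<in> K") auto
      qed
      have "(\<lambda>n. w n x - \<phi> x) \<longlonglongrightarrow> 0" for x
      proof (rule Lim_null_comparison)
        show "\<forall>\<^sub>F n in sequentially. norm (w n x - \<phi> x) \<le> 2 * (1 / real (Suc n))" using w(2) by simp
        have "(\<lambda>n. 2 * (1 / real (Suc n))) \<longlonglongrightarrow> 2 * 0" by (intro tendsto_intros LIMSEQ_Suc lim_1_over_n)
        then show "(\<lambda>n. 2 * (1 / real (Suc n))) \<longlonglongrightarrow> 0" by simp
      qed
      then show "AE x in ?M. (\<lambda>n. w n x - \<phi> x) \<longlonglongrightarrow> 0" by simp
    qed
    from sq_int.tendsto_form_right[OF wL \<phi>L h(1) this]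
    have "(\<lambda>n. sq_inner ?M (w n, h)) \<longlonglongrightarrow> sq_inner ?M (\<phi>, h)" .
    moreover have "sq_inner ?M (w n, h) = 0" for n using h(2) w(1) sq_int.sym[OF wL h(1)] by simp
    ultimately have "sq_inner ?M (\<phi>, h) = 0" by (simp add: LIMSEQ_const_iff)
    then show "(\<integral>x. h x * \<phi> x \<partial>?M) = 0" by (simp add: sq_inner_def mult.commute)
  qed
  have "\<exists>u\<in>?C. mean_sq ?M (\<lambda>x. w x - u x) < \<epsilon>" if "w \<in> sq_int ?M" "\<epsilon> > 0" for w \<epsilon>
    using CH HU.sub_sq_int C_zero C_add C_scale orth that by (intro sq_int_denseI) auto
  then have dense: "\<exists>u\<in>pulled_domain F. mean_sq ?M (\<lambda>x. w x - u x) < \<epsilon>"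
    if "w \<in> sq_int ?M" "\<epsilon> > 0" for w \<epsilon> using that base by blast
  show "regular_dirichlet_form U (dx_on U) (half_dirichlet U (pulled_domain F))"
  proof (rule regular_half_dirichletI[OF mf dense])
    show "\<exists>w\<in>pulled_domain F \<inter> Cc U. form_norm ?M ?D (\<lambda>x. u x - w x) < \<epsilon>"
      if "u \<in> pulled_domain F" "\<epsilon> > 0" for u \<epsilon>
      using that core unfolding dom HU.form_closure_def by blast
    show "\<exists>w\<in>pulled_domain F \<inter> Cc U. \<forall>x. \<bar>u x - w x\<bar> < \<epsilon>" if "u \<in> Cc U" "\<epsilon> > 0" for u \<epsilon>
      using unif[OF that] core by blast
  qed
qed

lemma pulled_domain_H10: "pulled_domain (H10 V) = H10 U"
proof
  interpret HU: closed_form "dx_on U" "H10 U" "dirichlet_integral U" by (rule closed_form_H10[OF open_dom])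
  show "pulled_domain (H10 V) \<subseteq> H10 U" unfolding pulled_domain_def by (rule HU.form_closure_sub)
  have CH: "pulled_core (H10 V) \<subseteq> H10 U" using pull_H10 unfolding pulled_core_def by blast
  show "H10 U \<subseteq> pulled_domain (H10 V)"
  proof
    fix u assume u: "u \<in> H10 U"
    obtain \<phi> where \<phi>: "\<And>n::nat. \<phi> n \<in> Cc_infinity U"
      "energy_conv U \<phi> u"
      "mean_conv (dx_on U) \<phi> u"
      using H10_approx[OF open_dom u] by blast
    have "\<phi> n \<in> pulled_core (H10 V)" for n
    proof -
      have "pull g V (\<phi> n) \<in> Cc_infinity V"
        using conformal.pull_Cc_infinity[OF conformal_sym[OF conformal_axioms] \<phi>(1)] .
      then have "pull g V (\<phi> n) \<in> H10 V \<inter> Cc V"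
        using Cc_infinity_subset_H10[OF open_ran] Cc_infinity_subset_Cc by blast
      moreover have "\<phi> n = pull f U (pull g V (\<phi> n))"
        using pull_pull' \<phi>(1)[of n] Cc_infinity_subset_Cc by (metis subsetD)
      ultimately show ?thesis unfolding pulled_core_def by blast
    qed
    then show "u \<in> pulled_domain (H10 V)"
      unfolding pulled_domain_def by (rule HU.form_closureI[OF CH u _ \<phi>(2,3)])
  qed
qed

end

section \<open>The conformal transformation of regular subspaces\<close>

context conformal begin

text \<open>Approximating sequences for the extended domain of the transformed form, pulled back to \<open>U\<close>.\<close>

definition approx_seq :: "(complex \<Rightarrow> real) set \<Rightarrow> (nat \<Rightarrow> complex \<Rightarrow> real) \<Rightarrow> (complex \<Rightarrow> real) \<Rightarrow> bool" where
  "approx_seq F us u \<longleftrightarrow> (\<forall>n. us n \<in> borel_measurable (dx_on V)) \<and> (\<forall>n. (\<lambda>x. us n (f x)) \<in> F) \<and>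
    psd_form.Cauchy_seq (dirichlet_integral U) (\<lambda>n x. us n (f x)) \<and>
    (AE x in dx_on U. (\<lambda>n. us n (f x)) \<longlonglongrightarrow> u (f x))"

lemma sets_image_measure: "sets (image_measure f U V) = sets (dx_on V)"
  by (simp add: image_measure_def sets_dx_on)

lemma measurable_image_measure: "borel_measurable (image_measure f U V) = borel_measurable (dx_on V)"
  by (rule measurable_cong_sets[OF sets_image_measure refl])

lemma image_measure_eq: "image_measure f U V = distr (dx_on U) (dx_on V) f"
  unfolding image_measure_def by (rule distr_cong) (auto simp: sets_dx_on)

lemma AE_image_measure_tendsto:
  fixes us :: "nat \<Rightarrow> complex \<Rightarrow> real"
  assumes [measurable]: "\<And>n. us n \<in> borel_measurable (dx_on V)" "u \<in> borel_measurable (dx_on V)"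
  shows "(AE x in image_measure f U V. (\<lambda>n. us n x) \<longlonglongrightarrow> u x) \<longleftrightarrow>
    (AE x in dx_on U. (\<lambda>n. us n (f x)) \<longlonglongrightarrow> u (f x))"
proof -
  have "Measurable.pred (dx_on V) (\<lambda>x. (\<lambda>n. us n x - u x) \<longlonglongrightarrow> 0)" by measurable
  then have "{x \<in> space (dx_on V). (\<lambda>n. us n x) \<longlonglongrightarrow> u x} \<in> sets (dx_on V)"
    by (simp add: pred_def LIM_zero_iff)
  from AE_distr_iff[OF measurable_f this] show ?thesis unfolding image_measure_eq .
qed

lemma transformed_domain:
  assumes "F \<subseteq> sq_int (dx_on U)"
  shows "{u \<in> L2 (image_measure f U V). u \<circ> f \<in> F} = {u \<in> borel_measurable (dx_on V). (\<lambda>x. u (f x)) \<in> F}"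
proof -
  have "integrable (image_measure f U V) (\<lambda>x. (u x)\<^sup>2)"
    if u: "u \<in> borel_measurable (dx_on V)" "(\<lambda>x. u (f x)) \<in> F" for u
  proof -
    have "(\<lambda>x. u (f x)) \<in> sq_int (dx_on U)" using u(2) assms by blast
    from sq_int_norm_sq[OF this] have "integrable (dx_on U) (\<lambda>x. (u (f x))\<^sup>2)" by simp
    moreover have "(\<lambda>x. (u x)\<^sup>2) \<in> borel_measurable (dx_on V)" using u(1) by measurable
    ultimately show ?thesis
      unfolding image_measure_eq using integrable_distr_eq[OF measurable_f, of "\<lambda>x. (u x)\<^sup>2"] by simp
  qed
  then show ?thesis unfolding L2_def measurable_image_measure by (auto simp: comp_def)
qed

lemma approximates_iff:
  assumes F: "markovian_form (dx_on U) F (dirichlet_integral U)" and u: "u \<in> borel_measurable (dx_on V)"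
  shows "approximates (image_measure f U V) (spatial_transform f (image_measure f U V) (half_dirichlet U F)) us u \<longleftrightarrow>
    approx_seq F us u"
proof -
  interpret F: markovian_form "dx_on U" F "dirichlet_integral U" by (rule F)
  let ?m = "image_measure f U V"
  define G where "G = {u \<in> L2 ?m. u \<circ> f \<in> F}"
  define E where "E = restrict (\<lambda>(u, v). fst (half_dirichlet U F) (u \<circ> f, v \<circ> f)) (G \<times> G)"
  have tr: "spatial_transform f ?m (half_dirichlet U F) = (E, G)"
    unfolding E_def G_def half_dirichlet_def spatial_transform.simps Let_def fst_conv ..
  have G: "G = {u \<in> borel_measurable (dx_on V). (\<lambda>x. u (f x)) \<in> F}"
    unfolding G_def by (rule transformed_domain[OF F.sub_sq_int])
  have "approximates ?m (E, G) us u \<longleftrightarrow> approx_seq F us u"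
  proof (cases "\<forall>n. us n \<in> G")
    case False
    then show ?thesis unfolding approximates.simps approx_seq_def G by blast
  next
    case True
    then have usm: "us n \<in> borel_measurable (dx_on V)" and usF: "(\<lambda>x. us n (f x)) \<in> F" for n
      unfolding G by auto
    have dF: "(\<lambda>x. us k (f x) - us n (f x)) \<in> F" for k n by (rule F.diff_mem[OF usF usF])
    have dG: "(\<lambda>x. us k x - us n x) \<in> G" for k n unfolding G using usm[of k] usm[of n] dF by auto
    have E: "E (\<lambda>x. us k x - us n x, \<lambda>x. us k x - us n x) =
        1/2 * energy U (\<lambda>x. us k (f x) - us n (f x))" for k n
      using dG[of k n] dF[of k n] by (simp add: E_def half_dirichlet_def comp_def)
    have C: "(\<forall>\<epsilon>>0. \<exists>N. \<forall>k\<ge>N. \<forall>n\<ge>N. E (\<lambda>x. us k x - us n x, \<lambda>x. us k x - us n x) < \<epsilon>) \<longleftrightarrow>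
        F.Cauchy_seq (\<lambda>n x. us n (f x))" (is "?L \<longleftrightarrow> ?R")
    proof
      assume L: ?L
      show ?R unfolding F.Cauchy_seq_def
      proof (intro allI impI)
        fix \<epsilon> :: real assume "\<epsilon> > 0"
        then have "\<epsilon> / 2 > 0" by simp
        then obtain N where "\<forall>k\<ge>N. \<forall>n\<ge>N. E (\<lambda>x. us k x - us n x, \<lambda>x. us k x - us n x) < \<epsilon> / 2"
          using L by blast
        then show "\<exists>N. \<forall>m\<ge>N. \<forall>n\<ge>N. energy U (\<lambda>x. us m (f x) - us n (f x)) < \<epsilon>"
          unfolding E by (intro exI[of _ N]) simp
      qed
    next
      assume R: ?R
      show ?L
      proof (intro allI impI)
        fix \<epsilon> :: real assume "\<epsilon> > 0"
        then obtain N where N: "\<forall>m\<ge>N. \<forall>n\<ge>N. energy U (\<lambda>x. us m (f x) - us n (f x)) < \<epsilon>"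
          using R unfolding F.Cauchy_seq_def by blast
        show "\<exists>N. \<forall>k\<ge>N. \<forall>n\<ge>N. E (\<lambda>x. us k x - us n x, \<lambda>x. us k x - us n x) < \<epsilon>"
        proof (intro exI[of _ N] allI impI)
          fix k n assume "k \<ge> N" "n \<ge> N"
          then show "E (\<lambda>x. us k x - us n x, \<lambda>x. us k x - us n x) < \<epsilon>"
            unfolding E using N F.nonneg[OF dF[of k n]] by fastforce
        qed
      qed
    qed
    have "(AE x in ?m. (\<lambda>n. us n x) \<longlonglongrightarrow> u x) \<longleftrightarrow> (AE x in dx_on U. (\<lambda>n. us n (f x)) \<longlonglongrightarrow> u (f x))"
      by (rule AE_image_measure_tendsto[OF usm u])
    with True C usm usF show ?thesis unfolding approximates.simps approx_seq_def by blast
  qed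
  then show ?thesis unfolding tr .
qed

text \<open>The spatial transformation and the time change written out as conditions on \<open>U\<close>, where the image
  measure has disappeared.\<close>

lemma transform_half_dirichlet:
  assumes F: "markovian_form (dx_on U) F (dirichlet_integral U)"
  defines "G \<equiv> {u \<in> sq_int (dx_on V). \<exists>us. approx_seq F us u}"
  shows "transform_and_time_change f U V (half_dirichlet U F) =
    (restrict (\<lambda>(u, v). THE e. \<exists>us vs. approx_seq F us u \<and> approx_seq F vs v \<and>
      (\<lambda>n. 1/2 * dirichlet_integral U (\<lambda>x. us n (f x), \<lambda>x. vs n (f x))) \<longlonglongrightarrow> e) (G \<times> G), G)"
proof -
  interpret F: markovian_form "dx_on U" F "dirichlet_integral U" by (rule F)
  let ?m = "image_measure f U V"
  let ?A = "spatial_transform f ?m (half_dirichlet U F)"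
  have dom: "extended_domain ?m ?A \<inter> L2 (dx_on V) = G"
    using approximates_iff[OF F] unfolding extended_domain_def G_def measurable_image_measure L2_eq_sq_int
    by (auto dest: sq_int_measurable)
  have val: "fst ?A (us n, vs n) = 1/2 * dirichlet_integral U (\<lambda>x. us n (f x), \<lambda>x. vs n (f x))"
    if "approx_seq F us u" "approx_seq F vs v" for us vs u v n
  proof -
    have "us n \<in> {u \<in> L2 ?m. u \<circ> f \<in> F}" "vs n \<in> {u \<in> L2 ?m. u \<circ> f \<in> F}"
      using that unfolding transformed_domain[OF F.sub_sq_int] approx_seq_def by auto
    then show ?thesis by (simp add: half_dirichlet_def comp_def Let_def)
  qed
  have ext: "extended_form ?m ?A (u, v) = (THE e. \<exists>us vs. approx_seq F us u \<and> approx_seq F vs v \<and>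
      (\<lambda>n. 1/2 * dirichlet_integral U (\<lambda>x. us n (f x), \<lambda>x. vs n (f x))) \<longlonglongrightarrow> e)" if "u \<in> G" "v \<in> G" for u v
  proof -
    have uv: "u \<in> borel_measurable (dx_on V)" "v \<in> borel_measurable (dx_on V)"
      using that sq_int_measurable unfolding G_def by auto
    have "(approx_seq F us u \<and> approx_seq F vs v \<and> (\<lambda>n. fst ?A (us n, vs n)) \<longlonglongrightarrow> e) \<longleftrightarrow>
        (approx_seq F us u \<and> approx_seq F vs v \<and>
         (\<lambda>n. 1/2 * dirichlet_integral U (\<lambda>x. us n (f x), \<lambda>x. vs n (f x))) \<longlonglongrightarrow> e)" for us vs e
      using val[of us u vs v] by (intro conj_cong refl) (simp only:)
    then show ?thesis
      unfolding extended_form_def prod.case approximates_iff[OF F uv(1)] approximates_iff[OF F uv(2)] by simp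
  qed
  have "restrict (extended_form ?m ?A) (G \<times> G) = restrict (\<lambda>(u, v). THE e. \<exists>us vs. approx_seq F us u \<and> approx_seq F vs v \<and>
      (\<lambda>n. 1/2 * dirichlet_integral U (\<lambda>x. us n (f x), \<lambda>x. vs n (f x))) \<longlonglongrightarrow> e) (G \<times> G)"
    by (rule restrict_ext) (use ext in auto)
  then show ?thesis unfolding transform_and_time_change_def time_change_def dom Let_def by simp
qed

lemma comp_mem_iff:
  assumes F: "markovian_form (dx_on U) F (dirichlet_integral U)" and w: "w \<in> borel_measurable (dx_on V)"
  shows "(\<lambda>x. w (f x)) \<in> F \<longleftrightarrow> pull f U w \<in> F"
proof -
  interpret F: markovian_form "dx_on U" F "dirichlet_integral U" by (rule F)
  have ae: "AE x in dx_on U. w (f x) = pull f U w x" by (rule AE_I2) (simp add: space_dx_on pull_def)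
  then have ae': "AE x in dx_on U. pull f U w x = w (f x)" by eventually_elim simp
  show ?thesis
    using F.AE_mem[OF _ pull_measurable[OF w] ae] F.AE_mem[OF _ measurable_comp[OF w] ae'] by blast
qed

text \<open>The difference of two approximating sequences of the same function tends to zero almost
  everywhere, and zero is square integrable: so its energy tends to zero.\<close>

lemma approx_seq_unique:
  assumes F: "markovian_form (dx_on U) F (dirichlet_integral U)"
    and "approx_seq F us u" "approx_seq F us' u" "approx_seq F vs v" "approx_seq F vs' v"
    and "(\<lambda>n. 1/2 * dirichlet_integral U (\<lambda>x. us n (f x), \<lambda>x. vs n (f x))) \<longlonglongrightarrow> e"
      "(\<lambda>n. 1/2 * dirichlet_integral U (\<lambda>x. us' n (f x), \<lambda>x. vs' n (f x))) \<longlonglongrightarrow> e'"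
  shows "e = e'"
proof -
  interpret F: markovian_form "dx_on U" F "dirichlet_integral U" by (rule F)
  have diff0: "(\<lambda>n. F.sq (\<lambda>x. us n (f x) - us' n (f x))) \<longlonglongrightarrow> 0"
    if "approx_seq F us u" "approx_seq F us' u" for us us' u
  proof -
    let ?d = "\<lambda>n x. us n (f x) - us' n (f x)"
    have usF: "(\<lambda>x. us n (f x)) \<in> F" "(\<lambda>x. us' n (f x)) \<in> F" for n using that unfolding approx_seq_def by blast+
    have C: "F.Cauchy_seq (\<lambda>n x. us n (f x))" "F.Cauchy_seq (\<lambda>n x. us' n (f x))"
      using that unfolding approx_seq_def by blast+
    have dF: "?d n \<in> F" for n by (rule F.diff_mem[OF usF])
    have "F.Cauchy_seq ?d" by (rule F.Cauchy_seq_diff[OF usF C])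
    moreover have "AE x in dx_on U. (\<lambda>n. us n (f x)) \<longlonglongrightarrow> u (f x)" "AE x in dx_on U. (\<lambda>n. us' n (f x)) \<longlonglongrightarrow> u (f x)"
      using that unfolding approx_seq_def by blast+
    then have "AE x in dx_on U. (\<lambda>n. ?d n x) \<longlonglongrightarrow> 0"
    proof eventually_elim
      case (elim x)
      from tendsto_diff[OF this] show ?case by simp
    qed
    ultimately have "(\<lambda>n. F.sq (\<lambda>x. ?d n x - 0)) \<longlonglongrightarrow> 0"
      by (intro F.extended_limit(2)[where us = ?d, OF dF] sq_int.zero_mem)
    then show ?thesis by simp
  qed
  have F': "(\<lambda>x. us n (f x)) \<in> F" "(\<lambda>x. us' n (f x)) \<in> F" "(\<lambda>x. vs n (f x)) \<in> F" "(\<lambda>x. vs' n (f x)) \<in> F" for n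
    using assms(2-5) unfolding approx_seq_def by blast+
  have C: "F.Cauchy_seq (\<lambda>n x. us n (f x))" "F.Cauchy_seq (\<lambda>n x. vs' n (f x))"
    using assms(2,5) unfolding approx_seq_def by blast+
  obtain K K' where "\<And>n. F.sq (\<lambda>x. us n (f x)) \<le> K" "\<And>n. F.sq (\<lambda>x. vs' n (f x)) \<le> K'"
    using F.Cauchy_seq_bounded[of "\<lambda>n x. us n (f x)", OF F'(1) C(1)]
      F.Cauchy_seq_bounded[of "\<lambda>n x. vs' n (f x)", OF F'(4) C(2)] by metis
  from F.tendsto_diff_forms[of "\<lambda>n x. us n (f x)" "\<lambda>n x. us' n (f x)" "\<lambda>n x. vs n (f x)" "\<lambda>n x. vs' n (f x)",
      OF F' diff0[OF assms(2,3)] diff0[OF assms(4,5)] this]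
  have "(\<lambda>n. 1/2 * (dirichlet_integral U (\<lambda>x. us n (f x), \<lambda>x. vs n (f x)) -
      dirichlet_integral U (\<lambda>x. us' n (f x), \<lambda>x. vs' n (f x)))) \<longlonglongrightarrow> 1/2 * 0" by (intro tendsto_intros)
  moreover have "(\<lambda>n. 1/2 * (dirichlet_integral U (\<lambda>x. us n (f x), \<lambda>x. vs n (f x)) -
      dirichlet_integral U (\<lambda>x. us' n (f x), \<lambda>x. vs' n (f x)))) \<longlonglongrightarrow> e - e'"
    using tendsto_diff[OF assms(6,7)] by (simp add: right_diff_distrib)
  ultimately show ?thesis using LIMSEQ_unique by fastforce
qed

text \<open>The core of \<open>F\<close> provides approximating sequences: convergence in the form norm on \<open>V\<close> gives
  convergence almost everywhere along a subsequence, and energies are the same on \<open>U\<close>.\<close>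

lemma approx_seq_of_mem:
  assumes R: "regular_dirichlet_form V (dx_on V) (half_dirichlet V F)" and sub: "F \<subseteq> H10 V" and u: "u \<in> F"
  obtains us where "approx_seq (pulled_domain F) us u" "\<And>n. us n \<in> F \<inter> Cc V"
    "energy_conv V us u"
proof -
  interpret FV: markovian_form "dx_on V" F "dirichlet_integral V" by (rule regular_half_dirichletD(1)[OF R])
  note RU = regular_pulled_domain[OF R sub]
  have mU: "markovian_form (dx_on U) (pulled_domain F) (dirichlet_integral U)" by (rule regular_half_dirichletD(1)[OF RU(1)])
  interpret FU: markovian_form "dx_on U" "pulled_domain F" "dirichlet_integral U" by (rule mU)
  obtain w where w: "\<And>n::nat. w n \<in> F \<inter> Cc V"
    "energy_conv V w u"
    "mean_conv (dx_on V) w u"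
    using regular_half_dirichlet_core[OF R u] by blast
  have wF: "w n \<in> F" and wC: "w n \<in> Cc V" and wH: "w n \<in> H10 V \<inter> Cc V" for n using w(1)[of n] sub by auto
  obtain r :: "nat \<Rightarrow> nat" where r: "strict_mono r" "AE x in dx_on V. (\<lambda>n. w (r n) x - u x) \<longlonglongrightarrow> 0"
    using sq_int_AE_subseq[of "\<lambda>n x. w n x - u x", OF sq_int.diff_mem[OF FV.mem_sq_int[OF wF] FV.mem_sq_int[OF u]] w(3)]
    by blast
  have wm: "w n \<in> borel_measurable (dx_on V)" for n by (rule FV.mem_measurable[OF wF])
  have pw: "pull f U (w n) \<in> pulled_domain F" for n
    using RU(3) w(1) unfolding pulled_core_def by blast
  have wU: "(\<lambda>x. w n (f x)) \<in> pulled_domain F" for n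
    using pw comp_mem_iff[OF mU wm] by blast
  have lim: "(\<lambda>n. energy V (\<lambda>x. w (r n) x - u x)) \<longlonglongrightarrow> 0"
    using LIMSEQ_subseq_LIMSEQ[OF w(2) r(1)] by (simp add: comp_def)
  have "FV.Cauchy_seq (\<lambda>n. w (r n))" by (rule FV.convergent_Cauchy_seq[OF wF u lim])
  moreover have "energy U (\<lambda>x. w m (f x) - w n (f x)) =
      energy V (\<lambda>x. w m x - w n x)" for m n
  proof -
    have d: "(\<lambda>x. w m x - w n x) \<in> H10 V \<inter> Cc V"
      using FV.diff_mem[OF wF[of m] wF[of n]] sub Cc_add[OF wC[of m] Cc_scale[OF wC[of n], of "-1"]] by auto
    have "energy U (\<lambda>x. w m (f x) - w n (f x)) =
        FU.sq (\<lambda>x. pull f U (w m) x - pull f U (w n) x)"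
      by (rule FU.AE_cong_sq[OF FU.diff_mem[OF wU wU] FU.diff_mem[OF pw pw]])
        (rule AE_I2, simp add: space_dx_on pull_def)
    also have "\<dots> = energy V (\<lambda>x. w m x - w n x)"
      using dirichlet_integral_pull[OF d d] unfolding pull_diff .
    finally show ?thesis .
  qed
  ultimately have C: "FU.Cauchy_seq (\<lambda>n x. w (r n) (f x))"
    unfolding FU.Cauchy_seq_def FV.Cauchy_seq_def by simp
  have "AE x in dx_on V. (\<lambda>n. w (r n) x) \<longlonglongrightarrow> u x" using r(2) by (simp add: LIM_zero_iff)
  from AE_comp[OF this] have "approx_seq (pulled_domain F) (\<lambda>n. w (r n)) u"
    unfolding approx_seq_def using wm wU C by blast
  then show ?thesis using that lim w(1) by blast
qed

text \<open>An approximating sequence on \<open>U\<close> consists of arbitrary members of the closure, whose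
  counterparts on \<open>V\<close> need not be square integrable.  Replacing each by a nearby member of the core
  keeps the limit, along a subsequence, and makes it possible to push the sequence forward to \<open>V\<close>,
  where \<open>extended_limit\<close> applies.\<close>

lemma mem_of_approx_seq:
  assumes R: "regular_dirichlet_form V (dx_on V) (half_dirichlet V F)" and sub: "F \<subseteq> H10 V"
    and u: "u \<in> sq_int (dx_on V)" and us: "approx_seq (pulled_domain F) us u"
  shows "u \<in> F"
proof -
  interpret FV: markovian_form "dx_on V" F "dirichlet_integral V" by (rule regular_half_dirichletD(1)[OF R])
  note RU = regular_pulled_domain[OF R sub]
  interpret HU: closed_form "dx_on U" "H10 U" "dirichlet_integral U" by (rule closed_form_H10[OF open_dom])
  interpret FU: markovian_form "dx_on U" "pulled_domain F" "dirichlet_integral U"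
    by (rule regular_half_dirichletD(1)[OF RU(1)])
  define h where "h n x = us n (f x)" for n x
  have hF: "h n \<in> pulled_domain F" and hC: "FU.Cauchy_seq h"
    and hlim: "AE x in dx_on U. (\<lambda>n. h n x) \<longlonglongrightarrow> u (f x)" for n
    using us unfolding approx_seq_def h_def by blast+
  have "\<forall>n. \<exists>w. w \<in> F \<inter> Cc V \<and> form_norm (dx_on U) (dirichlet_integral U) (\<lambda>x. h n x - pull f U w x) < 1 / real (Suc n)"
  proof
    fix n
    have "\<exists>v\<in>pulled_core F. form_norm (dx_on U) (dirichlet_integral U) (\<lambda>x. h n x - v x) < 1 / real (Suc n)"
      using hF[of n] unfolding pulled_domain_def HU.form_closure_def by simp
    then show "\<exists>w. w \<in> F \<inter> Cc V \<and> form_norm (dx_on U) (dirichlet_integral U) (\<lambda>x. h n x - pull f U w x) < 1 / real (Suc n)"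
      unfolding pulled_core_def by blast
  qed
  from choice[OF this] obtain w where w: "\<And>n. w n \<in> F \<inter> Cc V"
    "\<And>n. form_norm (dx_on U) (dirichlet_integral U) (\<lambda>x. h n x - pull f U (w n) x) < 1 / real (Suc n)" by blast
  define c where "c n = pull f U (w n)" for n
  have wF: "w n \<in> F" and wC: "w n \<in> Cc V" for n using w(1)[of n] by auto
  have cF: "c n \<in> pulled_domain F" for n
    using RU(3) w(1) unfolding pulled_core_def c_def by blast
  have dF: "(\<lambda>x. h n x - c n x) \<in> pulled_domain F" for n by (rule FU.diff_mem[OF hF cF])
  have "(\<lambda>n. form_norm (dx_on U) (dirichlet_integral U) (\<lambda>x. h n x - c n x)) \<longlonglongrightarrow> 0"
  proof (rule Lim_null_comparison)
    show "\<forall>\<^sub>F n in sequentially. norm (form_norm (dx_on U) (dirichlet_integral U) (\<lambda>x. h n x - c n x)) \<le> 1 / real (Suc n)"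
      using w(2) FU.E1.nonneg[OF dF] unfolding c_def[symmetric]
      by (intro always_eventually allI) (simp add: FU.form_norm_eq less_imp_le)
    show "(\<lambda>n. 1 / real (Suc n)) \<longlonglongrightarrow> 0" by (intro LIMSEQ_Suc lim_1_over_n)
  qed
  then have d0: "(\<lambda>n. FU.sq (\<lambda>x. h n x - c n x)) \<longlonglongrightarrow> 0"
    "(\<lambda>n. mean_sq (dx_on U) (\<lambda>x. h n x - c n x)) \<longlonglongrightarrow> 0"
    using FU.form_norm_tendsto_0_iff[of "\<lambda>n x. h n x - c n x", OF dF]
      FU.E1_tendsto_0_iff[of "\<lambda>n x. h n x - c n x", OF dF] by blast+
  obtain r :: "nat \<Rightarrow> nat" where r: "strict_mono r" "AE x in dx_on U. (\<lambda>n. h (r n) x - c (r n) x) \<longlonglongrightarrow> 0"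
    using sq_int_AE_subseq[of "\<lambda>n x. h n x - c n x", OF FU.mem_sq_int[OF dF] d0(2)] by blast
  have clim: "AE x in dx_on U. (\<lambda>n. c (r n) x) \<longlonglongrightarrow> u (f x)"
    using hlim r(2)
  proof eventually_elim
    case (elim x)
    have "(\<lambda>n. h (r n) x) \<longlonglongrightarrow> u (f x)" using LIMSEQ_subseq_LIMSEQ[OF elim(1) r(1)] by (simp add: comp_def)
    from tendsto_diff[OF this elim(2)] show ?case by simp
  qed
  interpret G: conformal g f V U by (rule conformal_sym[OF conformal_axioms])
  have "AE y in dx_on V. (\<lambda>n. c (r n) (g y)) \<longlonglongrightarrow> u (f (g y))" by (rule G.AE_comp[OF clim])
  moreover have "AE y in dx_on V. y \<in> V" by (rule AE_I2) (simp add: space_dx_on)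
  ultimately have wlim: "AE y in dx_on V. (\<lambda>n. w (r n) y) \<longlonglongrightarrow> u y"
    by eventually_elim (simp add: c_def pull_def maps_inv inv')
  have d0C: "FU.Cauchy_seq (\<lambda>n x. h n x - c n x)"
    by (rule FU.convergent_Cauchy_seq[OF dF FU.zero_mem]) (use d0(1) in simp)
  have "FU.Cauchy_seq (\<lambda>n x. h n x - (h n x - c n x))"
    by (rule FU.Cauchy_seq_diff[of h "\<lambda>n x. h n x - c n x", OF hF dF hC d0C])
  then have cC: "FU.Cauchy_seq c" by simp
  have eq: "FU.sq (\<lambda>x. c m x - c n x) = FV.sq (\<lambda>x. w m x - w n x)" for m n
  proof -
    have d: "(\<lambda>x. w m x - w n x) \<in> H10 V \<inter> Cc V"
      using FV.diff_mem[OF wF[of m] wF[of n]] sub Cc_add[OF wC[of m] Cc_scale[OF wC[of n], of "-1"]] by auto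
    show ?thesis using dirichlet_integral_pull[OF d d] unfolding pull_diff c_def .
  qed
  have "FV.Cauchy_seq (\<lambda>n. w (r n))" unfolding FV.Cauchy_seq_def
  proof (intro allI impI)
    fix \<epsilon> :: real assume "\<epsilon> > 0"
    then obtain N where N: "\<forall>m\<ge>N. \<forall>n\<ge>N. FU.sq (\<lambda>x. c m x - c n x) < \<epsilon>"
      using cC unfolding FU.Cauchy_seq_def by blast
    have "r n \<ge> n" for n by (rule seq_suble[OF r(1)])
    then show "\<exists>N. \<forall>m\<ge>N. \<forall>n\<ge>N. FV.sq (\<lambda>x. w (r m) x - w (r n) x) < \<epsilon>"
      using N unfolding eq by (meson le_trans)
  qed
  from FV.extended_limit(1)[of "\<lambda>n. w (r n)", OF wF this wlim u] show ?thesis .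
qed

text \<open>Energies along the approximating sequences from the core agree on \<open>U\<close> and \<open>V\<close>, so that the
  extended form is the limit of the energies on \<open>V\<close>.\<close>

lemma transform_pulled_domain:
  assumes R: "regular_dirichlet_form V (dx_on V) (half_dirichlet V F)" and sub: "F \<subseteq> H10 V"
  shows "transform_and_time_change f U V (half_dirichlet U (pulled_domain F)) = half_dirichlet V F"
proof -
  interpret FV: markovian_form "dx_on V" F "dirichlet_integral V" by (rule regular_half_dirichletD(1)[OF R])
  note RU = regular_pulled_domain[OF R sub]
  have mU: "markovian_form (dx_on U) (pulled_domain F) (dirichlet_integral U)" by (rule regular_half_dirichletD(1)[OF RU(1)])
  interpret FU: markovian_form "dx_on U" "pulled_domain F" "dirichlet_integral U" by (rule mU)
  have dom: "{u \<in> sq_int (dx_on V). \<exists>us. approx_seq (pulled_domain F) us u} = F"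
  proof
    show "{u \<in> sq_int (dx_on V). \<exists>us. approx_seq (pulled_domain F) us u} \<subseteq> F"
      using mem_of_approx_seq[OF R sub] by auto
    show "F \<subseteq> {u \<in> sq_int (dx_on V). \<exists>us. approx_seq (pulled_domain F) us u}"
    proof
      fix u assume u: "u \<in> F"
      obtain us where "approx_seq (pulled_domain F) us u" using approx_seq_of_mem[OF R sub u] by metis
      with FV.mem_sq_int[OF u] show "u \<in> {u \<in> sq_int (dx_on V). \<exists>us. approx_seq (pulled_domain F) us u}" by auto
    qed
  qed
  have val: "(THE e. \<exists>us vs. approx_seq (pulled_domain F) us u \<and> approx_seq (pulled_domain F) vs v \<and>
      (\<lambda>n. 1/2 * dirichlet_integral U (\<lambda>x. us n (f x), \<lambda>x. vs n (f x))) \<longlonglongrightarrow> e) = 1/2 * dirichlet_integral V (u, v)"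
    if uv: "u \<in> F" "v \<in> F" for u v
  proof -
    obtain us where us: "approx_seq (pulled_domain F) us u" "\<And>n. us n \<in> F \<inter> Cc V"
      "energy_conv V us u"
      using approx_seq_of_mem[OF R sub uv(1)] by blast
    obtain vs where vs: "approx_seq (pulled_domain F) vs v" "\<And>n. vs n \<in> F \<inter> Cc V"
      "energy_conv V vs v"
      using approx_seq_of_mem[OF R sub uv(2)] by blast
    have F: "us n \<in> F" "vs n \<in> F" for n using us(2) vs(2) by auto
    have eq: "dirichlet_integral U (\<lambda>x. us n (f x), \<lambda>x. vs n (f x)) = dirichlet_integral V (us n, vs n)" for n
    proof -
      have H: "us n \<in> H10 V \<inter> Cc V" "vs n \<in> H10 V \<inter> Cc V" using us(2) vs(2) sub by auto
      have pF: "pull f U (us n) \<in> pulled_domain F" "pull f U (vs n) \<in> pulled_domain F"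
        using RU(3) us(2) vs(2) unfolding pulled_core_def by blast+
      have cF: "(\<lambda>x. us n (f x)) \<in> pulled_domain F" "(\<lambda>x. vs n (f x)) \<in> pulled_domain F"
        using us(1) vs(1) unfolding approx_seq_def by blast+
      have ae: "AE x in dx_on U. us n (f x) = pull f U (us n) x" "AE x in dx_on U. vs n (f x) = pull f U (vs n) x"
        by (rule AE_I2, simp add: space_dx_on pull_def)+
      have "dirichlet_integral U (\<lambda>x. us n (f x), \<lambda>x. vs n (f x)) = dirichlet_integral U (pull f U (us n), \<lambda>x. vs n (f x))"
        by (rule FU.AE_cong_left[OF cF(1) pF(1) cF(2) ae(1)])
      also have "\<dots> = dirichlet_integral U (\<lambda>x. vs n (f x), pull f U (us n))" by (rule FU.sym[OF pF(1) cF(2)])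
      also have "\<dots> = dirichlet_integral U (pull f U (vs n), pull f U (us n))"
        by (rule FU.AE_cong_left[OF cF(2) pF(2) pF(1) ae(2)])
      also have "\<dots> = dirichlet_integral V (vs n, us n)" by (rule dirichlet_integral_pull[OF H(2,1)])
      also have "\<dots> = dirichlet_integral V (us n, vs n)" by (rule FV.sym[OF F(2,1)])
      finally show ?thesis .
    qed
    have "(\<lambda>n. dirichlet_integral V (us n, vs n)) \<longlonglongrightarrow> dirichlet_integral V (u, v)"
      by (rule FV.tendsto_form[OF F uv us(3) vs(3)])
    then have lim: "(\<lambda>n. 1/2 * dirichlet_integral U (\<lambda>x. us n (f x), \<lambda>x. vs n (f x))) \<longlonglongrightarrow> 1/2 * dirichlet_integral V (u, v)"
      unfolding eq by (intro tendsto_intros)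
    show ?thesis
    proof (rule the_equality)
      show "\<exists>us vs. approx_seq (pulled_domain F) us u \<and> approx_seq (pulled_domain F) vs v \<and>
          (\<lambda>n. 1/2 * dirichlet_integral U (\<lambda>x. us n (f x), \<lambda>x. vs n (f x))) \<longlonglongrightarrow> 1/2 * dirichlet_integral V (u, v)"
        using us(1) vs(1) lim by blast
      show "e = 1/2 * dirichlet_integral V (u, v)"
        if "\<exists>us vs. approx_seq (pulled_domain F) us u \<and> approx_seq (pulled_domain F) vs v \<and>
          (\<lambda>n. 1/2 * dirichlet_integral U (\<lambda>x. us n (f x), \<lambda>x. vs n (f x))) \<longlonglongrightarrow> e" for e
        using that approx_seq_unique[OF mU _ us(1) _ vs(1) _ lim] by blast
    qed
  qed
  have "restrict (\<lambda>(u, v). THE e. \<exists>us vs. approx_seq (pulled_domain F) us u \<and> approx_seq (pulled_domain F) vs v \<and>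
      (\<lambda>n. 1/2 * dirichlet_integral U (\<lambda>x. us n (f x), \<lambda>x. vs n (f x))) \<longlonglongrightarrow> e) (F \<times> F) =
      restrict (\<lambda>(u, v). 1/2 * dirichlet_integral V (u, v)) (F \<times> F)"
    by (rule restrict_ext) (use val in auto)
  then show ?thesis unfolding transform_half_dirichlet[OF mU] dom unfolding half_dirichlet_def by (simp only:)
qed

text \<open>A regular subspace is the closure of its compactly supported continuous members, and these
  are determined by the transformed form.\<close>

lemma transform_inj:
  assumes R: "regular_dirichlet_form U (dx_on U) (half_dirichlet U F')" and sub: "F' \<subseteq> H10 U"
    and T: "half_dirichlet V F = transform_and_time_change f U V (half_dirichlet U F')"
  shows "F' = pulled_domain F"
proof -
  have mU: "markovian_form (dx_on U) F' (dirichlet_integral U)" by (rule regular_half_dirichletD(1)[OF R])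
  interpret FU: markovian_form "dx_on U" F' "dirichlet_integral U" by (rule mU)
  interpret HU: closed_form "dx_on U" "H10 U" "dirichlet_integral U" by (rule closed_form_H10[OF open_dom])
  have dom: "F = {u \<in> sq_int (dx_on V). \<exists>us. approx_seq F' us u}"
    using arg_cong[OF T, of snd] unfolding transform_half_dirichlet[OF mU] unfolding half_dirichlet_def snd_conv .
  have core: "F' \<inter> Cc U = pulled_core F"
  proof
    show "F' \<inter> Cc U \<subseteq> pulled_core F"
    proof
      fix c assume c: "c \<in> F' \<inter> Cc U"
      define w where "w = pull g V c"
      have wC: "w \<in> Cc V" and cw: "c = pull f U w" unfolding w_def using pull_back_Cc pull_pull' c by auto
      have wL: "w \<in> sq_int (dx_on V)" by (rule Cc_sq_int[OF open_ran wC])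
      have "(\<lambda>x. w (f x)) \<in> F'" using comp_mem_iff[OF mU sq_int_measurable[OF wL]] c cw by blast
      then have "approx_seq F' (\<lambda>_. w) w"
        unfolding approx_seq_def FU.Cauchy_seq_def using sq_int_measurable[OF wL] FU.zero_left[OF FU.zero_mem] by auto
      then have "w \<in> F" unfolding dom using wL by blast
      with wC cw show "c \<in> pulled_core F" unfolding pulled_core_def by blast
    qed
    show "pulled_core F \<subseteq> F' \<inter> Cc U"
    proof
      fix c assume "c \<in> pulled_core F"
      then obtain w where w: "w \<in> F" "w \<in> Cc V" "c = pull f U w" unfolding pulled_core_def by blast
      obtain us where us: "approx_seq F' us w" using w(1) dom by blast
      have wL: "w \<in> sq_int (dx_on V)" by (rule Cc_sq_int[OF open_ran w(2)])
      have pL: "pull f U w \<in> sq_int (dx_on U)" by (rule Cc_sq_int[OF open_dom pull_Cc[OF w(2)]])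
      have ae: "AE x in dx_on U. norm (w (f x)) \<le> norm (pull f U w x)"
        by (rule AE_I2) (simp add: space_dx_on pull_def)
      have wfL: "(\<lambda>x. w (f x)) \<in> sq_int (dx_on U)"
        by (rule sq_int_bound[OF pL measurable_comp[OF sq_int_measurable[OF wL]] ae])
      have "(\<lambda>x. w (f x)) \<in> F'"
        using us unfolding approx_seq_def
        by (intro FU.extended_limit(1)[of "\<lambda>n x. us n (f x)" "\<lambda>x. w (f x)"] wfL) blast+
      then have "c \<in> F'" using comp_mem_iff[OF mU sq_int_measurable[OF wL]] w(3) by blast
      with w(2,3) pull_Cc show "c \<in> F' \<inter> Cc U" by blast
    qed
  qed
  have CH: "pulled_core F \<subseteq> H10 U" using core sub by blast
  show ?thesis
  proof
    show "F' \<subseteq> pulled_domain F"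
    proof
      fix u assume u: "u \<in> F'"
      obtain w where "\<And>n::nat. w n \<in> F' \<inter> Cc U"
        "energy_conv U w u"
        "mean_conv (dx_on U) w u"
        using regular_half_dirichlet_core[OF R u] by blast
      then show "u \<in> pulled_domain F"
        using HU.form_closureI[OF CH, of u w] u sub core unfolding pulled_domain_def by blast
    qed
    show "pulled_domain F \<subseteq> F'"
    proof
      fix u assume u: "u \<in> pulled_domain F"
      obtain w where w: "\<And>n::nat. w n \<in> pulled_core F"
        "energy_conv U w u"
        "mean_conv (dx_on U) w u"
        using HU.form_closureE[OF CH u[unfolded pulled_domain_def]] by blast
      have uH: "u \<in> H10 U" using u HU.form_closure_sub unfolding pulled_domain_def by blast
      have wF: "w n \<in> F'" and wH: "w n \<in> H10 U" for n using w(1)[of n] core sub by auto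
      have "FU.Cauchy_seq w" by (rule HU.convergent_Cauchy_seq[OF wH uH w(2)])
      then show "u \<in> F'" by (rule FU.Cauchy_limit(1)[OF wF _ HU.mem_sq_int[OF uH] w(3)])
    qed
  qed
qed

end

theorem proposition3p6:
  fixes U V :: "complex set" and f :: "complex \<Rightarrow> complex"
  assumes "nontrivial_sc_domain U" and "nontrivial_sc_domain V"
    and "biholomorphic f U V"
  shows "\<forall>A\<^sub>V. regular_subspace V (dx_on V) A\<^sub>V (absorbing_BM_form V) \<longrightarrow>
           (\<exists>!A\<^sub>U. regular_subspace U (dx_on U) A\<^sub>U (absorbing_BM_form U) \<and>
                  A\<^sub>V = transform_and_time_change f U V A\<^sub>U)"
proof (intro allI impI)
  fix A\<^sub>V assume A: "regular_subspace V (dx_on V) A\<^sub>V (absorbing_BM_form V)"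
  interpret conformal f "the_inv_into U f" U V
    using assms by (intro biholomorphic_imp_conformal) (auto simp: nontrivial_sc_domain_def)
  obtain E F where EF: "A\<^sub>V = (E, F)" by (cases A\<^sub>V)
  have AV: "A\<^sub>V = half_dirichlet V F" and sub: "F \<subseteq> H10 V"
    using regular_subspace_eq_half_dirichlet A unfolding EF by blast+
  have R: "regular_dirichlet_form V (dx_on V) (half_dirichlet V F)"
    and RH: "regular_dirichlet_form V (dx_on V) (half_dirichlet V (H10 V))"
    using A unfolding AV regular_subspace_half_dirichlet_iff by blast+
  have RU: "regular_dirichlet_form U (dx_on U) (half_dirichlet U (H10 U))"
    using regular_pulled_domain(1)[OF RH order_refl] unfolding pulled_domain_H10 .
  show "\<exists>!A\<^sub>U. regular_subspace U (dx_on U) A\<^sub>U (absorbing_BM_form U) \<and>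
      A\<^sub>V = transform_and_time_change f U V A\<^sub>U"
  proof (rule ex1I)
    show "regular_subspace U (dx_on U) (half_dirichlet U (pulled_domain F)) (absorbing_BM_form U) \<and>
        A\<^sub>V = transform_and_time_change f U V (half_dirichlet U (pulled_domain F))"
      unfolding regular_subspace_half_dirichlet_iff transform_pulled_domain[OF R sub] AV
      using regular_pulled_domain[OF R sub] RU by blast
  next
    fix A\<^sub>U
    assume AU: "regular_subspace U (dx_on U) A\<^sub>U (absorbing_BM_form U) \<and>
      A\<^sub>V = transform_and_time_change f U V A\<^sub>U"
    obtain E' F' where EF': "A\<^sub>U = (E', F')" by (cases A\<^sub>U)
    have eq: "A\<^sub>U = half_dirichlet U F'" and sub': "F' \<subseteq> H10 U"
      using regular_subspace_eq_half_dirichlet AU unfolding EF' by blast+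
    have "regular_dirichlet_form U (dx_on U) (half_dirichlet U F')"
      "half_dirichlet V F = transform_and_time_change f U V (half_dirichlet U F')"
      using AU unfolding eq AV regular_subspace_half_dirichlet_iff by blast+
    from transform_inj[OF this(1) sub' this(2)] show "A\<^sub>U = half_dirichlet U (pulled_domain F)"
      unfolding eq by simp
  qed
qed

end
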